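(* 1. There is an $SU(2)$-equivariant fibration $\pi:\mathcal{O}_x^{\mathbb{C}}\to\mathcal{O}_x$ of the complex (co-)adjoint orbit $$\mathcal{O}_x^{\mathbb{C}}\simeq\{(\ell_1,\ell_2)\in\mathbb{CP}^1\times\mathbb{CP}^1:\ \ell_1\oplus\ell_2=\mathbb{C}^2\}$$ over the compact (co-)adjoint orbit $\mathcal{O}_x\simeq\mathbb{CP}^1\simeq\mathbb{S}^2$, given by $$\pi(\mathrm{Ad}(k\cdot f\cdot e)(x))=\mathrm{Ad}(k)(x),\qquad (k,f,e)\in SU(2)\times\exp i\mathfrak{m}\times\exp i\mathfrak{t}.$$ In particular, the fiber $\pi^{-1}(x)$ over $x\in\mathcal{O}_x$ is $\mathrm{Ad}(e^{i\mathfrak{m}})(x)=\mathcal{O}_x^{n.c.}\simeq\mathbb{H}^2$. 2. Moreover, the complex (co-)adjoint orbit is isomorphic to the (co-)tangent bundle of $\mathbb{CP}^1$ via the following $SU(2)$-equivariant diffeomorphism: $$\Phi: T\mathbb{CP}^1=T\mathcal{O}_x\to\mathcal{O}_x^{\mathbb{C}},\qquad (z=gxg^{-1},\ v=g\mathfrak{a}g^{-1})\longmapsto g\,e^{i\mathfrak{a}}\,x\,e^{-i\mathfrak{a}}\,g^{-1},$$ where $g\in SU(2)$ and $\mathfrak{a}\in\mathfrak{m}$. In other words, $\mathcal{O}_x^{\mathbb{C}}$ is the complexification of the compact orbit $\mathcal{O}_x\simeq\mathbb{CP}^1$ and is isomorphic to the tangent bundle of $\mathbb{CP}^1$; the hyperbolic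 space $\mathbb{H}^2$ sits inside $\mathcal{O}_x^{\mathbb{C}}$ as the fiber over $x\in\mathcal{O}_x\simeq\mathbb{CP}^1$ and is the orbit of $x$ under the adjoint action of $SU(1,1)\subset SL(2,\mathbb{C})$.
   Context: $x:=\begin{pmatrix}i&0\\0&-i\end{pmatrix}\in\mathfrak{su}(2)$ and $\mathrm{Ad}(g)(y)=gyg^{-1}$. $\mathcal{O}_x$, $\mathcal{O}_x^{\mathbb{C}}$, $\mathcal{O}_x^{n.c.}$ denote the orbits of $x$ under the adjoint actions of $SU(2)$, $SL(2,\mathbb{C})$ and $SU(1,1):=\left\{\begin{pmatrix}a&b\\ \bar b&\bar a\end{pmatrix}:|a|^2-|b|^2=1\right\}$ respectively (adjoint and coadjoint orbits are identified via the Killing form). The identification $\mathcal{O}_x\simeq\mathbb{CP}^1$ sends $y\in\mathcal{O}_x$ to its eigenline $\mathrm{Eig}(i)$ for the eigenvalue $i$; the identification of $\mathcal{O}_x^{\mathbb{C}}$ with pairs of lines sends $y$ to $(\ell_1,\ell_2)=(\mathrm{Eig}(i),\mathrm{Eig}(-i))$. $\mathbb{H}^2=\{z\in\mathbb{C}:|z|<1\}$, and the identification $\mathcal{O}_x^{n.c.}\simeq SU(1,1)/U(1)\simeq\mathbb{H}^2$ sends $\mathrm{Ad}\begin{pmatrix}a&b\\ \bar b&\bar a\end{pmatrix}(x)$ to $b/\bar a$. $\mathfrak{t}=\left\{\begin{pmatrix}i\theta&0\\0&-i\theta\end{pmatrix}:\theta\in\mathbb{R}\right\}$ is the Lie algebra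 of the stabilizer of $x$ in $SU(2)$, and $\mathfrak{m}=\left\{\begin{pmatrix}0&-\bar c\\c&0\end{pmatrix}:c\in\mathbb{C}\right\}$ is its orthogonal complement in $\mathfrak{su}(2)$ for the Killing form; $i\mathfrak{t}$ and $i\mathfrak{m}$ are their multiples by $i$ inside $\mathfrak{sl}(2,\mathbb{C})$. By Mostow's decomposition theorem, every element of $SL(2,\mathbb{C})$ can be written uniquely as $k\cdot f\cdot e$ with $k\in SU(2)$, $f\in\exp i\mathfrak{m}$, $e\in\exp i\mathfrak{t}$. The tangent space $T_x\mathcal{O}_x$ is identified with $\mathfrak{m}=\mathfrak{su}(2)/\mathfrak{t}$, and $T_{gxg^{-1}}\mathcal{O}_x$ with $g\mathfrak{m}g^{-1}$ for $g\in SU(2)$ (note that $\mathfrak{m}$ is stable under the adjoint action of the stabilizer of $x$). $SU(2)$ acts on $\mathcal{O}_x$ and $\mathcal{O}_x^{\mathbb{C}}$ by $\mathrm{Ad}$, and on $T\mathcal{O}_x$ by the induced action $h\cdot(z,v)=(hzh^{-1},hvh^{-1})$. *)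

theory Defs
  imports "HOL-Analysis.Analysis"
begin

type_synonym cmat = "complex^2^2"

definition mat2 :: "complex \<Rightarrow> complex \<Rightarrow> complex \<Rightarrow> complex \<Rightarrow> cmat" where
  "mat2 a b c d = vector [vector [a, b], vector [c, d]]"

definition cscale :: "complex \<Rightarrow> cmat \<Rightarrow> cmat"  (infixr \<open>*\<^sub>M\<close> 75) where
  "c *\<^sub>M A = map_matrix ((*) c) A"

definition ctransp :: "cmat \<Rightarrow> cmat" where
  "ctransp A = map_matrix cnj (transpose A)"

text \<open>The library multiplies vectors componentwise, so neither the power operation nor
  \<^const>\<open>exp\<close> refers to the matrix product; hence the explicit power series.\<close>

definition mexp :: "cmat \<Rightarrow> cmat" where
  "mexp A = (\<Sum>n. (1 / fact n) *\<^sub>R (((**) A) ^^ n) (mat 1))"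

definition lie_bracket :: "cmat \<Rightarrow> cmat \<Rightarrow> cmat" where
  "lie_bracket A B = A ** B - B ** A"

definition SU2 :: "cmat set" where
  "SU2 = {g. ctransp g ** g = mat 1 \<and> det g = 1}"

definition SL2C :: "cmat set" where
  "SL2C = {g. det g = 1}"

definition SU11 :: "cmat set" where
  "SU11 = {mat2 a b (cnj b) (cnj a) | a b. (cmod a)\<^sup>2 - (cmod b)\<^sup>2 = 1}"

definition Ad :: "cmat \<Rightarrow> cmat \<Rightarrow> cmat" where
  "Ad g y = g ** y ** matrix_inv g"

definition x0 :: cmat where
  "x0 = mat2 \<i> 0 0 (- \<i>)"

definition orbit :: "cmat set \<Rightarrow> cmat set" where
  "orbit G = (\<lambda>g. Ad g x0) ` G"

abbreviation Orb :: "cmat set" where "Orb \<equiv> orbit SU2"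
abbreviation OrbC :: "cmat set" where "OrbC \<equiv> orbit SL2C"
abbreviation OrbNC :: "cmat set" where "OrbNC \<equiv> orbit SU11"

definition tt :: "cmat set" where
  "tt = {mat2 (\<i> * of_real \<theta>) 0 0 (- \<i> * of_real \<theta>) | \<theta> :: real. True}"

definition mm :: "cmat set" where
  "mm = {mat2 0 (- cnj c) c 0 | c. True}"

definition exp_im :: "cmat set" where
  "exp_im = (\<lambda>a. mexp (\<i> *\<^sub>M a)) ` mm"

definition exp_it :: "cmat set" where
  "exp_it = (\<lambda>a. mexp (\<i> *\<^sub>M a)) ` tt"

text \<open>The fibre of the tangent bundle over \<open>g x g\<^sup>-\<^sup>1\<close> is \<open>g \<mm> g\<^sup>-\<^sup>1\<close>. A vector \<open>v\<close> of
  that fibre stands for the velocity at \<open>0\<close> of the curve \<open>t \<mapsto> Ad (exp (t v)) z\<close>, that is, for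
  the vector \<open>[v, z]\<close> of the ambient matrix space.\<close>

definition T_Orb :: "(cmat \<times> cmat) set" where
  "T_Orb = {(Ad g x0, Ad g a) | g a. g \<in> SU2 \<and> a \<in> mm}"

definition eigenspace :: "cmat \<Rightarrow> complex \<Rightarrow> (complex^2) set" where
  "eigenspace y c = {v. y *v v = c *s v}"

definition CP1 :: "(complex^2) set set" where
  "CP1 = {l. vec.subspace l \<and> vec.dim l = 1}"

definition complementary_lines :: "((complex^2) set \<times> (complex^2) set) set" where
  "complementary_lines = {(l1, l2). l1 \<in> CP1 \<and> l2 \<in> CP1 \<and>
     l1 \<inter> l2 = {0} \<and> {u + v | u v. u \<in> l1 \<and> v \<in> l2} = UNIV}"

text \<open>\<open>Ck_on k f U\<close> is meant for open sets \<open>U\<close>: \<open>f\<close> is \<open>k\<close> times continuously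
  differentiable on \<open>U\<close>, expressed by directional derivatives.\<close>

primrec Ck_on :: "nat \<Rightarrow> ('a::euclidean_space \<Rightarrow> 'b::real_normed_vector) \<Rightarrow> 'a set \<Rightarrow> bool" where
  "Ck_on 0 f U \<longleftrightarrow> continuous_on U f"
| "Ck_on (Suc k) f U \<longleftrightarrow> (\<forall>p\<in>U. f differentiable (at p)) \<and>
     (\<forall>v. Ck_on k (\<lambda>p. frechet_derivative f (at p) v) U)"

text \<open>A function on an arbitrary subset of a Euclidean space is smooth if it extends locally to
  \<open>C\<^sup>\<infinity>\<close> functions on open sets. On embedded submanifolds this is the usual smoothness.\<close>

definition smooth_on :: "'a::euclidean_space set \<Rightarrow> ('a \<Rightarrow> 'b::real_normed_vector) \<Rightarrow> bool" where
  "smooth_on S f \<longleftrightarrow> (\<forall>p\<in>S. \<exists>U F. open U \<and> p \<in> U \<and> (\<forall>k. Ck_on k F U) \<and> (\<forall>q\<in>S \<inter> U. F q = f q))"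

text \<open>An atlas is a set of pairs of a domain and an injective chart on it. Charts take values in
  arbitrary subsets of a Euclidean space, so a submanifold of a Euclidean space has the
  inclusion as a single global chart.\<close>

type_synonym ('a, 'e) atlas = "('a set \<times> ('a \<Rightarrow> 'e)) set"

definition points :: "('a, 'e) atlas \<Rightarrow> 'a set" where
  "points A = (\<Union>(U, \<phi>)\<in>A. U)"

definition smooth_map ::
  "('a, 'e::euclidean_space) atlas \<Rightarrow> ('b, 'f::euclidean_space) atlas \<Rightarrow> ('a \<Rightarrow> 'b) \<Rightarrow> bool" where
  "smooth_map A B f \<longleftrightarrow> (\<forall>p\<in>points A. \<exists>(U, \<phi>)\<in>A. \<exists>(V, \<psi>)\<in>B. \<exists>W.
     p \<in> U \<and> open W \<and> \<phi> p \<in> W \<and> (\<forall>q\<in>U. \<phi> q \<in> W \<longrightarrow> f q \<in> V) \<and>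
     smooth_on (\<phi> ` U \<inter> W) (\<lambda>t. \<psi> (f (inv_into U \<phi> t))))"

definition diffeo ::
  "('a, 'e::euclidean_space) atlas \<Rightarrow> ('b, 'f::euclidean_space) atlas \<Rightarrow> ('a \<Rightarrow> 'b) \<Rightarrow> bool" where
  "diffeo A B f \<longleftrightarrow> bij_betw f (points A) (points B) \<and>
     smooth_map A B f \<and> smooth_map B A (inv_into (points A) f)"

definition emb :: "'e::euclidean_space set \<Rightarrow> ('e, 'e) atlas" where
  "emb S = {(S, \<lambda>p. p)}"

definition prod_atlas :: "('a, 'e) atlas \<Rightarrow> ('b, 'f) atlas \<Rightarrow> ('a \<times> 'b, 'e \<times> 'f) atlas" where
  "prod_atlas A B = {(U \<times> V, map_prod \<phi> \<psi>) | U \<phi> V \<psi>. (U, \<phi>) \<in> A \<and> (V, \<psi>) \<in> B}"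

definition restrict_atlas :: "('a, 'e) atlas \<Rightarrow> 'a set \<Rightarrow> ('a, 'e) atlas" where
  "restrict_atlas A S = {(U \<inter> S, \<phi>) | U \<phi>. (U, \<phi>) \<in> A}"

text \<open>The two affine charts \<open>[1 : w] \<mapsto> w\<close> and \<open>[w : 1] \<mapsto> w\<close>.\<close>

definition CP1_atlas :: "((complex^2) set, complex) atlas" where
  "CP1_atlas =
    {({l \<in> CP1. \<exists>w. vector [1, w] \<in> l}, \<lambda>l. THE w. vector [1, w] \<in> l),
     ({l \<in> CP1. \<exists>w. vector [w, 1] \<in> l}, \<lambda>l. THE w. vector [w, 1] \<in> l)}"

definition complementary_lines_atlas ::
  "((complex^2) set \<times> (complex^2) set, complex \<times> complex) atlas" where
  "complementary_lines_atlas = restrict_atlas (prod_atlas CP1_atlas CP1_atlas) complementary_lines"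

definition smooth_fibre_bundle ::
  "'a::euclidean_space set \<Rightarrow> 'b::euclidean_space set \<Rightarrow> 'c::euclidean_space set \<Rightarrow> ('a \<Rightarrow> 'b) \<Rightarrow> bool"
  where
  "smooth_fibre_bundle E B F \<pi> \<longleftrightarrow> smooth_map (emb E) (emb B) \<pi> \<and> \<pi> ` E = B \<and>
     (\<forall>b\<in>B. \<exists>U \<psi>. openin (top_of_set B) U \<and> b \<in> U \<and>
        diffeo (emb {y \<in> E. \<pi> y \<in> U}) (emb (U \<times> F)) \<psi> \<and>
        (\<forall>y\<in>E. \<pi> y \<in> U \<longrightarrow> fst (\<psi> y) = \<pi> y))"

text \<open>Velocities of curves in \<open>S\<close>; for an embedded submanifold this is its tangent space at
  \<open>p\<close>, as a subspace of the ambient space.\<close>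

definition tangent_space :: "'a::euclidean_space set \<Rightarrow> 'a \<Rightarrow> 'a set" where
  "tangent_space S p = {v. \<exists>\<gamma>. \<gamma> 0 = p \<and> (\<forall>t::real. \<gamma> t \<in> S) \<and>
     (\<gamma> has_vector_derivative v) (at 0)}"

text \<open>\<open>N\<close> has complex tangent spaces and \<open>M\<close> is a totally real submanifold of \<open>N\<close> of maximal
  dimension: \<open>T\<^sub>z N = T\<^sub>z M \<oplus> \<i> T\<^sub>z M\<close>.\<close>

definition complexification_of :: "cmat set \<Rightarrow> cmat set \<Rightarrow> bool" where
  "complexification_of N M \<longleftrightarrow> M \<subseteq> N \<and>
     (\<forall>y\<in>N. \<forall>v\<in>tangent_space N y. \<i> *\<^sub>M v \<in> tangent_space N y) \<and>
     (\<forall>z\<in>M. tangent_space M z \<inter> (*\<^sub>M) \<i> ` tangent_space M z = {0} \<and>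
        tangent_space N z = {u + \<i> *\<^sub>M v | u v. u \<in> tangent_space M z \<and> v \<in> tangent_space M z})"

end

theory Submission
  imports Defs
begin

text \<open>Every \<open>y\<close> in the complex orbit satisfies \<open>y\<^sup>2 = - 1\<close>, so \<open>y\<close> is determined by its eigenlines
  for \<open>\<i>\<close> and \<open>- \<i>\<close>, and its polar decomposition can be written down: if \<open>A\<close> and \<open>B\<close> are its
  skew-Hermitian and Hermitian parts, then the unitary part is \<open>A / sqrt (det A)\<close>. Since
  \<open>Ad (k f e) x = (k f\<^sup>2 k\<^sup>-\<^sup>1) (k x k\<^sup>-\<^sup>1)\<close> is a product of a positive and a unitary matrix, the
  projection of the Mostow fibration is \<open>y \<mapsto> A / sqrt (det A)\<close>. For \<open>v \<in> T\<^sub>z\<close> one has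
  \<open>v\<^sup>2 = - det v\<close>, hence \<open>\<Phi> (z, v) = exp (2 \<i> v) z = cosh (2 r) z + (sinh (2 r) / r) \<i> v z\<close> with
  \<open>r\<^sup>2 = det v\<close>; the inverse recovers \<open>z\<close> as the unitary part and \<open>v\<close> from \<open>B\<close> and
  \<open>2 r = arcosh (sqrt (det A))\<close>. All maps are \<open>SU(2)\<close>-equivariant, so the identities need to be
  checked over \<open>x\<close> only, where the fibre is the hyperboloid \<open>SU(1,1)\<close>-orbit. Smoothness at the
  zero section holds because \<open>cosh (sqrt s)\<close> and \<open>sinh (sqrt s) / sqrt s\<close> are entire in \<open>s\<close> and
  \<open>arcosh\<^sup>2\<close> is smooth at \<open>1\<close>.\<close>

subsection \<open>Smooth functions\<close>

text \<open>The projection is defined by a formula in y alone, so it depends on no choice of (k, f,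
  e), and the formula of the fibration is verified afterwards. The square f^2 arises because x
  anticommutes with i m: x f^-1 = f x for f in exp (i m), hence f x f^-1 = f^2 x. Transported to z,
  the same anticommutation makes i v z Hermitian for v in T_z, so the skew-Hermitian part of exp (2
  i v) z is cosh (2 r) z, of determinant cosh^2 (2 r); this is why dividing by sqrt (det A) returns
  z. Local triviality meets a topological obstacle: SU(2) -> S^2 is the Hopf fibration and has no
  global section. Local sections come from quaternionic rotations, each defined away from one
  antipode. Tangent spaces become linear algebra: differentiating y^2 = -1 gives w y + y w = 0, and
  conversely every such w is the velocity of a rescaled line through y.\<close>

lemma Ck_on_cong:
  assumes "open U" "Ck_on k f U" "\<And>p. p \<in> U \<Longrightarrow> f p = g p"
  shows "Ck_on k g U"
  using assms(2,3)
proof (induction k arbitrary: f g)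
  case 0
  show ?case using 0 unfolding Ck_on.simps by (rule continuous_on_eq)
next
  case (Suc k)
  have D: "(g has_derivative frechet_derivative f (at p)) (at p)" if "p \<in> U" for p
  proof (rule has_derivative_transform_within_open[OF _ assms(1) that Suc.prems(2)])
    show "(f has_derivative frechet_derivative f (at p)) (at p)"
      using Suc.prems(1) that by (simp add: frechet_derivative_works)
  qed
  have E: "frechet_derivative f (at p) = frechet_derivative g (at p)" if "p \<in> U" for p
    by (rule frechet_derivative_at[OF D[OF that]])
  have "Ck_on k (\<lambda>p. frechet_derivative g (at p) v) U" for v
  proof (rule Suc.IH[of "\<lambda>p. frechet_derivative f (at p) v"])
    show "Ck_on k (\<lambda>p. frechet_derivative f (at p) v) U" using Suc.prems(1) by simp
    show "frechet_derivative f (at p) v = frechet_derivative g (at p) v" if "p \<in> U" for p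
      using E[OF that] by simp
  qed
  moreover have "g differentiable (at p)" if "p \<in> U" for p
    using D[OF that] unfolding differentiable_def by blast
  ultimately show ?case by simp
qed

text \<open>\<open>Ck_on\<close> refers to the chosen \<open>frechet_derivative\<close>; derivatives
  at a point are unique, so an explicit formula may replace it on an open set.\<close>

lemma Ck_on_SucI:
  assumes "open U" "\<And>p. p \<in> U \<Longrightarrow> (f has_derivative f' p) (at p)"
    "\<And>v. Ck_on k (\<lambda>p. f' p v) U"
  shows "Ck_on (Suc k) f U"
  using assms frechet_derivative_at[OF assms(2)]
  by (auto simp: differentiable_def intro!: Ck_on_cong[OF assms(1,3)])

lemma Ck_on_SucD:
  assumes "Ck_on (Suc k) f U"
  shows "\<And>p. p \<in> U \<Longrightarrow> (f has_derivative frechet_derivative f (at p)) (at p)"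
    "\<And>v. Ck_on k (\<lambda>p. frechet_derivative f (at p) v) U"
  using assms by (auto simp: frechet_derivative_works)

lemma Ck_on_Suc_imp: "Ck_on (Suc k) f U \<Longrightarrow> Ck_on k f U"
proof (induction k arbitrary: f)
  case 0
  then show ?case
    by (auto intro: continuous_at_imp_continuous_on differentiable_imp_continuous_within)
next
  case (Suc k)
  then show ?case by (metis Ck_on.simps(2))
qed

lemma Ck_on_subset: "Ck_on k f U \<Longrightarrow> V \<subseteq> U \<Longrightarrow> Ck_on k f V"
  by (induction k arbitrary: f) (auto intro: continuous_on_subset)

lemma Ck_on_const: "open U \<Longrightarrow> Ck_on k (\<lambda>p. c) U"
proof (induction k arbitrary: c)
  case (Suc k)
  then show ?case
    by (intro Ck_on_SucI[where f' = "\<lambda>p v. 0"]) auto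
qed simp

lemma Ck_on_linear: "open U \<Longrightarrow> bounded_linear f \<Longrightarrow> Ck_on k f U"
  by (cases k)
    (auto simp del: Ck_on.simps(2) intro!: Ck_on_SucI[where f' = "\<lambda>p. f"] Ck_on_const
      linear_continuous_on bounded_linear_imp_has_derivative)

lemma Ck_on_add:
  assumes "open U"
  shows "Ck_on k f U \<Longrightarrow> Ck_on k g U \<Longrightarrow> Ck_on k (\<lambda>p. f p + g p) U"
proof (induction k arbitrary: f g)
  case 0
  then show ?case by (auto intro: continuous_on_add)
next
  case (Suc k)
  show ?case
    using Ck_on_SucD[OF Suc.prems(1)] Ck_on_SucD[OF Suc.prems(2)]
    by (intro Ck_on_SucI[OF assms has_derivative_add] Suc.IH) auto
qed

lemma Ck_on_sum:
  assumes "open U"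
  shows "(\<And>i. i \<in> I \<Longrightarrow> Ck_on k (f i) U) \<Longrightarrow> Ck_on k (\<lambda>p. \<Sum>i\<in>I. f i p) U"
  using assms
  by (induction I rule: infinite_finite_induct) (auto intro!: Ck_on_add Ck_on_const)

lemma Ck_on_bilinear:
  assumes "open U" "bounded_bilinear B"
  shows "Ck_on k f U \<Longrightarrow> Ck_on k g U \<Longrightarrow> Ck_on k (\<lambda>p. B (f p) (g p)) U"
proof (induction k arbitrary: f g)
  case 0
  then show ?case by (auto intro: bounded_bilinear.continuous_on[OF assms(2)])
next
  case (Suc k)
  \<comment> \<open>The product rule pairs each derivative with an undifferentiated factor, so
    \<open>f\<close> and \<open>g\<close> are needed at the lower order as well.\<close>
  note f = Ck_on_SucD[OF Suc.prems(1)] Ck_on_Suc_imp[OF Suc.prems(1)]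
  note g = Ck_on_SucD[OF Suc.prems(2)] Ck_on_Suc_imp[OF Suc.prems(2)]
  show ?case
    by (rule Ck_on_SucI[OF assms(1) bounded_bilinear.FDERIV[OF assms(2) f(1) g(1)]])
      (auto intro!: Ck_on_add[OF assms(1)] Suc.IH f g)
qed

lemma Ck_on_compose:
  fixes f :: "'b::euclidean_space \<Rightarrow> 'c::real_normed_vector"
    and g :: "'a::euclidean_space \<Rightarrow> 'b"
  assumes "open U" "open V" "g ` U \<subseteq> V"
  shows "Ck_on k f V \<Longrightarrow> Ck_on k g U \<Longrightarrow> Ck_on k (\<lambda>p. f (g p)) U"
proof (induction k arbitrary: f)
  case 0
  then show ?case using assms(3) by (auto intro: continuous_on_compose2)
next
  case (Suc k)
  let ?f = "\<lambda>p. frechet_derivative f (at p)" and ?g = "\<lambda>p. frechet_derivative g (at p)"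
  note f = Ck_on_SucD[OF Suc.prems(1)]
  note g = Ck_on_SucD[OF Suc.prems(2)] Ck_on_Suc_imp[OF Suc.prems(2)]
  have "((\<lambda>p. f (g p)) has_derivative (\<lambda>v. ?f (g p) (?g p v))) (at p)" if "p \<in> U" for p
    using that assms(3) by (auto intro!: has_derivative_compose[OF g(1) f(1)])
  \<comment> \<open>In the chain rule p enters through the base point \<open>g p\<close> and through
    the direction \<open>?g p v\<close> at once, which the induction hypothesis cannot handle.
    Expanding the direction in the basis leaves products of functions to which it applies.\<close>
  moreover have "?f (g p) w = (\<Sum>b\<in>Basis. (w \<bullet> b) *\<^sub>R ?f (g p) b)" if "p \<in> U" for p w
  proof -
    interpret linear "?f (g p)"
      using f(1)[of "g p"] that assms(3) by (auto intro: has_derivative_linear)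
    have "?f (g p) w = ?f (g p) (\<Sum>b\<in>Basis. (w \<bullet> b) *\<^sub>R b)" by (simp only: euclidean_representation)
    then show ?thesis by (simp add: sum scaleR)
  qed
  ultimately have "((\<lambda>p. f (g p)) has_derivative
      (\<lambda>v. \<Sum>b\<in>Basis. (?g p v \<bullet> b) *\<^sub>R ?f (g p) b)) (at p)" if "p \<in> U" for p
    using that by simp
  then show ?case
    by (rule Ck_on_SucI[OF assms(1)])
      (auto intro!: Ck_on_sum Ck_on_bilinear[OF _ bounded_bilinear_scaleR] Suc.IH f g assms(1)
        Ck_on_bilinear[OF _ bounded_bilinear_inner] Ck_on_const)
qed

lemma Ck_on_Pair:
  fixes f :: "'a::euclidean_space \<Rightarrow> 'b::real_normed_vector"
    and g :: "'a \<Rightarrow> 'c::real_normed_vector"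
  assumes "open U" 
  shows "Ck_on k f U \<Longrightarrow> Ck_on k g U \<Longrightarrow> Ck_on k (\<lambda>p. (f p, g p)) U"
proof (induction k arbitrary: f g)
  case 0
  then show ?case by (auto intro: continuous_on_Pair)
next
  case (Suc k)
  show ?case
    using Ck_on_SucD[OF Suc.prems(1)] Ck_on_SucD[OF Suc.prems(2)]
    by (intro Ck_on_SucI[OF assms has_derivative_Pair] Suc.IH) auto
qed

text \<open>The derivative v |-> - x^-1 v x^-1 is built bilinearly from inversion itself, so the
  order rises by induction.\<close>

lemma Ck_on_inverse:
  "Ck_on k (inverse :: 'a \<Rightarrow> 'a::{euclidean_space, real_normed_div_algebra}) (- {0})"
proof (induction k)
  case 0
  show ?case unfolding Ck_on.simps by (rule continuous_on_inverse[OF continuous_on_id]) simp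
next
  case (Suc k)
  have "Ck_on k (\<lambda>x::'a. - (inverse x * v * inverse x)) (- {0})" for v
    by (rule Ck_on_compose[OF _ open_UNIV _
          Ck_on_linear[OF open_UNIV bounded_linear_minus[OF bounded_linear_ident]]])
      (auto intro!: Ck_on_bilinear[OF _ bounded_bilinear_mult] Suc Ck_on_const)
  then show ?case
    by (intro Ck_on_SucI[OF _ has_derivative_inverse']) auto
qed

lemma Ck_on_SucI_real:
  fixes f :: "real \<Rightarrow> real"
  assumes "open U" "\<And>x. x \<in> U \<Longrightarrow> (f has_real_derivative f' x) (at x)" "Ck_on k f' U"
  shows "Ck_on (Suc k) f U"
proof (rule Ck_on_SucI[OF assms(1)])
  show "(f has_derivative (\<lambda>v. v * f' p)) (at p)" if "p \<in> U" for p
    using assms(2)[OF that] by (simp add: has_field_derivative_def mult_commute_abs)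
  show "Ck_on k (\<lambda>p. v * f' p) U" for v
    by (intro Ck_on_bilinear[OF _ bounded_bilinear_mult] Ck_on_const assms)
qed

text \<open>Covers inverses of smooth functions and other solutions of an autonomous equation
  \<open>f' = h \<circ> f\<close>.\<close>

lemma Ck_on_autonomous:
  fixes f h :: "real \<Rightarrow> real"
  assumes U: "open U" and V: "open V" and fUV: "f ` U \<subseteq> V" and h: "\<And>k. Ck_on k h V"
    and f: "\<And>x. x \<in> U \<Longrightarrow> (f has_real_derivative h (f x)) (at x)"
  shows "Ck_on k f U"
proof (induction k)
  case 0
  show ?case
    using f DERIV_isCont by (auto intro!: continuous_at_imp_continuous_on)
next
  case (Suc k)
  show ?case
    by (rule Ck_on_SucI_real[OF U f Ck_on_compose[OF U V fUV h Suc]])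
qed

lemma Ck_on_sqrt: "Ck_on k sqrt {0<..}"
\<comment> \<open>The square root solves f' = 1 / (2 f).\<close>
proof (rule Ck_on_autonomous[where V = "{0<..}" and h = "\<lambda>x. inverse x * (1/2)"])
  show "Ck_on k (\<lambda>x::real. inverse x * (1/2)) {0<..}" for k
    by (intro Ck_on_bilinear[OF _ bounded_bilinear_mult] Ck_on_const
        Ck_on_subset[OF Ck_on_inverse]) auto
  show "(sqrt has_real_derivative inverse (sqrt x) * (1/2)) (at x)" if "x \<in> {0<..}" for x
    using DERIV_real_sqrt[of x] that by simp
qed auto

section \<open>Smoothness on arbitrary subsets of Euclidean spaces\<close>

lemma smooth_onI:
  "open U \<Longrightarrow> S \<subseteq> U \<Longrightarrow> (\<And>k. Ck_on k f U) \<Longrightarrow> smooth_on S f"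
  unfolding smooth_on_def by blast

lemma smooth_on_eq:
  assumes "smooth_on S f" "\<And>p. p \<in> S \<Longrightarrow> f p = g p"
  shows "smooth_on S g"
proof -
  have "(\<forall>q\<in>S \<inter> U. F q = f q) \<longleftrightarrow> (\<forall>q\<in>S \<inter> U. F q = g q)" for U and F :: "'a \<Rightarrow> 'b"
    using assms(2) by simp
  then show ?thesis using assms(1) unfolding smooth_on_def by simp
qed

lemma smooth_onE:
  assumes "smooth_on S f" "p \<in> S"
  obtains U F where "open U" "p \<in> U" "\<And>k. Ck_on k F U" "\<And>q. q \<in> S \<Longrightarrow> q \<in> U \<Longrightarrow> F q = f q"
proof -
  obtain U F where *: "open U \<and> p \<in> U \<and> (\<forall>k. Ck_on k F U) \<and> (\<forall>q\<in>S \<inter> U. F q = f q)"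
    using bspec[OF assms(1)[unfolded smooth_on_def] assms(2)] by (elim exE)
  show thesis
    by (rule that[of U F]) (simp_all add: *)
qed

lemma smooth_on_localI:
  assumes "\<And>p. p \<in> S \<Longrightarrow>
    \<exists>U F. open U \<and> p \<in> U \<and> (\<forall>k. Ck_on k F U) \<and> (\<forall>q\<in>S \<inter> U. F q = f q)"
  shows "smooth_on S f"
  unfolding smooth_on_def using assms by (rule ballI)

lemma smooth_on_subset:
  assumes "smooth_on T f" "S \<subseteq> T"
  shows "smooth_on S f"
proof (rule smooth_on_localI)
  fix p assume "p \<in> S"
  with assms obtain U F where "open U" "p \<in> U" "\<And>k. Ck_on k F U" "\<And>q. q \<in> T \<Longrightarrow> q \<in> U \<Longrightarrow> F q = f q"
    by (elim smooth_onE[of T f p]) auto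
  then show "\<exists>U F. open U \<and> p \<in> U \<and> (\<forall>k. Ck_on k F U) \<and> (\<forall>q\<in>S \<inter> U. F q = f q)"
    using assms(2) by (intro exI[of _ U] exI[of _ F]) auto
qed

lemma smooth_on_const [intro!]: "smooth_on S (\<lambda>p. c)"
  by (rule smooth_onI[of UNIV]) (auto intro: Ck_on_const)

lemma smooth_on_id [intro!]: "smooth_on S (\<lambda>p. p)"
  by (rule smooth_onI[of UNIV]) (auto intro: Ck_on_linear)

lemma smooth_on_Pair [intro!]:
  assumes "smooth_on S f" "smooth_on S g"
  shows "smooth_on S (\<lambda>p. (f p, g p))"
proof (rule smooth_on_localI)
  fix p assume "p \<in> S"
  obtain U F where U: "open U" "p \<in> U" "\<And>k. Ck_on k F U" "\<And>q. q \<in> S \<Longrightarrow> q \<in> U \<Longrightarrow> F q = f q"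
    by (rule smooth_onE[OF assms(1) \<open>p \<in> S\<close>]) (rule that)
  obtain V G where V: "open V" "p \<in> V" "\<And>k. Ck_on k G V" "\<And>q. q \<in> S \<Longrightarrow> q \<in> V \<Longrightarrow> G q = g q"
    by (rule smooth_onE[OF assms(2) \<open>p \<in> S\<close>]) (rule that)
  have "Ck_on k (\<lambda>p. (F p, G p)) (U \<inter> V)" for k
    by (rule Ck_on_Pair[OF open_Int[OF U(1) V(1)] Ck_on_subset[OF U(3)] Ck_on_subset[OF V(3)]])
      auto
  then show "\<exists>U F. open U \<and> p \<in> U \<and> (\<forall>k. Ck_on k F U) \<and> (\<forall>q\<in>S \<inter> U. F q = (f q, g q))"
    using U V by (intro exI[of _ "U \<inter> V"] exI[of _ "\<lambda>p. (F p, G p)"]) auto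
qed

lemma smooth_on_compose:
  assumes f: "smooth_on T f" and g: "smooth_on S g" and ST: "\<And>p. p \<in> S \<Longrightarrow> g p \<in> T"
  shows "smooth_on S (\<lambda>p. f (g p))"
proof (rule smooth_on_localI)
  fix p assume "p \<in> S"
  obtain U G where U: "open U" "p \<in> U" "\<And>k. Ck_on k G U" "\<And>q. q \<in> S \<Longrightarrow> q \<in> U \<Longrightarrow> G q = g q"
    by (rule smooth_onE[OF g \<open>p \<in> S\<close>]) (rule that)
  obtain V F where V: "open V" "g p \<in> V" "\<And>k. Ck_on k F V" "\<And>q. q \<in> T \<Longrightarrow> q \<in> V \<Longrightarrow> F q = f q"
    by (rule smooth_onE[OF f ST[OF \<open>p \<in> S\<close>]]) (rule that)
  \<comment> \<open>Outside \<open>S\<close> the extension \<open>G\<close> may leave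
    \<open>V\<close>, so its domain is cut down to the preimage of \<open>V\<close>, which is open
    by continuity.\<close>
  have "continuous_on U G" using U(3)[of 0] by simp
  then have o: "open (U \<inter> G -` V)"
    using continuous_open_preimage U V by blast
  have "Ck_on k (\<lambda>p. F (G p)) (U \<inter> G -` V)" for k
    by (rule Ck_on_compose[OF o V(1) _ V(3) Ck_on_subset[OF U(3)]]) auto
  moreover have "p \<in> U \<inter> G -` V" using U V \<open>p \<in> S\<close> by simp
  moreover have "\<forall>q\<in>S \<inter> (U \<inter> G -` V). F (G q) = f (g q)" using U(4) V(4) ST by (metis IntD1 IntD2 IntI vimageD)
  ultimately show "\<exists>U F. open U \<and> p \<in> U \<and> (\<forall>k. Ck_on k F U) \<and> (\<forall>q\<in>S \<inter> U. F q = f (g q))"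
    using o by (intro exI[of _ "U \<inter> G -` V"] exI[of _ "\<lambda>p. F (G p)"]) auto
qed

lemma smooth_on_linear:
  fixes f :: "'b::euclidean_space \<Rightarrow> 'c::real_normed_vector"
  shows "bounded_linear f \<Longrightarrow> smooth_on S g \<Longrightarrow> smooth_on S (\<lambda>p. f (g p))"
  by (rule smooth_on_compose[of UNIV f]) (auto intro: smooth_onI Ck_on_linear)

lemma smooth_on_bilinear:
  fixes B :: "'b::euclidean_space \<Rightarrow> 'c::euclidean_space \<Rightarrow> 'd::real_normed_vector"
  assumes "bounded_bilinear B" "smooth_on S f" "smooth_on S g"
  shows "smooth_on S (\<lambda>p. B (f p) (g p))"
proof -
  have "smooth_on UNIV (\<lambda>x. B (fst x) (snd x))"
    by (rule smooth_onI[OF open_UNIV])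
      (rule subset_UNIV Ck_on_bilinear[OF _ assms(1)] Ck_on_linear bounded_linear_fst
        bounded_linear_snd open_UNIV)+
  from smooth_on_compose[OF this smooth_on_Pair[OF assms(2,3)]] show ?thesis by simp
qed

lemmas smooth_on_fst [intro!] = smooth_on_linear[OF bounded_linear_fst]
lemmas smooth_on_snd [intro!] = smooth_on_linear[OF bounded_linear_snd]
lemmas smooth_on_vec_nth [intro!] = smooth_on_linear[OF bounded_linear_vec_nth]
lemmas smooth_on_Re [intro!] = smooth_on_linear[OF bounded_linear_Re]
lemmas smooth_on_Im [intro!] = smooth_on_linear[OF bounded_linear_Im]
lemmas smooth_on_cnj [intro!] = smooth_on_linear[OF bounded_linear_cnj]
lemmas smooth_on_of_real [intro!] = smooth_on_linear[OF bounded_linear_of_real]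
lemmas smooth_on_minus [intro!] = smooth_on_linear[OF bounded_linear_minus[OF bounded_linear_ident]]
lemmas smooth_on_mult [intro!] = smooth_on_bilinear[OF bounded_bilinear_mult]
lemmas smooth_on_scaleR [intro!] = smooth_on_bilinear[OF bounded_bilinear_scaleR]

lemma smooth_on_add [intro!]:
  fixes f :: "'a::euclidean_space \<Rightarrow> 'b::euclidean_space"
  shows "smooth_on S f \<Longrightarrow> smooth_on S g \<Longrightarrow> smooth_on S (\<lambda>p. f p + g p)"
  using smooth_on_linear[OF bounded_linear_add[OF bounded_linear_fst bounded_linear_snd]
      smooth_on_Pair[of S f g]] by simp

lemma smooth_on_diff [intro!]:
  fixes f :: "'a::euclidean_space \<Rightarrow> 'b::euclidean_space"
  shows "smooth_on S f \<Longrightarrow> smooth_on S g \<Longrightarrow> smooth_on S (\<lambda>p. f p - g p)"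
  using smooth_on_add[of S f "\<lambda>p. - g p"] by auto

lemma smooth_on_divide [intro!]:
  fixes f g :: "'a::euclidean_space \<Rightarrow> 'b::{euclidean_space, real_normed_field}"
  assumes "smooth_on S f" "smooth_on S g" "\<And>p. p \<in> S \<Longrightarrow> g p \<noteq> 0"
  shows "smooth_on S (\<lambda>p. f p / g p)"
proof -
  have "smooth_on S (\<lambda>p. inverse (g p))"
    by (rule smooth_on_compose[of "- {0}" inverse, OF smooth_onI[of "- {0}"]])
      (use assms in \<open>auto intro: Ck_on_inverse\<close>)
  with assms(1) show ?thesis unfolding divide_inverse by auto
qed

lemma smooth_on_sqrt [intro!]:
  assumes "smooth_on S f" "\<And>p. p \<in> S \<Longrightarrow> f p > 0"
  shows "smooth_on S (\<lambda>p. sqrt (f p))"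
  by (rule smooth_on_compose[of "{0<..}" sqrt, OF smooth_onI[of "{0<..}"]])
    (use assms in \<open>auto intro: Ck_on_sqrt\<close>)

lemma smooth_on_power [intro!]:
  fixes f :: "'a::euclidean_space \<Rightarrow> 'b::{euclidean_space, real_normed_field}"
  shows "smooth_on S f \<Longrightarrow> smooth_on S (\<lambda>p. f p ^ n)"
  by (induction n) auto

text \<open>Since \<open>axis i\<close> is linear, writing the vector as the sum of its placed
  coordinates leaves only sums and linear maps.\<close>

lemma smooth_on_vec_lambda:
  fixes f :: "'n::finite \<Rightarrow> 'a::euclidean_space \<Rightarrow> 'b::euclidean_space"
  assumes "\<And>i. smooth_on S (f i)"
  shows "smooth_on S (\<lambda>p. \<chi> i. f i p)"
proof -
  have *: "bounded_linear (axis i :: 'b \<Rightarrow> 'b ^ 'n)" for i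
    by (intro linear_conv_bounded_linear[THEN iffD1] linearI) (auto simp: axis_def vec_eq_iff)
  have "smooth_on S (\<lambda>p. \<Sum>i\<in>I. axis i (f i p))" if "finite I" for I
    using that by induction (auto intro!: smooth_on_linear[OF *] assms)
  moreover have "(\<chi> i. f i p) = (\<Sum>i\<in>UNIV. axis i (f i p))" for p
    by (simp add: vec_eq_iff axis_def sum.delta if_distrib cong: if_cong)
  ultimately show ?thesis by simp
qed

subsection \<open>Hyperbolic functions and the matrix exponential\<close>

text \<open>The termwise derivative is again an everywhere convergent power series, so the induction
  ranges over all coefficient sequences.\<close>

lemma Ck_on_powser:
  fixes a :: "nat \<Rightarrow> real"
  assumes "\<And>x. summable (\<lambda>n. a n * x ^ n)"
  shows "Ck_on k (\<lambda>x. \<Sum>n. a n * x ^ n) UNIV"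
  using assms
proof (induction k arbitrary: a)
  case 0
  show ?case
    using DERIV_isCont[OF termdiffs_strong_converges_everywhere[OF 0]]
    by (auto intro!: continuous_at_imp_continuous_on)
next
  case (Suc k)
  show ?case
    by (rule Ck_on_SucI_real[OF open_UNIV termdiffs_strong_converges_everywhere[OF Suc.prems]
          Suc.IH[OF termdiff_converges_all[OF Suc.prems]]])
qed

text \<open>The entire functions \<open>cosh (sqrt s)\<close> and \<open>sinh (sqrt s) / sqrt s\<close>.\<close>

definition cosh_sqrt :: "real \<Rightarrow> real" where
  "cosh_sqrt s = (\<Sum>n. inverse (fact (2 * n)) * s ^ n)"

definition sinh_sqrt :: "real \<Rightarrow> real" where
  "sinh_sqrt s = (\<Sum>n. inverse (fact (2 * n + 1)) * s ^ n)"

lemma sums_even_odd_iff: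
  fixes f :: "nat \<Rightarrow> 'a::real_normed_vector"
  shows "(\<And>n. odd n \<Longrightarrow> f n = 0) \<Longrightarrow> (\<lambda>n. f (2 * n)) sums c \<longleftrightarrow> f sums c"
    and "(\<And>n. even n \<Longrightarrow> f n = 0) \<Longrightarrow> (\<lambda>n. f (2 * n + 1)) sums c \<longleftrightarrow> f sums c"
proof -
  assume "\<And>n. odd n \<Longrightarrow> f n = 0"
  moreover have "odd n" if "n \<notin> range ((*) 2)" for n :: nat using that by auto
  ultimately show "(\<lambda>n. f (2 * n)) sums c \<longleftrightarrow> f sums c"
    by (intro sums_mono_reindex) (auto simp: strict_mono_def)
next
  assume *: "\<And>n. even n \<Longrightarrow> f n = 0"
  have "even n" if "n \<notin> range (\<lambda>n. 2 * n + 1)" for n :: nat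
    using that by (metis oddE rangeI)
  with * show "(\<lambda>n. f (2 * n + 1)) sums c \<longleftrightarrow> f sums c"
    by (intro sums_mono_reindex[of "\<lambda>n. 2 * n + 1"]) (auto simp: strict_mono_def)
qed

lemma cosh_even_sums: "(\<lambda>n. inverse (fact (2 * n)) * (r\<^sup>2) ^ n) sums cosh (r::real)"
  using sums_even_odd_iff(1)[THEN iffD2, OF _ cosh_converges[of r]]
  by (simp add: power_mult)

lemma sinh_odd_sums: "(\<lambda>n. r * (inverse (fact (2 * n + 1)) * (r\<^sup>2) ^ n)) sums sinh (r::real)"
  using sums_even_odd_iff(2)[THEN iffD2, OF _ sinh_converges[of r]]
  by (simp add: power_mult mult.left_commute del: fact_Suc)

lemma cosh_sqrt_square [simp]: "cosh_sqrt (r\<^sup>2) = cosh r"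
  unfolding cosh_sqrt_def using sums_unique[OF cosh_even_sums[of r]] by simp

lemma summable_cosh_sqrt: "summable (\<lambda>n. inverse (fact (2 * n)) * (s::real) ^ n)"
proof -
  \<comment> \<open>A negative s is not a square, but the absolute values of its terms are the terms
    of cosh at sqrt |s|.\<close>
  have "summable (\<lambda>n. norm (inverse (fact (2 * n)) * s ^ n))"
    using sums_summable[OF cosh_even_sums[of "sqrt \<bar>s\<bar>"]] by (simp add: abs_mult power_abs)
  then show ?thesis by (rule summable_norm_cancel)
qed

text \<open>The identity (n + 1) / (2n + 2)! = 1 / (2 (2n + 1)!). It yields both the convergence of
  \<open>sinh_sqrt\<close> and its role as twice the derivative of \<open>cosh_sqrt\<close>.\<close>

lemma diffs_cosh_sqrt:
  "diffs (\<lambda>n. inverse (fact (2 * n)) :: real) = (\<lambda>n. inverse 2 * inverse (fact (2 * n + 1)))"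
proof
  fix n
  have "fact (2 * Suc n) = (2 * real (Suc n)) * fact (2 * n + 1)"
    by (simp add: algebra_simps)
  then show "diffs (\<lambda>n. inverse (fact (2 * n)) :: real) n = inverse 2 * inverse (fact (2 * n + 1))"
    unfolding diffs_def by (simp del: fact_Suc of_nat_Suc)
qed

lemma summable_sinh_sqrt: "summable (\<lambda>n. inverse (fact (2 * n + 1)) * (s::real) ^ n)"
  using summable_mult[OF termdiff_converges_all[OF summable_cosh_sqrt, of s], of 2]
  by (simp add: diffs_cosh_sqrt mult.assoc del: fact_Suc)

lemma sinh_sqrt_square [simp]: "r * sinh_sqrt (r\<^sup>2) = sinh r"
  unfolding sinh_sqrt_def suminf_mult[OF summable_sinh_sqrt, symmetric]
  using sums_unique[OF sinh_odd_sums[of r]] by simp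

lemma DERIV_cosh_sqrt: "(cosh_sqrt has_real_derivative sinh_sqrt s / 2) (at s)"
proof -
  have "(\<Sum>n. diffs (\<lambda>n. inverse (fact (2 * n))) n * s ^ n) = sinh_sqrt s / 2"
    unfolding diffs_cosh_sqrt sinh_sqrt_def mult.assoc by (subst suminf_mult[OF summable_sinh_sqrt]) simp
  from termdiffs_strong_converges_everywhere[OF summable_cosh_sqrt, of s, unfolded this]
  show ?thesis by (simp only: cosh_sqrt_def[abs_def])
qed

lemma Ck_on_cosh_sqrt: "Ck_on k cosh_sqrt UNIV"
  unfolding cosh_sqrt_def by (rule Ck_on_powser[OF summable_cosh_sqrt])

lemma Ck_on_sinh_sqrt: "Ck_on k sinh_sqrt UNIV"
  unfolding sinh_sqrt_def by (rule Ck_on_powser[OF summable_sinh_sqrt])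

lemma smooth_on_cosh_sqrt [intro!]: "smooth_on S f \<Longrightarrow> smooth_on S (\<lambda>p. cosh_sqrt (f p))"
  by (rule smooth_on_compose[of UNIV cosh_sqrt]) (auto intro: smooth_onI[of UNIV] Ck_on_cosh_sqrt)

lemma smooth_on_sinh_sqrt [intro!]: "smooth_on S f \<Longrightarrow> smooth_on S (\<lambda>p. sinh_sqrt (f p))"
  by (rule smooth_on_compose[of UNIV sinh_sqrt]) (auto intro: smooth_onI[of UNIV] Ck_on_sinh_sqrt)

text \<open>All terms are non-negative and the constant term is 1. This licenses the later divisions
  by \<open>sinh_sqrt\<close>.\<close>

lemma sinh_sqrt_pos: "s \<ge> 0 \<Longrightarrow> sinh_sqrt s > 0"
  unfolding sinh_sqrt_def
  by (rule suminf_pos2[OF summable_sinh_sqrt, of _ 0]) auto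

text \<open>The square of \<open>arcosh\<close> is smooth up to the end point \<open>1\<close>, because it inverts the
  function \<open>cosh (sqrt s)\<close>, whose derivative is positive near \<open>s \<ge> 0\<close>.\<close>

lemma smooth_on_arcosh_square: "smooth_on {1..} (\<lambda>x::real. (arcosh x)\<^sup>2)"
proof -
  have "open {s. 0 < sinh_sqrt s}"
    using Ck_on_sinh_sqrt[of 0] by (intro open_Collect_less) auto
  then obtain e where e: "e > 0" "\<And>s. \<bar>s\<bar> < e \<Longrightarrow> sinh_sqrt s > 0"
    using sinh_sqrt_pos[of 0] unfolding open_contains_ball
    by (force simp: dist_real_def subset_eq)
  \<comment> \<open>\<open>U\<close> reaches below 0, so that 1 = \<open>cosh_sqrt 0\<close> becomes
    an interior point of the image and the inverse \<open>L\<close> lives on a neighbourhood of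
    \<open>{1..}\<close>.\<close>
  define U where "U = {- e<..}"
  have pos: "sinh_sqrt s > 0" if "s \<in> U" for s
    using e(2)[of s] sinh_sqrt_pos[of s] that by (cases "s \<ge> 0") (auto simp: U_def)
  have "cosh_sqrt s < cosh_sqrt t" if "s \<in> U" "s < t" for s t
    by (rule DERIV_pos_imp_increasing[OF that(2)])
      (use DERIV_cosh_sqrt pos that in \<open>force simp: U_def\<close>)
  then have inj: "inj_on cosh_sqrt U"
    by (metis inj_onI less_irrefl linorder_less_linear)
  define L where "L = inv_into U cosh_sqrt"
  have L: "L (cosh_sqrt s) = s" if "s \<in> U" for s
    unfolding L_def by (rule inv_into_f_f[OF inj that])
  have U: "open U" by (simp add: U_def)
  have cont: "continuous_on U cosh_sqrt"
    using Ck_on_subset[OF Ck_on_cosh_sqrt[of 0], of U] by simp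
  have V: "open (cosh_sqrt ` U)" by (rule invariance_of_domain[OF cont U inj])
  have D: "(L has_real_derivative inverse (sinh_sqrt (L x) / 2)) (at x)" if "x \<in> cosh_sqrt ` U" for x
  proof -
    from that obtain s where s: "s \<in> U" "x = cosh_sqrt s" by blast
    have "(L has_derivative (*) (inverse (sinh_sqrt s / 2))) (at (cosh_sqrt s))"
      by (rule has_derivative_inverse_strong[OF U s(1) cont L
            DERIV_cosh_sqrt[unfolded has_field_derivative_def]])
        (use pos[OF s(1)] in \<open>auto simp: fun_eq_iff\<close>)
    then show ?thesis using s L by (simp add: has_field_derivative_def)
  qed
  have CkL: "Ck_on k L (cosh_sqrt ` U)" for k
  \<comment> \<open>The inverse function rule reads L' = 2 / sinh_sqrt (L), an autonomous
    equation.\<close>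
  proof (rule Ck_on_autonomous[OF V U _ _ D])
    show "L ` cosh_sqrt ` U \<subseteq> U" using L by auto
    have "Ck_on k (\<lambda>s. inverse 2 * sinh_sqrt s) U" for k
      by (rule Ck_on_bilinear[OF U bounded_bilinear_mult Ck_on_const[OF U]
            Ck_on_subset[OF Ck_on_sinh_sqrt subset_UNIV]])
    then have "Ck_on k (\<lambda>s. inverse (inverse 2 * sinh_sqrt s)) U" for k
      by (rule Ck_on_compose[OF U _ _ Ck_on_inverse, rotated 2]) (use pos in force)+
    then show "Ck_on k (\<lambda>s. inverse (sinh_sqrt s / 2)) U" for k
      by (simp add: field_simps)
  qed
  have x: "x = cosh_sqrt ((arcosh x)\<^sup>2)" "(arcosh x)\<^sup>2 \<in> U" if "x \<ge> 1" for x :: real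
    using that e(1) by (auto simp: U_def intro: less_le_trans[of _ 0])
  then have "{1..} \<subseteq> cosh_sqrt ` U"
    by (metis atLeast_iff image_eqI subsetI)
  from smooth_onI[OF V this CkL] have "smooth_on {1..} L" .
  then show ?thesis
  proof (rule smooth_on_eq)
    show "L p = (arcosh p)\<^sup>2" if "p \<in> {1..}" for p
      using L[OF x(2)[of p]] that by simp
  qed
qed

text \<open>Even powers of \<open>M\<close> are r^(2n) times the identity and odd ones r^(2n) times
  \<open>M\<close>, so the series splits into those of cosh r and sinh r / r;
  \<open>sinh_sqrt\<close> gives the latter its value at r = 0.\<close>

lemma mexp_of_square:
  assumes "M ** M = (r\<^sup>2) *\<^sub>R mat 1"
  shows "mexp M = cosh r *\<^sub>R mat 1 + sinh_sqrt (r\<^sup>2) *\<^sub>R M"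
proof -
  let ?p = "\<lambda>n. (((**) M) ^^ n) (mat 1)"
  have ev: "?p (2 * n) = ((r\<^sup>2) ^ n) *\<^sub>R mat 1" for n
    by (induction n) (simp_all add: assms matrix_mul_assoc scalar_matrix_assoc[symmetric])
  have od: "?p (2 * n + 1) = ((r\<^sup>2) ^ n) *\<^sub>R M" for n
    using ev[of n] by (simp add: matrix_scalar_ac)
  let ?t = "\<lambda>n. (1 / fact n) *\<^sub>R ?p n"
  have "(\<lambda>n. ?t (2 * n)) sums (cosh r *\<^sub>R mat 1)"
    using sums_scaleR_left[OF cosh_even_sums[of r], of "mat 1 :: cmat"]
    unfolding ev by (simp add: divide_inverse)
  then have 1: "(\<lambda>n. if even n then ?t n else 0) sums (cosh r *\<^sub>R mat 1)"
    by (subst sums_even_odd_iff(1)[symmetric]) auto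
  have "(\<lambda>n. ?t (2 * n + 1)) sums (sinh_sqrt (r\<^sup>2) *\<^sub>R M)"
    using sums_scaleR_left[OF summable_sums[OF summable_sinh_sqrt[of "r\<^sup>2"]], of M]
    unfolding od by (simp add: sinh_sqrt_def divide_inverse del: fact_Suc)
  then have 2: "(\<lambda>n. if odd n then ?t n else 0) sums (sinh_sqrt (r\<^sup>2) *\<^sub>R M)"
    by (subst sums_even_odd_iff(2)[symmetric]) auto
  have "?t sums (cosh r *\<^sub>R mat 1 + sinh_sqrt (r\<^sup>2) *\<^sub>R M)"
    by (rule sums_cong[THEN iffD1, OF _ sums_add[OF 1 2]]) simp
  then show ?thesis
    unfolding mexp_def by (simp add: sums_iff)
qed

subsection \<open>Matrices and the adjoint action\<close>

lemma mat2_nth [simp]: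
  "mat2 a b c d $ 1 $ 1 = a" "mat2 a b c d $ 1 $ 2 = b"
  "mat2 a b c d $ 2 $ 1 = c" "mat2 a b c d $ 2 $ 2 = d"
  by (simp_all add: mat2_def)

lemma cmat_eq_iff:
  "A = (B :: cmat) \<longleftrightarrow> A $ 1 $ 1 = B $ 1 $ 1 \<and> A $ 1 $ 2 = B $ 1 $ 2 \<and> A $ 2 $ 1 = B $ 2 $ 1 \<and> A $ 2 $ 2 = B $ 2 $ 2"
  by (simp add: vec_eq_iff forall_2)

lemma mat2_eq_iff [simp]: "mat2 a b c d = mat2 a' b' c' d' \<longleftrightarrow> a = a' \<and> b = b' \<and> c = c' \<and> d = d'"
  by (simp add: cmat_eq_iff)

lemma cmat_cases: obtains a b c d where "A = mat2 a b c d"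
  by (rule that[of "A $ 1 $ 1" "A $ 1 $ 2" "A $ 2 $ 1" "A $ 2 $ 2"]) (simp add: cmat_eq_iff)

lemma mat2_mult [simp]:
  "mat2 a b c d ** mat2 a' b' c' d' = mat2 (a * a' + b * c') (a * b' + b * d') (c * a' + d * c') (c * b' + d * d')"
  by (simp add: cmat_eq_iff matrix_matrix_mult_def sum_2)

lemma mat2_mult_vector [simp]: "mat2 a b c d *v vector [x, y] = vector [a * x + b * y, c * x + d * y]"
  by (simp add: vec_eq_iff forall_2 matrix_vector_mult_def sum_2)

lemma mat2_linear [simp]:
  "mat2 a b c d + mat2 a' b' c' d' = mat2 (a + a') (b + b') (c + c') (d + d')"
  "mat2 a b c d - mat2 a' b' c' d' = mat2 (a - a') (b - b') (c - c') (d - d')"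
  "- mat2 a b c d = mat2 (- a) (- b) (- c) (- d)"
  "r *\<^sub>R mat2 a b c d = mat2 (complex_of_real r * a) (complex_of_real r * b) (complex_of_real r * c) (complex_of_real r * d)"
  "k *\<^sub>M mat2 a b c d = mat2 (k * a) (k * b) (k * c) (k * d)"
  by (simp_all add: cmat_eq_iff cscale_def map_matrix_def) (simp_all add: scaleR_conv_of_real)

lemma mat_one_mat2: "mat 1 = mat2 1 0 0 1"
  by (simp add: cmat_eq_iff mat_def)

lemma zero_mat2: "0 = mat2 0 0 0 0"
  by (simp add: cmat_eq_iff)

lemma ctransp_mat2 [simp]: "ctransp (mat2 a b c d) = mat2 (cnj a) (cnj c) (cnj b) (cnj d)"
  by (simp add: cmat_eq_iff ctransp_def map_matrix_def transpose_def)

lemma det_mat2 [simp]: "det (mat2 a b c d) = a * d - b * c"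
  by (simp add: det_2)

lemma matrix_inv_eqI:
  fixes A B :: cmat
  assumes "A ** B = mat 1" "B ** A = mat 1"
  shows "matrix_inv A = B"
  unfolding matrix_inv_def
  by (rule some_equality) (use assms in \<open>auto, metis matrix_mul_assoc matrix_mul_lid matrix_mul_rid\<close>)

lemma matrix_inv_mat2: "a * d - b * c = 1 \<Longrightarrow> matrix_inv (mat2 a b c d) = mat2 d (- b) (- c) a"
  by (rule matrix_inv_eqI) (simp_all add: mat_one_mat2 algebra_simps)

lemma SL2C_inv:
  assumes "g \<in> SL2C"
  shows "g ** matrix_inv g = mat 1" "matrix_inv g ** g = mat 1" "matrix_inv g \<in> SL2C"
    "matrix_inv (matrix_inv g) = g"
proof -
  obtain a b c d where "g = mat2 a b c d" by (rule cmat_cases)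
  with assms show "g ** matrix_inv g = mat 1" "matrix_inv g ** g = mat 1" "matrix_inv g \<in> SL2C"
    "matrix_inv (matrix_inv g) = g"
    by (simp_all add: SL2C_def matrix_inv_mat2 mat_one_mat2 algebra_simps)
qed

lemma SL2C_cancel:
  assumes "g \<in> SL2C"
  shows "g ** (matrix_inv g ** A) = A" "matrix_inv g ** (g ** A) = A"
  by (simp_all add: matrix_mul_assoc SL2C_inv[OF assms])

lemma SL2C_mult: "g \<in> SL2C \<Longrightarrow> h \<in> SL2C \<Longrightarrow> g ** h \<in> SL2C"
  by (simp add: SL2C_def det_mul)

lemma matrix_inv_mult:
  "g \<in> SL2C \<Longrightarrow> h \<in> SL2C \<Longrightarrow> matrix_inv (g ** h) = matrix_inv h ** matrix_inv g"
  by (rule matrix_inv_eqI) (simp_all add: matrix_mul_assoc[symmetric] SL2C_cancel SL2C_inv)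

lemma Ad_mult: "g \<in> SL2C \<Longrightarrow> h \<in> SL2C \<Longrightarrow> Ad (g ** h) y = Ad g (Ad h y)"
  by (simp add: Ad_def matrix_inv_mult matrix_mul_assoc)

lemma Ad_inv:
  assumes "g \<in> SL2C"
  shows "Ad (matrix_inv g) (Ad g y) = y" "Ad g (Ad (matrix_inv g) y) = y"
  using assms by (simp_all add: Ad_def SL2C_inv SL2C_cancel matrix_mul_assoc[symmetric])

lemma Ad_linear:
  "Ad g (y + z) = Ad g y + Ad g z" "Ad g (y - z) = Ad g y - Ad g z" "Ad g (- y) = - Ad g y"
  "Ad g (t *\<^sub>R y) = t *\<^sub>R Ad g y" "Ad g (k *\<^sub>M y) = k *\<^sub>M Ad g y"
proof -
  obtain a b c d where y: "y = mat2 a b c d" by (rule cmat_cases)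
  obtain a' b' c' d' where z: "z = mat2 a' b' c' d'" by (rule cmat_cases)
  obtain p q r s where g: "g = mat2 p q r s" by (rule cmat_cases)
  obtain p' q' r' s' where h: "matrix_inv g = mat2 p' q' r' s'" by (rule cmat_cases)
  show "Ad g (y + z) = Ad g y + Ad g z" "Ad g (y - z) = Ad g y - Ad g z" "Ad g (- y) = - Ad g y"
    "Ad g (t *\<^sub>R y) = t *\<^sub>R Ad g y" "Ad g (k *\<^sub>M y) = k *\<^sub>M Ad g y"
    unfolding Ad_def h unfolding y z g by (simp_all add: algebra_simps)
qed

lemma Ad_matrix_mult: "g \<in> SL2C \<Longrightarrow> Ad g (y ** z) = Ad g y ** Ad g z"
  unfolding Ad_def by (simp add: matrix_mul_assoc[symmetric] SL2C_cancel)

lemma det_Ad: "g \<in> SL2C \<Longrightarrow> det (Ad g y) = det y"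
  unfolding Ad_def det_mul using SL2C_inv(3)[of g] by (simp add: SL2C_def)

section \<open>The group SU(2) and the equations of the complex orbit\<close>

text \<open>The inverse is the adjugate, because the determinant is 1, and the conjugate transpose,
  because the matrix is unitary. Comparing entries leaves the first column as a free unit
  vector.\<close>

lemma SU2_iff: "g \<in> SU2 \<longleftrightarrow> (\<exists>a b. g = mat2 a (- cnj b) b (cnj a) \<and> a * cnj a + b * cnj b = 1)"
proof
  assume g: "g \<in> SU2"
  obtain a b c d where abcd: "g = mat2 a b c d" by (rule cmat_cases)
  then have 1: "a * d - b * c = 1" "ctransp g ** g = mat 1" using g by (simp_all add: SU2_def)
  have "g ** ctransp g = mat 1" using 1(2) by (simp add: matrix_left_right_inverse)
  then have "matrix_inv g = ctransp g" by (rule matrix_inv_eqI[OF _ 1(2)])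
  then have "mat2 d (- b) (- c) a = mat2 (cnj a) (cnj c) (cnj b) (cnj d)"
    by (simp only: abcd matrix_inv_mat2[OF 1(1)] ctransp_mat2)
  then have 2: "d = cnj a" "- b = cnj c" unfolding mat2_eq_iff by blast+
  then have 3: "b = - cnj c" by (metis minus_minus)
  have "a * cnj a + c * cnj c = 1" using 1(1) unfolding 2(1) 3 by (simp add: algebra_simps)
  then show "\<exists>a b. g = mat2 a (- cnj b) b (cnj a) \<and> a * cnj a + b * cnj b = 1"
    unfolding abcd 2(1) 3 by blast
next
  assume "\<exists>a b. g = mat2 a (- cnj b) b (cnj a) \<and> a * cnj a + b * cnj b = 1"
  then show "g \<in> SU2" by (elim exE conjE) (simp add: SU2_def mat_one_mat2 algebra_simps)
qed

lemma SU2_SL2C: "g \<in> SU2 \<Longrightarrow> g \<in> SL2C"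
  by (simp add: SU2_def SL2C_def)

lemma SU2_inv: "g \<in> SU2 \<Longrightarrow> matrix_inv g = ctransp g" "g \<in> SU2 \<Longrightarrow> matrix_inv g \<in> SU2"
  by (auto simp: SU2_iff matrix_inv_mat2 algebra_simps)

lemma ctransp_mult: "ctransp (A ** B) = ctransp B ** ctransp A"
proof -
  obtain a b c d p q r s where "A = mat2 a b c d" "B = mat2 p q r s" by (meson cmat_cases)
  then show ?thesis by (simp add: algebra_simps)
qed

lemma ctransp_linear:
  "ctransp (A + B) = ctransp A + ctransp B" "ctransp (A - B) = ctransp A - ctransp B"
  "ctransp (- A) = - ctransp A" "ctransp (t *\<^sub>R A) = t *\<^sub>R ctransp A" "ctransp (k *\<^sub>M A) = cnj k *\<^sub>M ctransp A"
  "ctransp (ctransp A) = A"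
proof -
  obtain a b c d p q r s where "A = mat2 a b c d" "B = mat2 p q r s" by (meson cmat_cases)
  then show "ctransp (A + B) = ctransp A + ctransp B" "ctransp (A - B) = ctransp A - ctransp B"
    "ctransp (- A) = - ctransp A" "ctransp (t *\<^sub>R A) = t *\<^sub>R ctransp A" "ctransp (k *\<^sub>M A) = cnj k *\<^sub>M ctransp A"
    "ctransp (ctransp A) = A" by simp_all
qed

lemma SU2_mult: "g \<in> SU2 \<Longrightarrow> h \<in> SU2 \<Longrightarrow> g ** h \<in> SU2"
  unfolding SU2_def by (simp add: det_mul ctransp_mult) (metis matrix_mul_assoc matrix_mul_lid)

lemma ctransp_Ad: "g \<in> SU2 \<Longrightarrow> ctransp (Ad g y) = Ad g (ctransp y)"
  by (simp add: Ad_def SU2_inv ctransp_mult ctransp_linear matrix_mul_assoc)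

lemma Ad_in_OrbC: "g \<in> SL2C \<Longrightarrow> y \<in> OrbC \<Longrightarrow> Ad g y \<in> OrbC"
  unfolding orbit_def by (force simp: Ad_mult[symmetric] SL2C_mult)

lemma Ad_mat2_x0: "a * d - b * c = 1 \<Longrightarrow>
  Ad (mat2 a b c d) x0 = mat2 (\<i> * (a * d + b * c)) (- 2 * \<i> * a * b) (2 * \<i> * c * d) (- \<i> * (a * d + b * c))"
  by (simp add: Ad_def x0_def matrix_inv_mat2 algebra_simps)

text \<open>The orbit is the affine quadric of trace-free matrices of determinant 1. A conjugating
  element has eigenvectors for \<i> and - \<i> as its columns, scaled to determinant 1.\<close>

lemma OrbC_iff: "mat2 p q r s \<in> OrbC \<longleftrightarrow> s = - p \<and> p * p + q * r = - 1"
proof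
  assume "mat2 p q r s \<in> OrbC"
  then obtain g where g: "g \<in> SL2C" "mat2 p q r s = Ad g x0" by (auto simp: orbit_def)
  obtain a b c d where abcd: "g = mat2 a b c d" by (rule cmat_cases)
  with g have 1: "a * d = 1 + b * c" by (simp add: SL2C_def algebra_simps)
  then have "p = \<i> * (a * d + b * c)" "q = - 2 * \<i> * a * b" "r = 2 * \<i> * c * d" "s = - \<i> * (a * d + b * c)"
    using g(2) by (simp_all add: abcd Ad_mat2_x0)
  moreover have "\<i> * (a * d + b * c) * (\<i> * (a * d + b * c)) + (- 2 * \<i> * a * b) * (2 * \<i> * c * d)
    = - ((a * d - b * c)\<^sup>2)"
    by (simp add: power2_eq_square algebra_simps)
  ultimately show "s = - p \<and> p * p + q * r = - 1" using 1 by simp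
next
  assume *: "s = - p \<and> p * p + q * r = - 1"
  have "\<exists>g \<in> SL2C. Ad g x0 = mat2 p q r s"
  proof (cases "p = - \<i>")
    case False
    then have ne: "p + \<i> \<noteq> 0" by (simp add: add_eq_0_iff2)
    \<comment> \<open>The columns of \<open>?g\<close> are the eigenvectors (p + \<i>, r) and (m q,
      - \<i> / 2); \<open>m\<close> is the factor that makes the second one lie in the eigenspace of
      - \<i>.\<close>
    define m where "m = \<i> / 2 * inverse (p + \<i>)"
    have m: "m * (p + \<i>) = \<i> / 2" 
      by (simp only: m_def mult.assoc left_inverse[OF ne] mult_1_right)
    have qr: "q * r = - ((p + \<i>) * (p - \<i>))" using * by (simp add: algebra_simps eq_diff_eq add.commute)
    have mqr: "m * q * r = - (\<i> / 2 * (p - \<i>))"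
      by (simp only: mult.assoc qr mult_minus_right m[symmetric])
    let ?g = "mat2 (p + \<i>) (m * q) r (- (\<i> / 2))"
    have d: "(p + \<i>) * (- (\<i> / 2)) - m * q * r = 1"
      unfolding mqr by (simp add: field_simps)
    have "- 2 * \<i> * (p + \<i>) * (m * q) = - 2 * \<i> * (m * (p + \<i>)) * q" by (simp only: ac_simps)
    then have q: "- 2 * \<i> * (p + \<i>) * (m * q) = q" unfolding m by simp
    have "Ad ?g x0 = mat2 p q r s"
      unfolding Ad_mat2_x0[OF d] mqr q using * by (simp add: field_simps)
    moreover have "?g \<in> SL2C" using d by (simp add: SL2C_def)
    ultimately show ?thesis by blast
  next
    case True
    with * have qr: "q * r = 0" by simp
    \<comment> \<open>For p = - \<i> and q r = 0 the vectors (q, 2 \<i>) and (\<i> / 2, - r / 4) are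
      eigenvectors for \<i> and - \<i> without any division by p + \<i>.\<close>
    let ?g = "mat2 q (\<i> / 2) (2 * \<i>) (- r / 4)"
    have d: "q * (- r / 4) - \<i> / 2 * (2 * \<i>) = 1" using qr by simp
    have "Ad ?g x0 = mat2 p q r s"
      unfolding Ad_mat2_x0[OF d] using * qr True by (auto simp: algebra_simps)
    moreover have "?g \<in> SL2C" using d by (simp add: SL2C_def)
    ultimately show ?thesis by blast
  qed
  then show "mat2 p q r s \<in> OrbC" unfolding orbit_def by (metis imageI)
qed

subsection \<open>Polar decomposition in the complex orbit\<close>

lemma OrbC_square: "y \<in> OrbC \<Longrightarrow> y ** y = - mat 1"
  by (cases y rule: cmat_cases) (simp add: OrbC_iff mat_one_mat2 algebra_simps)

lemma Orb_subset_OrbC: "Orb \<subseteq> OrbC"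
  using SU2_SL2C by (auto simp: orbit_def)

lemma x0_in_Orb: "x0 \<in> Orb"
proof -
  have "mat 1 \<in> SU2" by (simp add: SU2_def mat_one_mat2)
  moreover have "Ad (mat 1) x0 = x0" by (simp add: mat_one_mat2 Ad_mat2_x0) (simp add: x0_def)
  ultimately show ?thesis unfolding orbit_def by (metis imageI)
qed

lemma ctransp_x0: "ctransp x0 = - x0"
  by (simp add: x0_def)

lemma Orb_ctransp: "y \<in> Orb \<Longrightarrow> ctransp y = - y"
  by (auto simp: orbit_def ctransp_Ad ctransp_x0 Ad_linear)

text \<open>A skew-Hermitian y is given by t = Im p and q with t^2 + |q|^2 = 1, a point of the unit
  sphere; an explicit rotation carries \<open>x0\<close>, the pole t = 1, to it.\<close>

lemma OrbI:
  assumes "y \<in> OrbC" "ctransp y = - y"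
  shows "y \<in> Orb"
proof -
  obtain p q r s where y: "y = mat2 p q r s" by (rule cmat_cases)
  have s: "s = - p" and pq: "p * p + q * r = - 1" using assms(1) by (auto simp: y OrbC_iff)
  have "cnj p = - p" and r: "r = - cnj q"
    using assms(2) by (simp_all add: y)
  then have "Re p = 0" by (simp add: complex_eq_iff)
  define t where "t = Im p"
  have p: "p = \<i> * of_real t" using \<open>Re p = 0\<close> by (simp add: t_def complex_eq_iff)
  have "q * cnj q = of_real (1 - t\<^sup>2)"
    using pq by (simp add: p r power2_eq_square algebra_simps)
  then have tq: "(cmod q)\<^sup>2 = 1 - t\<^sup>2"
    unfolding complex_norm_square[symmetric] of_real_eq_iff .
  then have "t\<^sup>2 \<le> 1" by (metis diff_ge_0_iff_ge zero_le_power2)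
  then have t1: "- 1 \<le> t" by (metis abs_le_square_iff abs_le_iff abs_one minus_le_iff one_power2)
  have "\<exists>g\<in>SU2. Ad g x0 = y"
  proof (cases "t = - 1")
    case True
    then have "q = 0" using tq by simp
    have g: "mat2 0 (- 1) 1 0 \<in> SU2" by (simp add: SU2_def mat_one_mat2)
    moreover have "Ad (mat2 0 (- 1) 1 0) x0 = y"
      by (simp add: Ad_mat2_x0 y s p r \<open>q = 0\<close> True)
    ultimately show ?thesis by blast
  next
    case False
    \<comment> \<open>\<open>?g\<close> is the quaternion 1 - y x0 divided by the square root of its
      determinant 2 (1 + t). This vanishes only at the antipode y = - x0, the other case.\<close>
    define e where "e = complex_of_real (1 / sqrt (2 * (1 + t)))"
    have e: "e * e * (2 * (1 + of_real t)) = 1" "cnj e = e"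
    proof -
      have 1: "e * e = of_real (1 / (2 * (1 + t)))"
        using t1 by (simp add: e_def flip: of_real_mult of_real_divide)
      have 2: "2 * (1 + of_real t) = complex_of_real (2 * (1 + t))" by simp
      show "e * e * (2 * (1 + of_real t)) = 1"
        unfolding 1 2 of_real_mult[symmetric] using False by simp
    qed (simp add: e_def)
    let ?g = "mat2 (e * (1 + of_real t)) (e * \<i> * q) (e * \<i> * cnj q) (e * (1 + of_real t))"
    have d: "e * (1 + of_real t) * (e * (1 + of_real t)) - e * \<i> * q * (e * \<i> * cnj q) = 1"
    proof -
      have "e * (1 + of_real t) * (e * (1 + of_real t)) - e * \<i> * q * (e * \<i> * cnj q)
        = e * e * ((1 + of_real t) * (1 + of_real t) + q * cnj q)" by (simp add: algebra_simps)
      also have "(1 + of_real t) * (1 + of_real t) + q * cnj q = 2 * (1 + complex_of_real t)"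
        unfolding \<open>q * cnj q = _\<close> by (simp add: power2_eq_square algebra_simps)
      finally show ?thesis using e by simp
    qed
    have "?g \<in> SU2"
      unfolding SU2_iff using d e by (intro exI[of _ "e * (1 + of_real t)"] exI[of _ "e * \<i> * cnj q"])
        (simp add: algebra_simps)
    moreover have "Ad ?g x0 = y"
    proof -
      have "e * (1 + of_real t) * (e * (1 + of_real t)) + e * \<i> * q * (e * \<i> * cnj q)
        = e * e * ((1 + of_real t) * (1 + of_real t) - q * cnj q)" by (simp add: algebra_simps)
      also have "(1 + of_real t) * (1 + of_real t) - q * cnj q = 2 * (1 + complex_of_real t) * of_real t"
        unfolding \<open>q * cnj q = _\<close> by (simp add: power2_eq_square algebra_simps)
      finally have 1: "e * (1 + of_real t) * (e * (1 + of_real t)) + e * \<i> * q * (e * \<i> * cnj q) = of_real t"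
        using e by (simp add: mult.assoc[symmetric])
      have "- 2 * \<i> * (e * (1 + of_real t)) * (e * \<i> * q) = e * e * (2 * (1 + of_real t)) * q"
        "2 * \<i> * (e * \<i> * cnj q) * (e * (1 + of_real t)) = - (e * e * (2 * (1 + of_real t)) * cnj q)"
        by (simp_all add: algebra_simps)
      then show ?thesis
        unfolding Ad_mat2_x0[OF d] 1 y s p r by (simp only: e) simp
    qed
    ultimately show ?thesis by blast
  qed
  then show ?thesis by (auto simp: orbit_def)
qed

text \<open>The polar decomposition of \<open>y\<close> in the complex orbit has unitary part
  \<open>unit_part y\<close>: since \<open>y\<^sup>-\<^sup>1 = - y\<close>, it is the normalised skew-Hermitian part.\<close>

definition skew_part :: "cmat \<Rightarrow> cmat" where
  "skew_part y = (1 / 2) *\<^sub>R (y - ctransp y)"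

definition herm_part :: "cmat \<Rightarrow> cmat" where
  "herm_part y = (1 / 2) *\<^sub>R (y + ctransp y)"

definition skew_norm :: "cmat \<Rightarrow> real" where
  "skew_norm y = sqrt (Re (det (skew_part y)))"

definition unit_part :: "cmat \<Rightarrow> cmat" where
  "unit_part y = (1 / skew_norm y) *\<^sub>R skew_part y"

lemma parts_Ad:
  assumes "g \<in> SU2"
  shows "skew_part (Ad g y) = Ad g (skew_part y)" "herm_part (Ad g y) = Ad g (herm_part y)"
    "skew_norm (Ad g y) = skew_norm y" "unit_part (Ad g y) = Ad g (unit_part y)"
proof -
  show 1: "skew_part (Ad g y) = Ad g (skew_part y)" "herm_part (Ad g y) = Ad g (herm_part y)"
    using assms by (simp_all add: skew_part_def herm_part_def Ad_linear ctransp_Ad)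
  show 2: "skew_norm (Ad g y) = skew_norm y"
    using assms by (simp add: skew_norm_def 1 det_Ad SU2_SL2C)
  show "unit_part (Ad g y) = Ad g (unit_part y)"
    by (simp add: unit_part_def 1 2 Ad_linear)
qed

lemma ctransp_parts: "ctransp (skew_part y) = - skew_part y" "ctransp (herm_part y) = herm_part y"
  by (simp_all add: skew_part_def herm_part_def ctransp_linear scaleR_minus_right[symmetric] add.commute del: scaleR_minus_right)

lemma skew_plus_herm: "skew_part y + herm_part y = y"
  by (simp add: skew_part_def herm_part_def scaleR_add_right[symmetric] del: scaleR_add_right)

text \<open>The determinant is 1 minus that of the Hermitian part, and a trace-free Hermitian matrix
  has determinant at most 0. Hence the normalisation never divides by 0 and the square root stays in
  its smooth range.\<close>

lemma det_skew_part:
  assumes "y \<in> OrbC"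
  shows "det (skew_part y) = of_real ((skew_norm y)\<^sup>2)" "skew_norm y \<ge> 1" "1 \<le> Re (det (skew_part y))"
proof -
  obtain p q r s where y: "y = mat2 p q r s" by (rule cmat_cases)
  have s: "s = - p" and pq: "p * p + q * r = - 1" using assms by (auto simp: y OrbC_iff)
  have 0: "Im (det (skew_part y)) = 0"
    by (simp add: skew_part_def y s algebra_simps)
  have "Re (p * p + q * r) = - 1" using pq by simp
  then have "Re (det (skew_part y)) = 1 + (Re p)\<^sup>2 + ((Re q + Re r)\<^sup>2 + (Im q - Im r)\<^sup>2) / 4"
    by (simp add: skew_part_def y s power2_eq_square field_simps)
  then show 1: "1 \<le> Re (det (skew_part y))" by simp
  show "skew_norm y \<ge> 1" using 1 by (simp add: skew_norm_def)
  show "det (skew_part y) = of_real ((skew_norm y)\<^sup>2)"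
    using 0 1 by (simp add: skew_norm_def complex_eq_iff)
qed

lemma unit_part_in_Orb:
  assumes "y \<in> OrbC"
  shows "unit_part y \<in> Orb"
proof (rule OrbI)
  obtain p q r s where y: "skew_part y = mat2 p q r s" by (rule cmat_cases)
  have 0: "skew_norm y \<noteq> 0" using det_skew_part[OF assms] by auto
  obtain p' q' r' s' where y': "y = mat2 p' q' r' s'" by (rule cmat_cases)
  have "s' = - p'" using assms by (simp add: y' OrbC_iff)
  with y have "p = (p' - cnj p') / 2" "s = (cnj p' - p') / 2" by (auto simp: y' skew_part_def)
  then have "s = - p" by (simp only: minus_divide_left minus_diff_eq)
  moreover have "p * s - q * r = of_real ((skew_norm y)\<^sup>2)"
    using det_skew_part(1)[OF assms] by (simp add: y)
  then have "p * p + q * r = - of_real ((skew_norm y)\<^sup>2)"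
    unfolding \<open>s = - p\<close> by (metis minus_diff_eq diff_minus_eq_add mult_minus_right minus_add_distrib minus_minus uminus_add_conv_diff)
  ultimately show "unit_part y \<in> OrbC"
    using 0 unfolding unit_part_def y
    by (simp add: OrbC_iff field_simps power2_eq_square)
  show "ctransp (unit_part y) = - unit_part y"
    by (simp add: unit_part_def ctransp_linear ctransp_parts)
qed

section \<open>The fibre over x as a sheet of a hyperboloid\<close>

text \<open>The sum of C times \<open>x0\<close> and an off-diagonal Hermitian matrix. The factor -
  \<i> in front of u is chosen so that conjugation by the element of SU(1,1) with first row (a, b)
  gives u = 2 a b.\<close>

definition hyperboloid_point :: "real \<Rightarrow> complex \<Rightarrow> cmat" where
  "hyperboloid_point C u = mat2 (\<i> * of_real C) (- \<i> * u) (\<i> * cnj u) (- \<i> * of_real C)"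

lemma hyperboloid_point_in_OrbC: "C\<^sup>2 = 1 + (cmod u)\<^sup>2 \<Longrightarrow> hyperboloid_point C u \<in> OrbC"
proof -
  assume "C\<^sup>2 = 1 + (cmod u)\<^sup>2"
  then have "complex_of_real (C\<^sup>2) = of_real (1 + (cmod u)\<^sup>2)" by simp
  then have "of_real C * of_real C = 1 + u * cnj u"
    unfolding of_real_add complex_norm_square by (simp add: power2_eq_square)
  then show ?thesis by (simp add: hyperboloid_point_def OrbC_iff algebra_simps)
qed

lemma unit_part_eq_x0:
  assumes "y \<in> OrbC" "unit_part y = x0"
  shows "\<exists>C u. y = hyperboloid_point C u \<and> C \<ge> 1 \<and> C\<^sup>2 = 1 + (cmod u)\<^sup>2"
proof -
  obtain p q r s where y: "y = mat2 p q r s" by (rule cmat_cases)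
  have s: "s = - p" and pq: "p * p + q * r = - 1" using assms(1) by (auto simp: y OrbC_iff)
  define C where "C = skew_norm y"
  have C: "C \<ge> 1" using det_skew_part[OF assms(1)] by (simp add: C_def)
  have "skew_part y = C *\<^sub>R x0"
    using C unfolding assms(2)[symmetric] unit_part_def C_def by simp
  from arg_cong[OF this, of "\<lambda>M. M $ 1 $ 1"] arg_cong[OF this, of "\<lambda>M. M $ 1 $ 2"]
  have p: "Im p = C" and qr: "q = cnj r"
    by (simp_all add: skew_part_def y x0_def complex_eq_iff)
  \<comment> \<open>As q = cnj r, the product q r is real, so this imaginary part is 2 Re p Im p,
    and Im p = C >= 1 forces Re p = 0.\<close>
  have "Im (p * p + q * r) = 0" using pq by simp
  then have "Re p = 0" using p C by (simp add: qr)
  then have p: "p = \<i> * of_real C" using p by (simp add: complex_eq_iff)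
  have "C\<^sup>2 = 1 + (cmod q)\<^sup>2"
  proof -
    have "r = cnj q" using qr by simp
    then have "complex_of_real (C\<^sup>2) = of_real (1 + (cmod q)\<^sup>2)"
      unfolding of_real_add complex_norm_square using pq
      by (simp add: p power2_eq_square algebra_simps)
    then show ?thesis unfolding of_real_eq_iff .
  qed
  then show ?thesis using C
    by (intro exI[of _ C] exI[of _ "\<i> * q"]) (simp add: y s p qr hyperboloid_point_def norm_mult)
qed

lemma parts_hyperboloid_point:
  assumes "C \<ge> 1"
  shows "skew_part (hyperboloid_point C u) = C *\<^sub>R x0"
    "herm_part (hyperboloid_point C u) = mat2 0 (- \<i> * u) (\<i> * cnj u) 0"
    "skew_norm (hyperboloid_point C u) = C"
    "unit_part (hyperboloid_point C u) = x0"
proof -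
  show 1: "skew_part (hyperboloid_point C u) = C *\<^sub>R x0"
    "herm_part (hyperboloid_point C u) = mat2 0 (- \<i> * u) (\<i> * cnj u) 0"
    by (simp_all add: skew_part_def herm_part_def hyperboloid_point_def x0_def)
  show 2: "skew_norm (hyperboloid_point C u) = C"
    using assms by (simp add: skew_norm_def 1 x0_def)
  show "unit_part (hyperboloid_point C u) = x0"
    using assms by (simp add: unit_part_def 1 2)
qed

text \<open>The normal form behind the fibrewise checks: a rotation that brings
  \<open>unit_part y\<close> back to \<open>x0\<close> brings y to the hyperboloid.\<close>

lemma OrbC_cases:
  assumes "y \<in> OrbC"
  obtains k C u where "k \<in> SU2" "y = Ad k (hyperboloid_point C u)" "C \<ge> 1" "C\<^sup>2 = 1 + (cmod u)\<^sup>2"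
    "unit_part y = Ad k x0"
proof -
  obtain k where k: "k \<in> SU2" "unit_part y = Ad k x0"
    using unit_part_in_Orb[OF assms] by (auto simp: orbit_def)
  let ?y = "Ad (matrix_inv k) y"
  have "?y \<in> OrbC" using assms k by (simp add: Ad_in_OrbC SU2_SL2C SU2_inv(2))
  moreover have "unit_part ?y = x0"
    using k by (simp add: parts_Ad SU2_inv(2) Ad_inv SU2_SL2C)
  ultimately obtain C u where "?y = hyperboloid_point C u" "C \<ge> 1" "C\<^sup>2 = 1 + (cmod u)\<^sup>2"
    using unit_part_eq_x0 by blast
  then show thesis using k by (intro that[of k C u]) (auto simp: Ad_inv SU2_SL2C dest: sym)
qed

lemma Ad_SU11_x0:
  assumes "(cmod a)\<^sup>2 - (cmod b)\<^sup>2 = 1"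
  shows "Ad (mat2 a b (cnj b) (cnj a)) x0 = hyperboloid_point ((cmod a)\<^sup>2 + (cmod b)\<^sup>2) (2 * a * b)"
    "((cmod a)\<^sup>2 + (cmod b)\<^sup>2)\<^sup>2 = 1 + (cmod (2 * a * b))\<^sup>2" "(cmod a)\<^sup>2 + (cmod b)\<^sup>2 \<ge> 1"
proof -
  have "complex_of_real ((cmod a)\<^sup>2 - (cmod b)\<^sup>2) = 1" using assms by simp
  then have d: "a * cnj a - b * cnj b = 1" unfolding of_real_diff complex_norm_square .
  show "Ad (mat2 a b (cnj b) (cnj a)) x0 = hyperboloid_point ((cmod a)\<^sup>2 + (cmod b)\<^sup>2) (2 * a * b)"
    unfolding Ad_mat2_x0[OF d] hyperboloid_point_def of_real_add complex_norm_square by simp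
  have "((cmod a)\<^sup>2 + (cmod b)\<^sup>2)\<^sup>2 = ((cmod a)\<^sup>2 - (cmod b)\<^sup>2)\<^sup>2 + (2 * cmod a * cmod b)\<^sup>2"
    by (simp add: power2_eq_square algebra_simps)
  then show "((cmod a)\<^sup>2 + (cmod b)\<^sup>2)\<^sup>2 = 1 + (cmod (2 * a * b))\<^sup>2" 
    by (simp add: assms norm_mult)
  show "(cmod a)\<^sup>2 + (cmod b)\<^sup>2 \<ge> 1" using assms zero_le_power2[of "cmod b"] by linarith
qed

lemma OrbNC_eq: "OrbNC = {hyperboloid_point C u | C u. C \<ge> 1 \<and> C\<^sup>2 = 1 + (cmod u)\<^sup>2}"
proof (intro equalityI subsetI)
  fix y assume "y \<in> OrbNC"
  then obtain a b where "(cmod a)\<^sup>2 - (cmod b)\<^sup>2 = 1" "y = Ad (mat2 a b (cnj b) (cnj a)) x0"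
    by (auto simp: orbit_def SU11_def)
  then show "y \<in> {hyperboloid_point C u | C u. C \<ge> 1 \<and> C\<^sup>2 = 1 + (cmod u)\<^sup>2}"
    using Ad_SU11_x0 by blast
next
  fix y assume "y \<in> {hyperboloid_point C u | C u. C \<ge> 1 \<and> C\<^sup>2 = 1 + (cmod u)\<^sup>2}"
  then obtain C u where y: "y = hyperboloid_point C u" and C: "C \<ge> 1" "C\<^sup>2 = 1 + (cmod u)\<^sup>2" by blast
  \<comment> \<open>The stabiliser U(1) allows a positive real a. Then |a|^2 + |b|^2 = C and |a|^2 -
    |b|^2 = 1 determine a, and 2 a b = u determines b.\<close>
  define a where "a = sqrt ((C + 1) / 2)"
  define b where "b = u / (2 * of_real a)"
  have a: "a > 0" "a\<^sup>2 = (C + 1) / 2" using C by (simp_all add: a_def)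
  have "(cmod b)\<^sup>2 = (cmod u)\<^sup>2 / (4 * a\<^sup>2)"
    using a by (simp add: b_def norm_divide norm_mult power_divide power_mult_distrib)
  also have "\<dots> = (C - 1) * (C + 1) / (2 * (C + 1))"
  proof -
    have "(cmod u)\<^sup>2 = (C - 1) * (C + 1)" using C(2) by (simp add: power2_eq_square algebra_simps)
    then show ?thesis by (simp only: a(2))
  qed
  also have "\<dots> = (C - 1) / 2" using C by (intro mult_divide_mult_cancel_right) simp
  finally have b: "(cmod b)\<^sup>2 = (C - 1) / 2" .
  have ab: "(cmod (of_real a))\<^sup>2 - (cmod b)\<^sup>2 = 1" using a b by (simp add: field_simps)
  have "Ad (mat2 (of_real a) b (cnj b) (cnj (of_real a))) x0 = y"
  proof -
    have "(cmod (of_real a))\<^sup>2 + (cmod b)\<^sup>2 = C" using a b by (simp add: field_simps)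
    moreover have "2 * of_real a * b = u" using a by (simp add: b_def)
    ultimately show ?thesis unfolding Ad_SU11_x0(1)[OF ab] y by (simp only:)
  qed
  then show "y \<in> OrbNC" unfolding orbit_def SU11_def using ab by blast
qed

lemma unit_part_OrbNC: "y \<in> OrbNC \<longleftrightarrow> y \<in> OrbC \<and> unit_part y = x0"
  unfolding OrbNC_eq using unit_part_eq_x0 parts_hyperboloid_point(4) hyperboloid_point_in_OrbC by blast

subsection \<open>The diffeomorphism from the tangent bundle\<close>

lemma smooth_on_mat2 [intro!]:
  assumes "smooth_on S a" "smooth_on S b" "smooth_on S c" "smooth_on S d"
  shows "smooth_on S (\<lambda>p. mat2 (a p) (b p) (c p) (d p))"
proof -
  let ?f = "\<lambda>i j p. if i = (1::2) then if j = (1::2) then a p else b p else if j = 1 then c p else d p"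
  have "smooth_on S (?f i j)" for i j
    using assms by (cases "i = 1"; cases "j = 1") auto
  then have "smooth_on S (\<lambda>p. \<chi> i j. ?f i j p)"
    by (intro smooth_on_vec_lambda)
  moreover have "(\<chi> i j. ?f i j p) = mat2 (a p) (b p) (c p) (d p)" for p
    by (simp add: cmat_eq_iff)
  ultimately show ?thesis by simp
qed

text \<open>Reduces smoothness of matrix expressions to that of polynomials in the entries and their
  conjugates.\<close>

lemma cmat_entries:
  "A ** B = mat2 (A $ 1 $ 1 * B $ 1 $ 1 + A $ 1 $ 2 * B $ 2 $ 1) (A $ 1 $ 1 * B $ 1 $ 2 + A $ 1 $ 2 * B $ 2 $ 2)
     (A $ 2 $ 1 * B $ 1 $ 1 + A $ 2 $ 2 * B $ 2 $ 1) (A $ 2 $ 1 * B $ 1 $ 2 + A $ 2 $ 2 * B $ 2 $ 2)"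
  "k *\<^sub>M A = mat2 (k * A $ 1 $ 1) (k * A $ 1 $ 2) (k * A $ 2 $ 1) (k * A $ 2 $ 2)"
  "ctransp A = mat2 (cnj (A $ 1 $ 1)) (cnj (A $ 2 $ 1)) (cnj (A $ 1 $ 2)) (cnj (A $ 2 $ 2))"
  for A B :: cmat
  by (simp_all add: cmat_eq_iff matrix_matrix_mult_def sum_2 cscale_def ctransp_def map_matrix_def transpose_def)

lemma smooth_on_cmat [intro!]:
  fixes f g :: "'a::euclidean_space \<Rightarrow> cmat"
  assumes "smooth_on S f" "smooth_on S g"
  shows "smooth_on S (\<lambda>p. f p ** g p)"
  unfolding cmat_entries using assms by auto

lemma smooth_on_cscale [intro!]: "smooth_on S k \<Longrightarrow> smooth_on S f \<Longrightarrow> smooth_on S (\<lambda>p. k p *\<^sub>M f p)"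
  unfolding cmat_entries by auto

lemma smooth_on_ctransp [intro!]: "smooth_on S f \<Longrightarrow> smooth_on S (\<lambda>p. ctransp (f p))"
  unfolding cmat_entries by auto

lemma smooth_on_det [intro!]: "smooth_on S f \<Longrightarrow> smooth_on S (\<lambda>p. det (f p :: cmat))"
  unfolding det_2 by auto

lemma smooth_on_parts [intro!]:
  assumes "smooth_on S f"
  shows "smooth_on S (\<lambda>p. skew_part (f p))" "smooth_on S (\<lambda>p. herm_part (f p))"
  unfolding skew_part_def herm_part_def using assms by auto

lemma smooth_on_skew_norm: "smooth_on OrbC skew_norm"
  unfolding skew_norm_def[abs_def] using det_skew_part(3) by (force intro!: smooth_on_sqrt)

lemma smooth_on_unit_part: "smooth_on OrbC unit_part"
  unfolding unit_part_def[abs_def] using det_skew_part(2)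
  by (force intro!: smooth_on_skew_norm)

lemma inv_into_ident: "t \<in> S \<Longrightarrow> inv_into S (\<lambda>p. p) t = t"
  by (metis f_inv_into_f image_ident)

lemma smooth_map_embI:
  assumes "f ` S \<subseteq> T" "smooth_on S f"
  shows "smooth_map (emb S) (emb T) f"
proof -
  have "smooth_on S (\<lambda>t. f (inv_into S (\<lambda>p. p) t))"
    by (rule smooth_on_eq[OF assms(2)]) (simp add: inv_into_ident)
  then show ?thesis
    using assms(1) unfolding smooth_map_def emb_def points_def
    by (auto intro!: exI[of _ UNIV])
qed

lemma points_emb [simp]: "points (emb S) = S"
  by (simp add: points_def emb_def)

lemma diffeo_embI:
  assumes "\<And>x. x \<in> S \<Longrightarrow> f x \<in> T" "\<And>y. y \<in> T \<Longrightarrow> g y \<in> S" "\<And>x. x \<in> S \<Longrightarrow> g (f x) = x"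
    "\<And>y. y \<in> T \<Longrightarrow> f (g y) = y" "smooth_on S f" "smooth_on T g"
  shows "diffeo (emb S) (emb T) f"
proof -
  have bij: "bij_betw f S T"
    using assms(1-4) by (intro bij_betw_byWitness[where f' = g]) auto
  have "inv_into S f y = g y" if "y \<in> T" for y
    using bij_betw_imp_inj_on[OF bij] assms(2)[OF that] assms(4)[OF that] by (metis inv_into_f_f)
  then have "smooth_on T (inv_into S f)" by (intro smooth_on_eq[OF assms(6)]) simp
  then show ?thesis
    unfolding diffeo_def points_emb using bij assms(5)
    by (auto intro!: smooth_map_embI dest: bij_betw_apply inv_into_into simp: bij_betw_def)
qed

section \<open>The tangent bundle and its explicit map to the complex orbit\<close>

definition mm_elem :: "complex \<Rightarrow> cmat" where
  "mm_elem c = mat2 0 (- cnj c) c 0"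

lemma mm_eq: "mm = range mm_elem"
  by (auto simp: mm_def mm_elem_def)

text \<open>Matrices that anticommute with \<open>x0\<close> are off-diagonal, and being
  skew-Hermitian cuts them down to \<open>mm\<close>; both conditions are invariant under SU(2). The
  outcome no longer mentions the group element g.\<close>

lemma T_Orb_iff: "(z, v) \<in> T_Orb \<longleftrightarrow> z \<in> Orb \<and> ctransp v = - v \<and> v ** z = - (z ** v)"
proof
  assume "(z, v) \<in> T_Orb"
  then obtain g c where g: "g \<in> SU2" "z = Ad g x0" "v = Ad g (mm_elem c)" by (auto simp: T_Orb_def mm_eq)
  have "mm_elem c ** x0 = - (x0 ** mm_elem c)" "ctransp (mm_elem c) = - mm_elem c"
    by (simp_all add: x0_def mm_elem_def)
  then show "z \<in> Orb \<and> ctransp v = - v \<and> v ** z = - (z ** v)"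
    using g by (simp add: orbit_def ctransp_Ad SU2_SL2C Ad_linear flip: Ad_matrix_mult)
next
  assume *: "z \<in> Orb \<and> ctransp v = - v \<and> v ** z = - (z ** v)"
  then obtain g where g: "g \<in> SU2" "z = Ad g x0" by (auto simp: orbit_def)
  define a where "a = Ad (matrix_inv g) v"
  note g' = SU2_inv(2)[OF g(1)]
  have v: "v = Ad g a" using g by (simp add: a_def Ad_inv SU2_SL2C)
  have x: "x0 = Ad (matrix_inv g) z" using g by (simp add: Ad_inv SU2_SL2C)
  have 1: "ctransp a = - a" using * g' by (simp add: a_def ctransp_Ad Ad_linear)
  have 2: "a ** x0 = - (x0 ** a)"
    using * g' by (simp add: a_def x SU2_SL2C Ad_linear flip: Ad_matrix_mult)
  obtain p q r s where a: "a = mat2 p q r s" by (rule cmat_cases)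
  have "p = 0" "s = 0" "q = - cnj r" using 1 2 by (auto simp: a x0_def)
  then have "a \<in> mm" by (auto simp: a mm_eq mm_elem_def)
  then show "(z, v) \<in> T_Orb" using g v by (auto simp: T_Orb_def)
qed

text \<open>The duplication formula of sinh divided by r, with r = 0 checked apart.\<close>

lemma sinh_sqrt_double: "2 * cosh r * sinh_sqrt (r\<^sup>2) = 2 * sinh_sqrt (4 * r\<^sup>2)"
proof (cases "r = 0")
  case False
  have e: "(2 * r)\<^sup>2 = 4 * r\<^sup>2" by (simp add: power_mult_distrib)
  have "2 * r * sinh_sqrt ((2 * r)\<^sup>2) = 2 * (r * sinh_sqrt (r\<^sup>2)) * cosh r"
    unfolding sinh_sqrt_square by (rule sinh_double)
  then have "r * (2 * cosh r * sinh_sqrt (r\<^sup>2)) = r * (2 * sinh_sqrt (4 * r\<^sup>2))"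
    unfolding e[symmetric] by (simp only: ac_simps)
  then show ?thesis unfolding mult_left_cancel[OF False] .
qed simp

lemma mexp_mm:
  "mexp (\<i> *\<^sub>M mm_elem c) = mat2 (of_real (cosh (cmod c))) (- \<i> * of_real (sinh_sqrt ((cmod c)\<^sup>2)) * cnj c)
    (\<i> * of_real (sinh_sqrt ((cmod c)\<^sup>2)) * c) (of_real (cosh (cmod c)))"
proof -
  have "(\<i> *\<^sub>M mm_elem c) ** (\<i> *\<^sub>M mm_elem c) = (cmod c)\<^sup>2 *\<^sub>R mat 1"
    unfolding mat_one_mat2 mat2_linear complex_norm_square mm_elem_def by (simp add: algebra_simps)
  from mexp_of_square[OF this] show ?thesis
    by (simp add: mat_one_mat2) (simp add: mm_elem_def)
qed

lemma mexp_mm_norm: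
  "(cmod (of_real (cosh (cmod c))))\<^sup>2 - (cmod (- \<i> * of_real (sinh_sqrt ((cmod c)\<^sup>2)) * cnj c))\<^sup>2 = 1"
proof -
  have "cmod (- \<i> * of_real (sinh_sqrt ((cmod c)\<^sup>2)) * cnj c) = sinh (cmod c)"
    using sinh_sqrt_pos[of "(cmod c)\<^sup>2"] sinh_sqrt_square[of "cmod c"] by (simp add: norm_mult mult.commute)
  then show ?thesis by (simp add: cosh_square_eq)
qed

text \<open>The exponential lies in SU(1,1) with a = cosh |c| and |b| = sinh |c|, so the hyperboloid
  coordinates |a|^2 + |b|^2 and 2 a b are hyperbolic functions of the doubled argument.\<close>

lemma Ad_mexp_mm:
  "Ad (mexp (\<i> *\<^sub>M mm_elem c)) x0 =
    hyperboloid_point (cosh (2 * cmod c)) (- \<i> * of_real (2 * sinh_sqrt (4 * (cmod c)\<^sup>2)) * cnj c)"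
proof -
  let ?a = "complex_of_real (cosh (cmod c))" and ?b = "- \<i> * of_real (sinh_sqrt ((cmod c)\<^sup>2)) * cnj c"
  have b: "cmod ?b = sinh (cmod c)"
    using sinh_sqrt_pos[of "(cmod c)\<^sup>2"] sinh_sqrt_square[of "cmod c"] by (simp add: norm_mult mult.commute)
  have "2 * ?a * ?b = - \<i> * of_real (2 * cosh (cmod c) * sinh_sqrt ((cmod c)\<^sup>2)) * cnj c"
    by simp
  also note sinh_sqrt_double
  finally have 1: "2 * ?a * ?b = - \<i> * of_real (2 * sinh_sqrt (4 * (cmod c)\<^sup>2)) * cnj c" .
  have 2: "(cmod ?a)\<^sup>2 + (cmod ?b)\<^sup>2 = cosh (2 * cmod c)"
    unfolding b cosh_double by simp
  have "mexp (\<i> *\<^sub>M mm_elem c) = mat2 ?a ?b (cnj ?b) (cnj ?a)"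
    by (simp add: mexp_mm)
  then show ?thesis
    using Ad_SU11_x0(1)[OF mexp_mm_norm[of c]] unfolding 1 2 by simp
qed

text \<open>With r^2 = det v, the argument 4 det v is (2 r)^2 and the coefficients are cosh (2 r)
  and sinh (2 r) / r, with no square root taken and no g chosen.\<close>

definition phi :: "cmat \<times> cmat \<Rightarrow> cmat" where
  "phi zv = (case zv of (z, v) \<Rightarrow>
     cosh_sqrt (4 * Re (det v)) *\<^sub>R z + (2 * sinh_sqrt (4 * Re (det v))) *\<^sub>R (\<i> *\<^sub>M (v ** z)))"

text \<open>The Hermitian part is B = 2 S \<i> v z with S = sinh_sqrt (4 r^2). Since z^2 = -1,
  multiplying by z on the right and by \<i> gives \<i> B z = 2 S v; the number 4 r^2 is read off
  from skew_norm = cosh (2 r).\<close>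

definition phi_inv :: "cmat \<Rightarrow> cmat \<times> cmat" where
  "phi_inv y = (unit_part y,
     (1 / (2 * sinh_sqrt ((arcosh (skew_norm y))\<^sup>2))) *\<^sub>R (\<i> *\<^sub>M (herm_part y ** unit_part y)))"

lemma phi_Ad: "g \<in> SU2 \<Longrightarrow> phi (Ad g z, Ad g v) = Ad g (phi (z, v))"
  by (simp add: phi_def det_Ad SU2_SL2C Ad_linear flip: Ad_matrix_mult)

lemma phi_inv_Ad: "g \<in> SU2 \<Longrightarrow> phi_inv (Ad g y) = map_prod (Ad g) (Ad g) (phi_inv y)"
  by (simp add: phi_inv_def parts_Ad SU2_SL2C Ad_linear flip: Ad_matrix_mult)

lemma phi_x0: "phi (x0, mm_elem c) =
    hyperboloid_point (cosh (2 * cmod c)) (- \<i> * of_real (2 * sinh_sqrt (4 * (cmod c)\<^sup>2)) * cnj c)"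
proof -
  have d: "Re (det (mm_elem c)) = (cmod c)\<^sup>2"
    by (simp add: cmod_power2 mm_elem_def) (simp add: power2_eq_square)
  have C: "cosh_sqrt (4 * (cmod c)\<^sup>2) = cosh (2 * cmod c)"
    using cosh_sqrt_square[of "2 * cmod c"] by (simp add: power_mult_distrib)
  show ?thesis
    by (simp only: phi_def prod.case d C) (simp add: x0_def hyperboloid_point_def mm_elem_def algebra_simps)
qed

lemma cosh_sinh_norm:
  "(cosh (2 * cmod c))\<^sup>2 = 1 + (cmod (- \<i> * of_real (2 * sinh_sqrt (4 * (cmod c)\<^sup>2)) * cnj c))\<^sup>2"
proof -
  have "cmod (- \<i> * of_real (2 * sinh_sqrt (4 * (cmod c)\<^sup>2)) * cnj c) = 2 * cmod c * sinh_sqrt ((2 * cmod c)\<^sup>2)"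
    using sinh_sqrt_pos[of "4 * (cmod c)\<^sup>2"] by (simp add: norm_mult power_mult_distrib)
  also have "\<dots> = sinh (2 * cmod c)" by (rule sinh_sqrt_square)
  finally show ?thesis by (simp add: cosh_square_eq)
qed

lemma phi_inv_phi:
  assumes "zv \<in> T_Orb"
  shows "phi zv \<in> OrbC" "phi_inv (phi zv) = zv"
proof -
  obtain g c where g: "g \<in> SU2" and zv: "zv = (Ad g x0, Ad g (mm_elem c))"
    using assms by (auto simp: T_Orb_def mm_eq)
  let ?u = "- \<i> * of_real (2 * sinh_sqrt (4 * (cmod c)\<^sup>2)) * cnj c"
  have "phi (x0, mm_elem c) \<in> OrbC"
    unfolding phi_x0 by (rule hyperboloid_point_in_OrbC[OF cosh_sinh_norm])
  then show "phi zv \<in> OrbC" using g by (simp add: zv phi_Ad Ad_in_OrbC SU2_SL2C)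
  have a: "(arcosh (cosh (2 * cmod c)))\<^sup>2 = 4 * (cmod c)\<^sup>2"
    by (simp add: arcosh_cosh_real power_mult_distrib)
  have "phi_inv (phi (x0, mm_elem c)) = (x0, mm_elem c)"
    using sinh_sqrt_pos[of "4 * (cmod c)\<^sup>2"]
    unfolding phi_x0 phi_inv_def parts_hyperboloid_point[OF cosh_real_ge_1] a
    by (simp add: x0_def mm_elem_def algebra_simps)
  then show "phi_inv (phi zv) = zv" using g by (simp add: zv phi_Ad phi_inv_Ad)
qed

lemma hyperboloid_point_eq_phi:
  assumes "C \<ge> 1" "C\<^sup>2 = 1 + (cmod u)\<^sup>2"
  shows "\<exists>c. phi_inv (hyperboloid_point C u) = (x0, mm_elem c) \<and> phi (x0, mm_elem c) = hyperboloid_point C u"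
proof -
  let ?r = "arcosh C"
  let ?S = "sinh_sqrt (?r\<^sup>2)"
  \<comment> \<open>Solves u = - 2 \<i> S cnj c. As S is taken at \<open>arcosh C\<close>, it
    remains to see that this equals 2 |c|, which follows from |u| = sinh (arcosh C).\<close>
  define c where "c = - \<i> * cnj u / (2 * of_real ?S)"
  have S: "?S > 0" by (simp add: sinh_sqrt_pos)
  have r: "cosh ?r = C" "?r \<ge> 0" using assms by (simp_all add: arcosh_nonneg_real)
  have "(?r * ?S)\<^sup>2 = (cmod u)\<^sup>2"
    unfolding sinh_sqrt_square using assms(2) r by (simp add: sinh_square_eq)
  then have "?r * ?S = cmod u" using r(2) S by simp
  moreover have c: "2 * cmod c * ?S = cmod u" using S by (simp add: c_def norm_divide norm_mult)
  ultimately have rc: "2 * cmod c = ?r" using S by (metis mult_cancel_right less_irrefl)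
  have r2: "4 * (cmod c)\<^sup>2 = ?r\<^sup>2" unfolding rc[symmetric] by (simp add: power_mult_distrib)
  have "- \<i> * of_real (2 * ?S) * cnj c = u" using S by (simp add: c_def)
  then have "phi (x0, mm_elem c) = hyperboloid_point C u"
    unfolding phi_x0 rc r r2 by simp
  moreover have "(x0, mm_elem c) \<in> T_Orb"
    using x0_in_Orb by (simp add: T_Orb_iff) (simp add: x0_def mm_elem_def)
  ultimately show ?thesis using phi_inv_phi by metis
qed

lemma phi_phi_inv:
  assumes "y \<in> OrbC"
  shows "phi_inv y \<in> T_Orb" "phi (phi_inv y) = y"
proof -
  obtain k C u where k: "k \<in> SU2" and y: "y = Ad k (hyperboloid_point C u)" and C: "C \<ge> 1" "C\<^sup>2 = 1 + (cmod u)\<^sup>2"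
    using OrbC_cases[OF assms] by metis
  obtain c where c: "phi_inv (hyperboloid_point C u) = (x0, mm_elem c)" "phi (x0, mm_elem c) = hyperboloid_point C u"
    using hyperboloid_point_eq_phi[OF C] by blast
  have "phi_inv y = (Ad k x0, Ad k (mm_elem c))" using k by (simp add: y phi_inv_Ad c)
  then show "phi_inv y \<in> T_Orb" "phi (phi_inv y) = y" using k c
    by (auto simp: T_Orb_def mm_eq y phi_Ad)
qed

lemma diffeo_phi: "diffeo (emb T_Orb) (emb OrbC) phi"
proof (rule diffeo_embI[where g = phi_inv])
  show "smooth_on T_Orb phi"
    unfolding phi_def[abs_def] case_prod_beta by auto
  have "smooth_on OrbC (\<lambda>y. (arcosh (skew_norm y))\<^sup>2)"
    by (rule smooth_on_compose[OF smooth_on_arcosh_square smooth_on_skew_norm])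
      (simp add: det_skew_part)
  then have "smooth_on OrbC (\<lambda>y. 1 / (2 * sinh_sqrt ((arcosh (skew_norm y))\<^sup>2)))"
    using sinh_sqrt_pos by (intro smooth_on_divide) (auto simp: less_imp_neq[symmetric])
  then show "smooth_on OrbC phi_inv"
    unfolding phi_inv_def[abs_def] by (intro smooth_on_Pair smooth_on_scaleR smooth_on_cscale
      smooth_on_cmat smooth_on_unit_part smooth_on_parts smooth_on_id smooth_on_const)
qed (simp_all add: phi_inv_phi phi_phi_inv)

section \<open>The factors exp (i m) and exp (i t)\<close>

lemma exp_im_orbit: "(\<lambda>f. Ad f x0) ` exp_im = OrbNC"
proof -
  have "(\<lambda>f. Ad f x0) ` exp_im = range (\<lambda>c. phi (x0, mm_elem c))"
    unfolding exp_im_def mm_eq image_image Ad_mexp_mm phi_x0 ..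
  also have "\<dots> = {hyperboloid_point C u | C u. C \<ge> 1 \<and> C\<^sup>2 = 1 + (cmod u)\<^sup>2}"
  proof (intro equalityI subsetI)
    fix y assume "y \<in> range (\<lambda>c. phi (x0, mm_elem c))"
    then obtain c where "y = phi (x0, mm_elem c)" by blast
    then show "y \<in> {hyperboloid_point C u | C u. C \<ge> 1 \<and> C\<^sup>2 = 1 + (cmod u)\<^sup>2}"
      unfolding phi_x0 mem_Collect_eq
      by (intro exI conjI) (assumption | rule cosh_real_ge_1 cosh_sinh_norm)+
  next
    fix y assume "y \<in> {hyperboloid_point C u | C u. C \<ge> 1 \<and> C\<^sup>2 = 1 + (cmod u)\<^sup>2}"
    then obtain C u where "y = hyperboloid_point C u" "C \<ge> 1" "C\<^sup>2 = 1 + (cmod u)\<^sup>2" by blast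
    moreover then obtain c where "phi (x0, mm_elem c) = hyperboloid_point C u"
      using hyperboloid_point_eq_phi by blast
    ultimately show "y \<in> range (\<lambda>c. phi (x0, mm_elem c))" by (metis rangeI)
  qed
  finally show ?thesis by (simp add: OrbNC_eq)
qed

lemma SU11_SL2C: "g \<in> SU11 \<Longrightarrow> g \<in> SL2C"
proof -
  assume "g \<in> SU11"
  then obtain a b where g: "g = mat2 a b (cnj b) (cnj a)" and "(cmod a)\<^sup>2 - (cmod b)\<^sup>2 = 1"
    by (auto simp: SU11_def)
  then have "complex_of_real ((cmod a)\<^sup>2 - (cmod b)\<^sup>2) = 1" by simp
  then show ?thesis unfolding of_real_diff complex_norm_square by (simp add: g SL2C_def)
qed

lemma mexp_mm_SU11: "mexp (\<i> *\<^sub>M mm_elem c) \<in> SU11"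
proof -
  have "mexp (\<i> *\<^sub>M mm_elem c) = mat2 (of_real (cosh (cmod c)))
    (- \<i> * of_real (sinh_sqrt ((cmod c)\<^sup>2)) * cnj c)
    (cnj (- \<i> * of_real (sinh_sqrt ((cmod c)\<^sup>2)) * cnj c)) (cnj (of_real (cosh (cmod c))))"
    by (simp add: mexp_mm)
  then show ?thesis unfolding SU11_def using mexp_mm_norm[of c] by blast
qed

lemma phi_exp:
  assumes "g \<in> SU2" "a \<in> mm"
  shows "phi (Ad g x0, Ad g a) = g ** mexp (\<i> *\<^sub>M a) ** x0 ** mexp (- (\<i> *\<^sub>M a)) ** matrix_inv g"
proof -
  obtain c where a: "a = mm_elem c" using assms(2) mm_eq by blast
  \<comment> \<open>Replacing c by - c only flips the off-diagonal entries of the exponential, which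
    is what inversion does to a matrix of determinant 1 with equal diagonal entries.\<close>
  have "- (\<i> *\<^sub>M a) = \<i> *\<^sub>M mm_elem (- c)" by (simp add: a mm_elem_def)
  moreover have "matrix_inv (mexp (\<i> *\<^sub>M a)) = mexp (\<i> *\<^sub>M mm_elem (- c))"
    using SU11_SL2C[OF mexp_mm_SU11[of c]] unfolding a mexp_mm SL2C_def mem_Collect_eq det_mat2
    by (subst matrix_inv_mat2) simp_all
  moreover have "phi (Ad g x0, Ad g a) = Ad g (Ad (mexp (\<i> *\<^sub>M a)) x0)"
    unfolding phi_Ad[OF assms(1)] a phi_x0 Ad_mexp_mm ..
  ultimately show ?thesis
    by (simp add: Ad_def matrix_mul_assoc)
qed

text \<open>The exponential is diagonal with entries exp (- t) and exp t, and diagonal matrices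
  commute with \<open>x0\<close>.\<close>

lemma exp_it_stabilizer:
  assumes "e \<in> exp_it"
  shows "e \<in> SL2C" "Ad e x0 = x0"
proof -
  obtain t :: real where e: "e = mexp (\<i> *\<^sub>M mat2 (\<i> * of_real t) 0 0 (- \<i> * of_real t))"
    using assms by (auto simp: exp_it_def tt_def)
  have M: "\<i> *\<^sub>M mat2 (\<i> * of_real t) 0 0 (- \<i> * of_real t) = mat2 (- of_real t) 0 0 (of_real t)" by simp
  have "mat2 (- of_real t) 0 0 (of_real t) ** mat2 (- of_real t) 0 0 (of_real t) = t\<^sup>2 *\<^sub>R mat 1"
    by (simp add: mat_one_mat2 power2_eq_square)
  from mexp_of_square[OF this]
  have e: "e = mat2 (of_real (cosh t - t * sinh_sqrt (t\<^sup>2))) 0 0 (of_real (cosh t + t * sinh_sqrt (t\<^sup>2)))"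
    unfolding e M by (simp add: mat_one_mat2 mult.commute) (simp flip: of_real_mult)
  have d: "complex_of_real (cosh t - t * sinh_sqrt (t\<^sup>2)) * of_real (cosh t + t * sinh_sqrt (t\<^sup>2)) - 0 * 0 = 1"
    unfolding sinh_sqrt_square cosh_minus_sinh cosh_plus_sinh of_real_mult[symmetric] mult_exp_exp by simp
  then show "e \<in> SL2C" unfolding e by (simp add: SL2C_def)
  show "Ad e x0 = x0"
    unfolding e Ad_mat2_x0[OF d] using d by (simp add: x0_def)
qed

subsection \<open>The fibration and the hyperbolic disc\<close>

lemma Orb_form:
  assumes "z \<in> Orb"
  obtains t w where "z = mat2 (\<i> * complex_of_real t) w (- cnj w) (- \<i> * of_real t)"
proof -
  obtain p q r s where z: "z = mat2 p q r s" by (rule cmat_cases)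
  have s: "s = - p" using assms Orb_subset_OrbC by (auto simp: z OrbC_iff)
  have "cnj p = - p" "r = - cnj q" using Orb_ctransp[OF assms] by (simp_all add: z)
  then have "p = \<i> * of_real (Im p)" "r = - cnj q" by (auto simp: complex_eq_iff)
  then show thesis using that[of "Im p" q] by (simp add: z s)
qed

lemma Orb_square: "z \<in> Orb \<Longrightarrow> z ** z = - mat 1"
  using OrbC_square Orb_subset_OrbC by blast

lemma matrix_mult_minus [simp]: "A ** (- B) = - (A ** B)" "(- A) ** B = - (A ** B)" for A B :: cmat
  by (simp_all add: cmat_eq_iff matrix_matrix_mult_def sum_2)

lemma matrix_diff_distrib: "A ** (B - C) = A ** B - A ** C" "(B - C) ** A = B ** A - C ** A" for A B C :: cmat
  by (simp_all add: cmat_eq_iff matrix_matrix_mult_def sum_2 algebra_simps)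

text \<open>As quaternions, \<open>1 - z b\<close> conjugates \<open>b\<close> to \<open>z\<close>.\<close>

definition rotation :: "cmat \<Rightarrow> cmat \<Rightarrow> cmat" where
  "rotation b z = (1 / sqrt (Re (det (mat 1 - z ** b)))) *\<^sub>R (mat 1 - z ** b)"

lemma rotation:
  assumes "z \<in> Orb" "b \<in> Orb" "z \<noteq> - b"
  shows "Re (det (mat 1 - z ** b)) > 0" "rotation b z \<in> SU2" "Ad (rotation b z) b = z"
proof -
  obtain t w where z: "z = mat2 (\<i> * complex_of_real t) w (- cnj w) (- \<i> * of_real t)"
    using Orb_form[OF assms(1)] .
  obtain s v where b: "b = mat2 (\<i> * complex_of_real s) v (- cnj v) (- \<i> * of_real s)"
    using Orb_form[OF assms(2)] .
  let ?q = "mat 1 - z ** b"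
  define \<alpha> where "\<alpha> = 1 + of_real t * of_real s + w * cnj v"
  define \<beta> where "\<beta> = \<i> * cnj w * of_real s - \<i> * of_real t * cnj v"
  have q: "?q = mat2 \<alpha> (- cnj \<beta>) \<beta> (cnj \<alpha>)"
    by (simp add: z b \<alpha>_def \<beta>_def mat_one_mat2 algebra_simps)
  have det: "det ?q = of_real ((cmod \<alpha>)\<^sup>2 + (cmod \<beta>)\<^sup>2)"
    unfolding q det_mat2 of_real_add complex_norm_square by simp
  \<comment> \<open>If z b = 1, then multiplying by b and using b^2 = -1 gives z = - b, the excluded
    antipode.\<close>
  have "?q \<noteq> 0"
  proof
    assume "?q = 0"
    then have "z ** b = mat 1" by (simp only: right_minus_eq)
    then have "z ** (b ** b) = b" by (simp only: matrix_mul_assoc matrix_mul_lid)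
    then have "b = - z" by (simp add: Orb_square[OF assms(2)])
    then show False using assms(3) by simp
  qed
  then have "\<alpha> \<noteq> 0 \<or> \<beta> \<noteq> 0" unfolding q by (auto simp: zero_mat2)
  then have pos: "(cmod \<alpha>)\<^sup>2 + (cmod \<beta>)\<^sup>2 > 0"
    by (metis add_pos_nonneg add_nonneg_pos zero_le_power2 zero_less_power2 norm_eq_zero)
  then show "Re (det ?q) > 0" by (simp add: det)
  define e where "e = complex_of_real (1 / sqrt ((cmod \<alpha>)\<^sup>2 + (cmod \<beta>)\<^sup>2))"
  have r: "rotation b z = mat2 (e * \<alpha>) (- cnj (e * \<beta>)) (e * \<beta>) (cnj (e * \<alpha>))"
    unfolding rotation_def det unfolding q by (simp add: e_def)
  have ee: "e * e * of_real ((cmod \<alpha>)\<^sup>2 + (cmod \<beta>)\<^sup>2) = 1"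
  proof -
    have "1 / sqrt N * (1 / sqrt N) * N = 1" if "N > 0" for N using that by simp
    from this[OF pos] show ?thesis unfolding e_def by (simp only: of_real_mult[symmetric] of_real_1)
  qed
  have "(e * \<alpha>) * cnj (e * \<alpha>) + (e * \<beta>) * cnj (e * \<beta>) = e * e * of_real ((cmod \<alpha>)\<^sup>2 + (cmod \<beta>)\<^sup>2)"
  proof -
    have "cnj e = e" by (simp add: e_def)
    then show ?thesis unfolding of_real_add complex_norm_square by (simp add: algebra_simps)
  qed
  then show SU: "rotation b z \<in> SU2"
    unfolding SU2_iff r ee by blast
  \<comment> \<open>Because z^2 = b^2 = -1, both products with 1 - z b equal z + b, so
    \<open>?q\<close> intertwines b and z.\<close>
  have "z ** ?q = z + b" "?q ** b = z + b"
    using Orb_square[OF assms(1)] Orb_square[OF assms(2)]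
    by (simp_all add: matrix_diff_distrib matrix_mul_assoc) (simp_all flip: matrix_mul_assoc)
  then have "rotation b z ** b = z ** rotation b z"
    by (simp add: rotation_def matrix_scalar_ac flip: scalar_matrix_assoc)
  then show "Ad (rotation b z) b = z"
    using SU by (simp add: Ad_def SL2C_inv SU2_SL2C flip: matrix_mul_assoc)
qed

text \<open>On SU(2) inversion is the conjugate transpose, which is linear over the reals.\<close>

lemma smooth_on_Ad_SU2:
  assumes "smooth_on S g" "smooth_on S f" "\<And>p. p \<in> S \<Longrightarrow> g p \<in> SU2"
  shows "smooth_on S (\<lambda>p. Ad (g p) (f p))" "smooth_on S (\<lambda>p. Ad (matrix_inv (g p)) (f p))"
proof -
  have "smooth_on S (\<lambda>p. g p ** f p ** ctransp (g p))" using assms by auto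
  then show "smooth_on S (\<lambda>p. Ad (g p) (f p))"
    by (rule smooth_on_eq) (simp add: Ad_def SU2_inv assms(3))
  have "smooth_on S (\<lambda>p. ctransp (g p) ** f p ** g p)" using assms by auto
  then show "smooth_on S (\<lambda>p. Ad (matrix_inv (g p)) (f p))"
    by (rule smooth_on_eq) (simp add: Ad_def assms(3) SL2C_inv SU2_SL2C SU2_inv(1)[OF assms(3), symmetric])
qed

text \<open>Around b the bundle is trivialised over the complement of - b: a local section of SU(2)
  -> Orb carries each fibre to the one over \<open>x0\<close>, by equivariance.\<close>

lemma unit_part_fibre_bundle: "smooth_fibre_bundle OrbC Orb OrbNC unit_part"
  unfolding smooth_fibre_bundle_def
proof (intro conjI ballI)
  show "smooth_map (emb OrbC) (emb Orb) unit_part"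
    using unit_part_in_Orb by (intro smooth_map_embI smooth_on_unit_part) auto
  have unit_x0: "unit_part x0 = x0"
    by (simp add: unit_part_def skew_norm_def skew_part_def x0_def)
  have "unit_part z = z" if "z \<in> Orb" for z
    using that unit_x0 by (auto simp: orbit_def parts_Ad)
  then show "unit_part ` OrbC = Orb"
    using unit_part_in_Orb Orb_subset_OrbC by (auto intro!: image_eqI[of _ unit_part, OF sym])
  fix b assume b: "b \<in> Orb"
  then obtain h where h: "h \<in> SU2" "b = Ad h x0" by (auto simp: orbit_def)
  define U where "U = Orb \<inter> {z. z \<noteq> - b}"
  \<comment> \<open>\<open>h\<close> takes \<open>x0\<close> to b and the rotation takes b to z, so
    \<open>K z\<close> takes \<open>x0\<close> to z and depends smoothly on z.\<close>
  define K where "K z = rotation b z ** h" for z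
  have K: "K z \<in> SU2" "Ad (K z) x0 = z" if "z \<in> U" for z
    using rotation[of z b] that b h by (simp_all add: U_def K_def SU2_mult Ad_mult SU2_SL2C)
  have K': "K z \<in> SL2C" if "z \<in> U" for z using K(1)[OF that] by (rule SU2_SL2C)
  have smooth_K: "smooth_on U K"
    unfolding K_def[abs_def] rotation_def[abs_def]
    using rotation(1)[of _ b] b unfolding U_def
    by (intro smooth_on_cmat smooth_on_scaleR smooth_on_divide smooth_on_sqrt smooth_on_Re smooth_on_det
      smooth_on_diff smooth_on_const smooth_on_id) (force simp: less_imp_neq[symmetric])+
  define \<psi> where "\<psi> y = (unit_part y, Ad (matrix_inv (K (unit_part y))) y)" for y
  define \<psi>' where "\<psi>' p = Ad (K (fst p)) (snd p)" for p
  have "openin (top_of_set Orb) U"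
    unfolding openin_open U_def by (intro exI[of _ "{z. z \<noteq> - b}"]) (auto simp: open_Collect_neq)
  moreover have "b \<in> U"
  proof -
    have "b \<noteq> 0" using Orb_square[OF b] by (auto simp: mat_one_mat2 zero_mat2)
    then have "b \<noteq> - b" by (simp add: cmat_eq_iff eq_neg_iff_add_eq_0 flip: mult_2)
    then show ?thesis using b by (simp add: U_def)
  qed
  moreover have "diffeo (emb {y \<in> OrbC. unit_part y \<in> U}) (emb (U \<times> OrbNC)) \<psi>"
  proof (rule diffeo_embI[where g = \<psi>'])
    fix y assume y: "y \<in> {y \<in> OrbC. unit_part y \<in> U}"
    let ?k = "K (unit_part y)"
    have k: "?k \<in> SU2" "?k \<in> SL2C" "Ad ?k x0 = unit_part y" using y K K' by auto
    have "unit_part (Ad (matrix_inv ?k) y) = Ad (matrix_inv ?k) (unit_part y)"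
      using k by (simp add: parts_Ad SU2_inv(2))
    also have "\<dots> = Ad (matrix_inv ?k) (Ad ?k x0)" by (simp only: k(3))
    also have "\<dots> = x0" using k(2) by (rule Ad_inv(1))
    finally show "\<psi> y \<in> U \<times> OrbNC"
      using y k by (simp add: \<psi>_def unit_part_OrbNC Ad_in_OrbC SL2C_inv)
    show "\<psi>' (\<psi> y) = y" using k by (simp add: \<psi>_def \<psi>'_def Ad_inv)
  next
    fix p assume p: "p \<in> U \<times> OrbNC"
    then have k: "K (fst p) \<in> SU2" "K (fst p) \<in> SL2C" "Ad (K (fst p)) x0 = fst p" using K K' by auto
    have n: "snd p \<in> OrbC" "unit_part (snd p) = x0" using p by (auto simp: unit_part_OrbNC)
    have u: "unit_part (\<psi>' p) = fst p" using k n by (simp add: \<psi>'_def parts_Ad)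
    show "\<psi>' p \<in> {y \<in> OrbC. unit_part y \<in> U}"
      using u p n k by (auto simp: \<psi>'_def Ad_in_OrbC)
    show "\<psi> (\<psi>' p) = p"
      using k by (simp add: \<psi>_def u) (simp add: \<psi>'_def Ad_inv)
  next
    show "smooth_on {y \<in> OrbC. unit_part y \<in> U} \<psi>"
      unfolding \<psi>_def[abs_def]
    proof (intro smooth_on_Pair smooth_on_Ad_SU2(2) smooth_on_id)
      show 1: "smooth_on {y \<in> OrbC. unit_part y \<in> U} unit_part"
        by (rule smooth_on_subset[OF smooth_on_unit_part]) auto
      show "smooth_on {y \<in> OrbC. unit_part y \<in> U} (\<lambda>y. K (unit_part y))"
        by (rule smooth_on_compose[OF smooth_K 1]) auto
    qed (use K in auto)
    show "smooth_on (U \<times> OrbNC) \<psi>'"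
      unfolding \<psi>'_def[abs_def]
      using K by (intro smooth_on_Ad_SU2 smooth_on_compose[OF smooth_K]) auto
  qed
  ultimately show "\<exists>U \<psi>. openin (top_of_set Orb) U \<and> b \<in> U \<and>
      diffeo (emb {y \<in> OrbC. unit_part y \<in> U}) (emb (U \<times> OrbNC)) \<psi> \<and>
      (\<forall>y\<in>OrbC. unit_part y \<in> U \<longrightarrow> fst (\<psi> y) = unit_part y)"
    by (intro exI[of _ U] exI[of _ \<psi>]) (simp add: \<psi>_def)
qed

text \<open>The factor e fixes \<open>x0\<close>, f moves it within the fibre over
  \<open>x0\<close>, and equivariance takes k outside.\<close>

lemma Mostow_unit_part:
  assumes "k \<in> SU2" "f \<in> exp_im" "e \<in> exp_it"
  shows "Ad (k ** f ** e) x0 \<in> OrbC" "unit_part (Ad (k ** f ** e) x0) = Ad k x0"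
proof -
  have f: "f \<in> SL2C" using assms(2) mexp_mm_SU11 SU11_SL2C by (auto simp: exp_im_def mm_eq)
  have eq: "Ad (k ** f ** e) x0 = Ad k (Ad f x0)"
    using assms f by (simp add: Ad_mult SL2C_mult SU2_SL2C exp_it_stabilizer)
  have "Ad f x0 \<in> OrbNC" using assms(2) exp_im_orbit by blast
  then show "Ad (k ** f ** e) x0 \<in> OrbC" "unit_part (Ad (k ** f ** e) x0) = Ad k x0"
    using assms by (simp_all add: eq parts_Ad unit_part_OrbNC Ad_in_OrbC SU2_SL2C)
qed

lemma OrbC_Mostow: "OrbC = {Ad (k ** f ** e) x0 | k f e. k \<in> SU2 \<and> f \<in> exp_im \<and> e \<in> exp_it}"
proof (intro equalityI subsetI)
  fix y assume "y \<in> OrbC"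
  then obtain k C u where k: "k \<in> SU2" and y: "y = Ad k (hyperboloid_point C u)"
    and C: "C \<ge> 1" "C\<^sup>2 = 1 + (cmod u)\<^sup>2" using OrbC_cases by metis
  have "hyperboloid_point C u \<in> OrbNC" using C by (auto simp: OrbNC_eq)
  then obtain f where f: "f \<in> exp_im" "hyperboloid_point C u = Ad f x0" using exp_im_orbit by blast
  have f': "f \<in> SL2C" using f(1) mexp_mm_SU11 SU11_SL2C by (auto simp: exp_im_def mm_eq)
  \<comment> \<open>As e fixes \<open>x0\<close>, the parameter 0 can serve as its witness.\<close>
  have e: "mexp (\<i> *\<^sub>M mat2 (\<i> * of_real 0) 0 0 (- \<i> * of_real 0)) \<in> exp_it" (is "?e \<in> _")
    unfolding exp_it_def tt_def by blast
  have "y = Ad (k ** f ** ?e) x0"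
    using k f f' exp_it_stabilizer[OF e] unfolding y by (simp add: Ad_mult SL2C_mult SU2_SL2C)
  then show "y \<in> {Ad (k ** f ** e) x0 | k f e. k \<in> SU2 \<and> f \<in> exp_im \<and> e \<in> exp_it}"
    using k f e by blast
qed (auto simp: Mostow_unit_part)

section \<open>The disc model of the fibre\<close>

lemma disk_diffeo:
  "\<exists>\<eta>. diffeo (emb OrbNC) (emb (ball (0::complex) 1)) \<eta> \<and>
     (\<forall>a b. (cmod a)\<^sup>2 - (cmod b)\<^sup>2 = 1 \<longrightarrow> \<eta> (Ad (mat2 a b (cnj b) (cnj a)) x0) = b / cnj a)"
proof -
  \<comment> \<open>On the hyperboloid this is the stereographic projection u / (C + 1); with u = 2
    a b and C + 1 = 2 |a|^2 it equals b / cnj a.\<close>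
  define \<eta> where "\<eta> y = \<i> * y $ 1 $ 2 / of_real (Im (y $ 1 $ 1) + 1)" for y :: cmat
  \<comment> \<open>For z = b / cnj a one has 1 - |z|^2 = 1 / |a|^2, whence C = 2 |a|^2 - 1 = (2 -
    \<rho>) / \<rho> and u = 2 |a|^2 z = 2 z / \<rho>. The real coordinates make \<rho> visibly
    polynomial.\<close>
  define \<rho> where "\<rho> z = 1 - ((Re z)\<^sup>2 + (Im z)\<^sup>2)" for z
  define \<theta> where "\<theta> z = mat2 (\<i> * of_real ((2 - \<rho> z) / \<rho> z)) (- \<i> * (2 * z / of_real (\<rho> z)))
    (\<i> * cnj (2 * z / of_real (\<rho> z))) (- \<i> * of_real ((2 - \<rho> z) / \<rho> z))" for z
  have \<theta>: "\<theta> z = hyperboloid_point ((2 - \<rho> z) / \<rho> z) (2 * z / of_real (\<rho> z))" for z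
    by (simp add: \<theta>_def hyperboloid_point_def)
  have \<rho>: "\<rho> z = 1 - (cmod z)\<^sup>2" for z by (simp add: \<rho>_def cmod_power2)
  have \<rho>_pos: "\<rho> z > 0" if "z \<in> ball 0 1" for z
    using that by (simp add: \<rho> power_less_one_iff abs_square_less_1)
  have \<eta>: "\<eta> (hyperboloid_point C u) = u / of_real (C + 1)" for C u
    by (simp add: \<eta>_def hyperboloid_point_def)
  have "diffeo (emb OrbNC) (emb (ball (0::complex) 1)) \<eta>"
  proof (rule diffeo_embI[where g = \<theta>])
    fix y assume "y \<in> OrbNC"
    then obtain C u where y: "y = hyperboloid_point C u" and C: "C \<ge> 1" "C\<^sup>2 = 1 + (cmod u)\<^sup>2"
      by (auto simp: OrbNC_eq)
    have "(cmod u)\<^sup>2 = (C - 1) * (C + 1)" using C(2) by (simp add: power2_eq_square algebra_simps)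
    moreover have "(cmod (\<eta> y))\<^sup>2 = (cmod u)\<^sup>2 / (C + 1)\<^sup>2"
      using C by (simp add: y \<eta> norm_divide power_divide del: of_real_add)
    ultimately have n: "(cmod (\<eta> y))\<^sup>2 = (C - 1) / (C + 1)" using C by (simp add: power2_eq_square)
    also have "\<dots> < 1" using C by simp
    finally show "\<eta> y \<in> ball 0 1" by (simp add: abs_square_less_1 power_less_one_iff)
    have r: "\<rho> (\<eta> y) = 2 / (C + 1)" unfolding \<rho> n using C by (simp add: field_simps)
    have 1: "(2 - \<rho> (\<eta> y)) / \<rho> (\<eta> y) = C" unfolding r using C by (simp add: field_simps)
    have "complex_of_real (C + 1) \<noteq> 0" using C unfolding of_real_eq_0_iff by simp
    moreover have "\<eta> y = u / of_real (C + 1)" unfolding y \<eta> ..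
    ultimately have 2: "2 * \<eta> y / of_real (\<rho> (\<eta> y)) = u" unfolding r by (simp del: of_real_add)
    show "\<theta> (\<eta> y) = y" unfolding \<theta> 1 2 by (rule y[symmetric])
  next
    fix z :: complex assume z: "z \<in> ball 0 1"
    have p: "\<rho> z > 0" "\<rho> z \<le> 1" using \<rho>_pos[OF z] by (simp_all add: \<rho>)
    have "cmod (2 * z / of_real (\<rho> z)) = 2 * cmod z / \<rho> z"
      using p by (simp add: norm_divide norm_mult)
    then have "(cmod (2 * z / of_real (\<rho> z)))\<^sup>2 = 4 * (1 - \<rho> z) / (\<rho> z)\<^sup>2"
      by (simp add: power_divide power_mult_distrib \<rho>)
    then have "((2 - \<rho> z) / \<rho> z)\<^sup>2 = 1 + (cmod (2 * z / of_real (\<rho> z)))\<^sup>2"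
      using p by (simp add: field_simps power2_eq_square)
    moreover have "(2 - \<rho> z) / \<rho> z \<ge> 1" using p by (simp add: field_simps)
    ultimately show "\<theta> z \<in> OrbNC" unfolding \<theta> OrbNC_eq by blast
    have "(2 - \<rho> z) / \<rho> z + 1 = 2 / \<rho> z" using p by (simp add: field_simps)
    then show "\<eta> (\<theta> z) = z" unfolding \<theta> \<eta> using p by simp
  next
    have "complex_of_real (Im (y $ 1 $ 1) + 1) \<noteq> 0" if "y \<in> OrbNC" for y
      using that unfolding of_real_eq_0_iff by (auto simp: OrbNC_eq hyperboloid_point_def)
    then show "smooth_on OrbNC \<eta>" unfolding \<eta>_def[abs_def]
      by (intro smooth_on_divide smooth_on_mult smooth_on_const smooth_on_vec_nth smooth_on_id
        smooth_on_of_real smooth_on_add smooth_on_Im)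
    have "smooth_on (ball 0 1) \<rho>" unfolding \<rho>_def[abs_def] by auto
    moreover have "\<rho> z \<noteq> 0" "complex_of_real (\<rho> z) \<noteq> 0" if "z \<in> ball 0 1" for z
      using \<rho>_pos[OF that] by auto
    ultimately show "smooth_on (ball 0 1) \<theta>" unfolding \<theta>_def[abs_def]
      by (intro smooth_on_mat2 smooth_on_divide smooth_on_mult smooth_on_const smooth_on_id
        smooth_on_of_real smooth_on_diff smooth_on_cnj)
  qed
  moreover have "\<eta> (Ad (mat2 a b (cnj b) (cnj a)) x0) = b / cnj a" if "(cmod a)\<^sup>2 - (cmod b)\<^sup>2 = 1" for a b
  proof -
    have "(cmod a)\<^sup>2 + (cmod b)\<^sup>2 + 1 = 2 * (cmod a)\<^sup>2" using that by simp
    then have e: "complex_of_real ((cmod a)\<^sup>2 + (cmod b)\<^sup>2 + 1) = 2 * (a * cnj a)"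
      by (simp only: of_real_mult complex_norm_square) simp
    have "a \<noteq> 0" using that zero_le_power2[of "cmod b"] by fastforce
    then show ?thesis unfolding Ad_SU11_x0(1)[OF that] \<eta> e by simp
  qed
  ultimately show ?thesis by blast
qed

subsection \<open>Tangent spaces\<close>

lemma bounded_bilinear_cmat: "bounded_bilinear ((**) :: cmat \<Rightarrow> cmat \<Rightarrow> cmat)"
  unfolding bilinear_conv_bounded_bilinear[symmetric] bilinear_def
  by (auto intro!: linearI simp: matrix_add_ldistrib matrix_scalar_ac scalar_matrix_assoc
      cmat_eq_iff matrix_matrix_mult_def sum_2 algebra_simps)

lemma bounded_linear_ctransp: "bounded_linear ctransp"
  unfolding linear_conv_bounded_linear[symmetric]
  by (auto intro!: linearI simp: ctransp_linear)

lemma bounded_bilinear_cscale: "bounded_bilinear (*\<^sub>M)"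
  unfolding bilinear_conv_bounded_bilinear[symmetric] bilinear_def
  by (auto intro!: linearI simp: cmat_eq_iff cmat_entries algebra_simps)
    (simp_all add: scaleR_conv_of_real)

text \<open>Differentiate the constant function \<gamma>(t)^2 = -1 at 0.\<close>

lemma tangent_OrbC_anticommutes:
  assumes "y \<in> OrbC" "w \<in> tangent_space OrbC y"
  shows "w ** y + y ** w = 0"
proof -
  obtain \<gamma> where \<gamma>: "\<gamma> 0 = y" "\<And>t::real. \<gamma> t \<in> OrbC" "(\<gamma> has_vector_derivative w) (at 0)"
    using assms(2) unfolding tangent_space_def by blast
  have "((\<lambda>t. \<gamma> t ** \<gamma> t) has_vector_derivative (\<gamma> 0 ** w + w ** \<gamma> 0)) (at 0)"
    by (rule bounded_bilinear.has_vector_derivative[OF bounded_bilinear_cmat \<gamma>(3) \<gamma>(3)])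
  moreover have "((\<lambda>t. \<gamma> t ** \<gamma> t) has_vector_derivative 0) (at 0)"
    unfolding OrbC_square[OF \<gamma>(2)] by (rule has_vector_derivative_const)
  ultimately have "\<gamma> 0 ** w + w ** \<gamma> 0 = 0" by (rule vector_derivative_unique_at)
  then show ?thesis unfolding \<gamma>(1) by (simp only: add.commute)
qed

lemma tangent_Orb_subset: "tangent_space Orb z \<subseteq> tangent_space OrbC z"
  unfolding tangent_space_def using Orb_subset_OrbC by blast

lemma tangent_Orb_skew:
  assumes "w \<in> tangent_space Orb z"
  shows "ctransp w = - w"
proof -
  obtain \<gamma> where \<gamma>: "\<And>t::real. \<gamma> t \<in> Orb" "(\<gamma> has_vector_derivative w) (at 0)"
    using assms unfolding tangent_space_def by blast
  have "((\<lambda>t. ctransp (\<gamma> t)) has_vector_derivative ctransp w) (at 0)"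
    by (rule bounded_linear.has_vector_derivative[OF bounded_linear_ctransp \<gamma>(2)])
  then have "((\<lambda>t. - \<gamma> t) has_vector_derivative ctransp w) (at 0)"
    unfolding Orb_ctransp[OF \<gamma>(1)] .
  moreover have "((\<lambda>t. - \<gamma> t) has_vector_derivative - w) (at 0)"
    by (rule has_vector_derivative_minus[OF \<gamma>(2)])
  ultimately show ?thesis by (rule vector_derivative_unique_at)
qed

text \<open>From w = - y w y^-1 the trace of w vanishes. A trace-free matrix has square minus its
  determinant, and in the square of y + t w the linear term y w + w y drops out. The proof carries
  this out in entries.\<close>

lemma det_anticommuting:
  assumes "y \<in> OrbC" "w ** y + y ** w = 0"
  shows "w $ 2 $ 2 = - w $ 1 $ 1" "det (y + t *\<^sub>R w) = 1 + of_real (t\<^sup>2) * det w"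
proof -
  obtain p q r s where y: "y = mat2 p q r s" by (rule cmat_cases)
  obtain a b c d where w: "w = mat2 a b c d" by (rule cmat_cases)
  have s: "s = - p" and pq: "p * p + q * r = - 1" using assms(1) by (auto simp: y OrbC_iff)
  have *: "2 * a * p + b * r + q * c = 0" "q * (a + d) = 0" "r * (a + d) = 0" "c * q + b * r - 2 * d * p = 0"
    using assms(2) by (simp_all add: y w s zero_mat2 algebra_simps)
  have "2 * (p * (a + d)) = (2 * a * p + b * r + q * c) - (c * q + b * r - 2 * d * p)"
    by (simp add: algebra_simps)
  then have p: "p * (a + d) = 0" unfolding *(1,4) by simp
  have "a + d = 0"
  proof (rule ccontr)
    assume "a + d \<noteq> 0"
    then have "p = 0" "q = 0" using p *(2) by simp_all
    then show False using pq by simp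
  qed
  then have d: "d = - a" by (simp add: eq_neg_iff_add_eq_0 add.commute)
  then show "w $ 2 $ 2 = - w $ 1 $ 1" by (simp add: w)
  have "det (y + t *\<^sub>R w) = - (p * p + q * r) - of_real t * (2 * a * p + b * r + q * c) + of_real t * of_real t * (- a * a - b * c)"
    by (simp add: y w s d algebra_simps)
  then show "det (y + t *\<^sub>R w) = 1 + of_real (t\<^sup>2) * det w"
    unfolding pq *(1) by (simp add: w d power2_eq_square)
qed

text \<open>The velocity \<open>w\<close> at \<open>y\<close> is that of the normalised line \<open>y + t w\<close>, which has
  determinant \<open>1 + t\<^sup>2 det w\<close>; the curve is constant where this vanishes.\<close>

definition orbit_curve :: "cmat \<Rightarrow> cmat \<Rightarrow> real \<Rightarrow> cmat" where
  "orbit_curve y w t = (if 1 + of_real (t\<^sup>2) * det w = 0 then y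
     else (1 / csqrt (1 + of_real (t\<^sup>2) * det w)) *\<^sub>M (y + t *\<^sub>R w))"

lemma orbit_curve_0: "orbit_curve y w 0 = y"
  by (simp add: orbit_curve_def cmat_eq_iff cmat_entries)

text \<open>Dividing the trace-free matrix y + t w by a square root of its determinant puts it on
  the quadric. All real t must be covered, since \<open>tangent_space\<close> asks for curves that
  stay in the set at all times.\<close>

lemma orbit_curve_in_OrbC:
  assumes "y \<in> OrbC" "w ** y + y ** w = 0"
  shows "orbit_curve y w t \<in> OrbC"
proof (cases "1 + of_real (t\<^sup>2) * det w = 0")
  case False
  let ?m = "csqrt (1 + of_real (t\<^sup>2) * det w)"
  obtain a b c d where v: "y + t *\<^sub>R w = mat2 a b c d" by (rule cmat_cases)
  have m: "?m * ?m = 1 + of_real (t\<^sup>2) * det w" "?m \<noteq> 0"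
    using False by (simp_all flip: power2_eq_square)
  have "y $ 2 $ 2 = - y $ 1 $ 1" using assms(1) by (cases y rule: cmat_cases) (simp add: OrbC_iff)
  moreover have "a = (y + t *\<^sub>R w) $ 1 $ 1" "d = (y + t *\<^sub>R w) $ 2 $ 2" unfolding v by simp_all
  ultimately have d: "d = - a" by (simp add: det_anticommuting(1)[OF assms])
  have "- (a * a + b * c) = ?m * ?m"
    using det_anticommuting(2)[OF assms, of t] unfolding m(1) v by (simp add: d)
  then have "a * a + b * c = - (?m * ?m)" by (metis minus_minus)
  then show ?thesis using False m(2) by (simp add: orbit_curve_def v d OrbC_iff flip: add_divide_distrib)
qed (use assms in \<open>simp add: orbit_curve_def\<close>)

text \<open>The normalising factor depends on t^2 only, so it is stationary at 0; near 0 its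
  argument is close to 1, away from the branch cut of \<open>csqrt\<close> and from the exceptional
  case.\<close>

lemma orbit_curve_derivative: "(orbit_curve y w has_vector_derivative w) (at 0)"
proof -
  let ?D = "\<lambda>t. 1 + complex_of_real (t\<^sup>2) * det w"
  have 1: "(?D has_vector_derivative 0) (at 0)"
    by (auto intro!: derivative_eq_intros simp: power2_eq_square)
  have "((\<lambda>z. 1 / csqrt z) has_field_derivative (- 1 / 2)) (at (?D 0))"
    by (auto intro!: derivative_eq_intros simp: complex_nonpos_Reals_iff)
  from field_vector_diff_chain_at[OF 1 this]
  have "((\<lambda>t. 1 / csqrt (?D t)) has_vector_derivative 0) (at 0)" by (simp add: o_def)
  moreover have "((\<lambda>t. y + t *\<^sub>R w) has_vector_derivative w) (at 0)"
    by (auto intro!: derivative_eq_intros)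
  ultimately have "((\<lambda>t. (1 / csqrt (?D t)) *\<^sub>M (y + t *\<^sub>R w)) has_vector_derivative
      (1 / csqrt (?D 0)) *\<^sub>M w + 0 *\<^sub>M (y + 0 *\<^sub>R w)) (at 0)"
    by (rule bounded_bilinear.has_vector_derivative[OF bounded_bilinear_cscale])
  moreover have "(1 / csqrt (?D 0)) *\<^sub>M w + 0 *\<^sub>M (y + 0 *\<^sub>R w) = w"
    by (simp add: cmat_eq_iff cmat_entries)
  ultimately have 2: "((\<lambda>t. (1 / csqrt (?D t)) *\<^sub>M (y + t *\<^sub>R w)) has_vector_derivative w) (at 0)"
    by simp
  have "open {t. ?D t \<noteq> 0}" by (intro open_Collect_neq continuous_intros)
  from has_vector_derivative_transform_within_open[OF 2 this]
  show ?thesis by (simp add: orbit_curve_def)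
qed

lemma tangent_OrbC:
  assumes "y \<in> OrbC"
  shows "tangent_space OrbC y = {w. w ** y + y ** w = 0}"
proof (intro equalityI subsetI)
  fix w assume "w \<in> {w. w ** y + y ** w = 0}"
  then show "w \<in> tangent_space OrbC y"
    unfolding tangent_space_def
    using orbit_curve_0 orbit_curve_in_OrbC[OF assms] orbit_curve_derivative by blast
qed (use tangent_OrbC_anticommutes[OF assms] in auto)

lemma tangent_Orb:
  assumes "z \<in> Orb"
  shows "tangent_space Orb z = {w. ctransp w = - w \<and> w ** z + z ** w = 0}"
proof (intro equalityI subsetI)
  fix w assume "w \<in> tangent_space Orb z"
  then show "w \<in> {w. ctransp w = - w \<and> w ** z + z ** w = 0}"
    using assms tangent_Orb_skew tangent_Orb_subset tangent_OrbC Orb_subset_OrbC by blast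
next
  fix w assume "w \<in> {w. ctransp w = - w \<and> w ** z + z ** w = 0}"
  then have w: "ctransp w = - w" "w ** z + z ** w = 0" by auto
  have z: "z \<in> OrbC" using assms Orb_subset_OrbC by auto
  obtain a b c d where abcd: "w = mat2 a b c d" by (rule cmat_cases)
  have "d = - a" using det_anticommuting(1)[OF z w(2)] by (simp add: abcd)
  moreover have "cnj a = - a" "c = - cnj b" using w(1) by (simp_all add: abcd)
  \<comment> \<open>For skew-Hermitian w the determinant is a sum of squares, so the normaliser is
    real and the curve stays skew-Hermitian.\<close>
  ultimately have "det w = a * cnj a + b * cnj b" by (simp add: abcd)
  then have D: "det w = of_real ((cmod a)\<^sup>2 + (cmod b)\<^sup>2)" unfolding of_real_add complex_norm_square .
  have "orbit_curve z w t \<in> Orb" for t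
  proof (rule OrbI)
    show "orbit_curve z w t \<in> OrbC" using orbit_curve_in_OrbC z w by blast
    have "csqrt (1 + of_real (t\<^sup>2) * det w) = csqrt (of_real (1 + t\<^sup>2 * ((cmod a)\<^sup>2 + (cmod b)\<^sup>2)))"
      by (simp add: D)
    also have "\<dots> = of_real (sqrt (1 + t\<^sup>2 * ((cmod a)\<^sup>2 + (cmod b)\<^sup>2)))"
      by (rule of_real_sqrt[symmetric]) simp
    finally have "cnj (csqrt (1 + of_real (t\<^sup>2) * det w)) = csqrt (1 + of_real (t\<^sup>2) * det w)"
      by simp
    then show "ctransp (orbit_curve z w t) = - orbit_curve z w t"
    proof -
      have "ctransp (z + t *\<^sub>R w) = - (z + t *\<^sub>R w)"
        by (simp add: ctransp_linear Orb_ctransp[OF assms] w(1))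
      moreover have "k *\<^sub>M (- A) = - (k *\<^sub>M A)" for k A
        by (simp add: cmat_eq_iff cmat_entries)
      ultimately show ?thesis
        using \<open>cnj (csqrt _) = _\<close> Orb_ctransp[OF assms] by (simp add: orbit_curve_def ctransp_linear(5) del: minus_add_distrib)
    qed
  qed
  then show "w \<in> tangent_space Orb z"
    unfolding tangent_space_def using orbit_curve_0 orbit_curve_derivative by blast
qed

text \<open>Anticommutation gives [v, z] = 2 v z, and z^2 = -1 makes right multiplication by - z / 2
  the inverse. This identifies the fibres of \<open>T_Orb\<close> with the geometric tangent
  spaces.\<close>

lemma lie_bracket_bij:
  assumes "z \<in> Orb"
  shows "bij_betw (\<lambda>v. lie_bracket v z) {v. (z, v) \<in> T_Orb} (tangent_space Orb z)"
proof -
  have zz: "A ** z ** z = - A" "z ** (z ** A) = - A" for A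
    using Orb_square[OF assms] by (simp_all add: matrix_mul_assoc) (simp flip: matrix_mul_assoc)
  have br: "lie_bracket v z = 2 *\<^sub>R (v ** z)" if "v ** z = - (z ** v)" for v
    using that by (simp add: lie_bracket_def scaleR_2)
  have anti: "ctransp (v ** z) = - (v ** z) \<and> (v ** z) ** z = - (z ** (v ** z))"
    if "ctransp v = - v" "v ** z = - (z ** v)" for v
  proof
    have "ctransp (v ** z) = z ** v" by (simp add: ctransp_mult that(1) Orb_ctransp[OF assms])
    then show "ctransp (v ** z) = - (v ** z)" by (simp add: that(2))
    have "z ** (v ** z) = v" unfolding that(2) by (simp add: zz(2))
    then show "(v ** z) ** z = - (z ** (v ** z))" by (simp add: zz(1))
  qed
  have scale: "ctransp (t *\<^sub>R v) = - (t *\<^sub>R v) \<and> (t *\<^sub>R v) ** z = - (z ** (t *\<^sub>R v))"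
    if "ctransp v = - v \<and> v ** z = - (z ** v)" for v t
    using that by (simp add: ctransp_linear matrix_scalar_ac flip: scalar_matrix_assoc)
  have T: "tangent_space Orb z = {w. ctransp w = - w \<and> w ** z = - (z ** w)}"
    using assms by (simp add: tangent_Orb eq_neg_iff_add_eq_0)
  show ?thesis
    unfolding T T_Orb_iff
  proof (rule bij_betw_byWitness[where f' = "\<lambda>w. (- 1 / 2) *\<^sub>R (w ** z)"])
    show "\<forall>a\<in>{v. z \<in> Orb \<and> ctransp v = - v \<and> v ** z = - (z ** v)}. (- 1 / 2) *\<^sub>R (lie_bracket a z ** z) = a"
    proof
      fix v assume "v \<in> {v. z \<in> Orb \<and> ctransp v = - v \<and> v ** z = - (z ** v)}"
      then have "lie_bracket v z ** z = 2 *\<^sub>R ((v ** z) ** z)"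
        using br[of v] by (simp only: scalar_matrix_assoc mem_Collect_eq)
      then show "(- 1 / 2) *\<^sub>R (lie_bracket v z ** z) = v" by (simp add: zz(1))
    qed
    show "\<forall>a'\<in>{w. ctransp w = - w \<and> w ** z = - (z ** w)}. lie_bracket ((- 1 / 2) *\<^sub>R (a' ** z)) z = a'"
    proof
      fix w assume "w \<in> {w. ctransp w = - w \<and> w ** z = - (z ** w)}"
      then have "((- 1 / 2) *\<^sub>R (w ** z)) ** z = - (z ** ((- 1 / 2) *\<^sub>R (w ** z)))"
        using anti scale by blast
      from br[OF this] show "lie_bracket ((- 1 / 2) *\<^sub>R (w ** z)) z = w"
        by (simp add: zz flip: scalar_matrix_assoc)
    qed
    show "(\<lambda>v. lie_bracket v z) ` {v. z \<in> Orb \<and> ctransp v = - v \<and> v ** z = - (z ** v)}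
      \<subseteq> {w. ctransp w = - w \<and> w ** z = - (z ** w)}"
    proof (rule image_subsetI)
      fix v assume "v \<in> {v. z \<in> Orb \<and> ctransp v = - v \<and> v ** z = - (z ** v)}"
      then have v: "ctransp v = - v" "v ** z = - (z ** v)" by blast+
      show "lie_bracket v z \<in> {w. ctransp w = - w \<and> w ** z = - (z ** w)}"
        unfolding br[OF v(2)] mem_Collect_eq by (rule scale[OF anti[OF v]])
    qed
    show "(\<lambda>w. (- 1 / 2) *\<^sub>R (w ** z)) ` {w. ctransp w = - w \<and> w ** z = - (z ** w)}
      \<subseteq> {v. z \<in> Orb \<and> ctransp v = - v \<and> v ** z = - (z ** v)}"
      using anti scale assms by blast
  qed
qed

text \<open>The equation w z + z w = 0 is complex linear, and for skew-Hermitian z its solutions are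
  stable under the conjugate transpose. They therefore split into skew-Hermitian and Hermitian ones,
  and the Hermitian ones are \<i> times skew-Hermitian ones.\<close>

lemma OrbC_complexification: "complexification_of OrbC Orb"
  unfolding complexification_of_def
proof (intro conjI ballI)
  show "Orb \<subseteq> OrbC" by (rule Orb_subset_OrbC)
next
  fix y v assume "y \<in> OrbC" "v \<in> tangent_space OrbC y"
  then have v: "v ** y + y ** v = 0" by (simp add: tangent_OrbC)
  have "(\<i> *\<^sub>M v) ** y + y ** (\<i> *\<^sub>M v) = \<i> *\<^sub>M (v ** y + y ** v)"
    by (simp add: cmat_eq_iff cmat_entries algebra_simps)
  also have "\<dots> = 0" unfolding v by (simp add: cmat_eq_iff cmat_entries)
  finally show "\<i> *\<^sub>M v \<in> tangent_space OrbC y" using \<open>y \<in> OrbC\<close> by (simp add: tangent_OrbC)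
next
  fix z assume z: "z \<in> Orb"
  then have z': "z \<in> OrbC" using Orb_subset_OrbC by auto
  note T = tangent_Orb[OF z] tangent_OrbC[OF z']
  show "tangent_space Orb z \<inter> (*\<^sub>M) \<i> ` tangent_space Orb z = {0}"
  proof (intro equalityI subsetI)
    fix w assume "w \<in> tangent_space Orb z \<inter> (*\<^sub>M) \<i> ` tangent_space Orb z"
    then obtain v where "ctransp w = - w" "w = \<i> *\<^sub>M v" "ctransp v = - v" by (auto simp: T)
    then have "- (\<i> *\<^sub>M v) = \<i> *\<^sub>M v" 
      by (simp add: ctransp_linear) (simp add: cmat_eq_iff cmat_entries)
    then show "w \<in> {0}" using \<open>w = _\<close> by (simp add: cmat_eq_iff eq_neg_iff_add_eq_0 flip: mult_2)
  next
    fix w :: cmat assume "w \<in> {0}"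
    moreover have "0 \<in> tangent_space Orb z" "\<i> *\<^sub>M 0 = 0"
      by (simp_all add: T cmat_eq_iff cmat_entries)
    ultimately show "w \<in> tangent_space Orb z \<inter> (*\<^sub>M) \<i> ` tangent_space Orb z" by force
  qed
  show "tangent_space OrbC z = {u + \<i> *\<^sub>M v | u v. u \<in> tangent_space Orb z \<and> v \<in> tangent_space Orb z}"
  proof (intro equalityI subsetI)
    fix w assume "w \<in> tangent_space OrbC z"
    then have w: "w ** z + z ** w = 0" by (simp add: T)
    have "ctransp (w ** z + z ** w) = - (z ** ctransp w + ctransp w ** z)"
      using Orb_ctransp[OF z] by (simp add: ctransp_mult ctransp_linear)
    moreover have "ctransp 0 = 0" by (simp add: cmat_eq_iff cmat_entries)
    ultimately have w': "ctransp w ** z + z ** ctransp w = 0"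
      unfolding w by (simp only: neg_0_equal_iff_equal add.commute)
    let ?u = "skew_part w" and ?v = "(- \<i>) *\<^sub>M herm_part w"
    have "?u ** z + z ** ?u = (1 / 2) *\<^sub>R ((w ** z + z ** w) - (ctransp w ** z + z ** ctransp w))"
      unfolding skew_part_def
      by (simp add: cmat_eq_iff cmat_entries algebra_simps) (simp add: scaleR_conv_of_real)
    then have u: "?u \<in> tangent_space Orb z" unfolding w w' by (simp add: T ctransp_parts)
    have "?v ** z + z ** ?v = (- \<i>) *\<^sub>M ((1 / 2) *\<^sub>R ((w ** z + z ** w) + (ctransp w ** z + z ** ctransp w)))"
      unfolding herm_part_def
      by (simp add: cmat_eq_iff cmat_entries algebra_simps) (simp add: scaleR_conv_of_real)
    also have "\<dots> = 0" unfolding w w' by (simp add: cmat_eq_iff cmat_entries)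
    finally have v: "?v \<in> tangent_space Orb z"
      by (simp add: T ctransp_linear ctransp_parts) (simp add: cmat_eq_iff cmat_entries)
    have "\<i> *\<^sub>M ?v = herm_part w" by (simp add: cmat_eq_iff cmat_entries)
    then have "w = ?u + \<i> *\<^sub>M ?v" by (simp add: skew_plus_herm)
    then show "w \<in> {u + \<i> *\<^sub>M v | u v. u \<in> tangent_space Orb z \<and> v \<in> tangent_space Orb z}"
      using u v by blast
  next
    fix w assume "w \<in> {u + \<i> *\<^sub>M v | u v. u \<in> tangent_space Orb z \<and> v \<in> tangent_space Orb z}"
    then obtain u v where w: "w = u + \<i> *\<^sub>M v" and u: "u ** z + z ** u = 0" and v: "v ** z + z ** v = 0"
      by (auto simp: T)
    have "w ** z + z ** w = (u ** z + z ** u) + \<i> *\<^sub>M (v ** z + z ** v)"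
      unfolding w by (simp add: cmat_eq_iff cmat_entries algebra_simps)
    also have "\<dots> = 0" unfolding u v by (simp add: cmat_eq_iff cmat_entries)
    finally show "w \<in> tangent_space OrbC z" by (simp add: T)
  qed
qed

subsection \<open>Lines and eigenlines\<close>

lemma smooth_map_cong:
  assumes eq: "\<And>p. p \<in> points A \<Longrightarrow> f p = g p" and f: "smooth_map A B f"
  shows "smooth_map A B g"
  unfolding smooth_map_def
proof
  fix p assume "p \<in> points A"
  with f obtain U \<phi> V \<psi> W where *: "(U, \<phi>) \<in> A" "(V, \<psi>) \<in> B" "p \<in> U" "open W" "\<phi> p \<in> W"
    "\<forall>q\<in>U. \<phi> q \<in> W \<longrightarrow> f q \<in> V" "smooth_on (\<phi> ` U \<inter> W) (\<lambda>t. \<psi> (f (inv_into U \<phi> t)))"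
    unfolding smooth_map_def by fast
  have fg: "f q = g q" if "q \<in> U" for q using eq *(1) that by (auto simp: points_def)
  have "\<forall>q\<in>U. \<phi> q \<in> W \<longrightarrow> g q \<in> V" using *(6) fg by simp
  moreover have "smooth_on (\<phi> ` U \<inter> W) (\<lambda>t. \<psi> (g (inv_into U \<phi> t)))"
    by (rule smooth_on_eq[OF *(7)]) (simp add: fg inv_into_into)
  ultimately show "\<exists>(U, \<phi>)\<in>A. \<exists>(V, \<psi>)\<in>B. \<exists>W. p \<in> U \<and> open W \<and> \<phi> p \<in> W \<and>
      (\<forall>q\<in>U. \<phi> q \<in> W \<longrightarrow> g q \<in> V) \<and> smooth_on (\<phi> ` U \<inter> W) (\<lambda>t. \<psi> (g (inv_into U \<phi> t)))"
    using *(1-5) by (intro bexI[of _ "(U, \<phi>)"]) (auto intro!: bexI[of _ "(V, \<psi>)"] exI[of _ W])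
qed

lemma smooth_map_into_embI:
  assumes "\<And>p. p \<in> points A \<Longrightarrow> f p \<in> T"
    and "\<And>U \<phi>. (U, \<phi>) \<in> A \<Longrightarrow> smooth_on (\<phi> ` U) (\<lambda>t. f (inv_into U \<phi> t))"
  shows "smooth_map A (emb T) f"
  unfolding smooth_map_def emb_def
proof
  fix p assume "p \<in> points A"
  then obtain U \<phi> where U: "(U, \<phi>) \<in> A" "p \<in> U" unfolding points_def by blast
  then have "\<forall>q\<in>U. f q \<in> T" using assms(1) unfolding points_def by blast
  then show "\<exists>(U, \<phi>)\<in>A. \<exists>(V, \<psi>)\<in>{(T, \<lambda>p. p)}. \<exists>W. p \<in> U \<and> open W \<and> \<phi> p \<in> W \<and>
      (\<forall>q\<in>U. \<phi> q \<in> W \<longrightarrow> f q \<in> V) \<and> smooth_on (\<phi> ` U \<inter> W) (\<lambda>t. \<psi> (f (inv_into U \<phi> t)))"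
    using U assms(2)[OF U(1)]
    by (intro bexI[of _ "(U, \<phi>)"]) (auto intro!: exI[of _ UNIV])
qed

lemma smooth_map_from_embI:
  assumes "\<And>p. p \<in> S \<Longrightarrow> \<exists>V \<psi> W. (V, \<psi>) \<in> B \<and> open W \<and> p \<in> W \<and>
    (\<forall>q \<in> S \<inter> W. f q \<in> V) \<and> smooth_on (S \<inter> W) (\<lambda>t. \<psi> (f t))"
  shows "smooth_map (emb S) B f"
  unfolding smooth_map_def points_emb
proof
  fix p assume "p \<in> S"
  then obtain V \<psi> W where *: "(V, \<psi>) \<in> B" "open W" "p \<in> W" "\<forall>q \<in> S \<inter> W. f q \<in> V"
    "smooth_on (S \<inter> W) (\<lambda>t. \<psi> (f t))"
    using assms by blast
  have "smooth_on (S \<inter> W) (\<lambda>t. \<psi> (f (inv_into S (\<lambda>p. p) t)))"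
    by (rule smooth_on_eq[OF *(5)]) (simp add: inv_into_ident)
  then show "\<exists>(U, \<phi>)\<in>emb S. \<exists>(V, \<psi>)\<in>B. \<exists>W. p \<in> U \<and> open W \<and> \<phi> p \<in> W \<and>
      (\<forall>q\<in>U. \<phi> q \<in> W \<longrightarrow> f q \<in> V) \<and> smooth_on (\<phi> ` U \<inter> W) (\<lambda>t. \<psi> (f (inv_into U \<phi> t)))"
    unfolding emb_def using *(1-4) \<open>p \<in> S\<close>
    by (intro bexI[of _ "(S, \<lambda>p. p)"]) (auto intro!: bexI[of _ "(V, \<psi>)"] exI[of _ W])
qed

definition line :: "complex \<Rightarrow> complex \<Rightarrow> (complex^2) set" where
  "line a b = {v. \<exists>k. v = k *s vector [a, b]}"

lemma vector2_scale: "k *s vector [a, b] = (vector [k * a, k * b] :: complex^2)"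
  by (simp add: vec_eq_iff forall_2)

lemma vector2_eq_iff [simp]: "(vector [a, b] :: complex^2) = vector [c, d] \<longleftrightarrow> a = c \<and> b = d"
  by (simp add: vec_eq_iff forall_2)

lemma vector2_zero: "(0 :: complex^2) = vector [0, 0]"
  by (simp add: vec_eq_iff forall_2)

lemma vector2_cases: obtains x y where "v = (vector [x, y] :: complex^2)"
  by (rule that[of "v $ 1" "v $ 2"]) (simp add: vec_eq_iff forall_2)

text \<open>Replaces the unknown scalar by the vanishing of a 2 x 2 determinant, so that questions
  about lines become polynomial identities.\<close>

lemma in_line_iff: "a \<noteq> 0 \<or> b \<noteq> 0 \<Longrightarrow> vector [x, y] \<in> line a b \<longleftrightarrow> a * y = b * x"
proof
  assume "vector [x, y] \<in> line a b"
  then show "a * y = b * x" by (auto simp: line_def vector2_scale)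
next
  assume ne: "a \<noteq> 0 \<or> b \<noteq> 0" and *: "a * y = b * x"
  show "vector [x, y] \<in> line a b"
  proof (cases "a = 0")
    case True
    then show ?thesis using ne * by (auto simp: line_def vector2_scale intro!: exI[of _ "y / b"])
  next
    case False
    then show ?thesis using * by (auto simp: line_def vector2_scale field_simps intro!: exI[of _ "x / a"])
  qed
qed

lemma line_eqI:
  assumes "a \<noteq> 0 \<or> b \<noteq> 0" "\<And>x y. vector [x, y] \<in> l \<longleftrightarrow> a * y = b * x"
  shows "l = line a b"
proof (rule set_eqI)
  fix v :: "complex^2"
  obtain x y where "v = vector [x, y]" by (rule vector2_cases)
  then show "v \<in> l \<longleftrightarrow> v \<in> line a b" using assms by (simp add: in_line_iff)
qed

lemma CP1_eq: "CP1 = {line a b | a b. a \<noteq> 0 \<or> b \<noteq> 0}"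
proof (intro equalityI subsetI)
  fix l assume "l \<in> CP1"
  then have l: "vec.subspace l" "vec.dim l = 1" by (auto simp: CP1_def)
  obtain B where B: "B \<subseteq> l" "vec.independent B" "l \<subseteq> vec.span B" "card B = vec.dim l"
    by (rule vec.basis_exists)
  then obtain v where v: "B = {v}" using l by (auto simp: card_1_singleton_iff)
  have "l = vec.span {v}" using B l v by (metis subset_antisym vec.span_minimal)
  moreover obtain a b where ab: "v = vector [a, b]" by (rule vector2_cases)
  moreover have "v \<noteq> 0" using B(2) v vec.dependent_zero by blast
  ultimately have "l = line a b" "a \<noteq> 0 \<or> b \<noteq> 0"
    unfolding line_def vec.span_singleton by (auto simp: vector2_zero)
  then show "l \<in> {line a b | a b. a \<noteq> 0 \<or> b \<noteq> 0}" by blast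
next
  fix l assume "l \<in> {line a b | a b. a \<noteq> 0 \<or> b \<noteq> 0}"
  then obtain a b where l: "l = line a b" "a \<noteq> 0 \<or> b \<noteq> 0" by blast
  have s: "l = vec.span {vector [a, b]}"
    unfolding l line_def vec.span_singleton by auto
  have "vec.independent {vector [a, b] :: complex^2}"
    using l(2) by (simp add: vector2_zero)
  then have "vec.dim l = 1" unfolding s vec.dim_span by (simp add: vec.dim_eq_card_independent)
  then show "l \<in> CP1" by (simp add: CP1_def s vec.subspace_span)
qed

lemma line_eq_iff:
  assumes "a \<noteq> 0 \<or> b \<noteq> 0" "c \<noteq> 0 \<or> d \<noteq> 0"
  shows "line a b = line c d \<longleftrightarrow> a * d = b * c"
proof
  assume "line a b = line c d"
  moreover have "vector [c, d] \<in> line c d" using assms by (simp add: in_line_iff)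
  ultimately show "a * d = b * c" using assms by (metis in_line_iff)
next
  assume *: "a * d = b * c"
  have "a * y = b * x \<longleftrightarrow> c * y = d * x" for x y
  proof (cases "a = 0")
    case True
    then show ?thesis using assms * by auto
  next
    case False
    then have "c \<noteq> 0" using assms * by auto
    have "a * (c * y - d * x) = c * (a * y - b * x)" using * by algebra
    then show ?thesis using \<open>a \<noteq> 0\<close> \<open>c \<noteq> 0\<close> by (metis eq_iff_diff_eq_0 mult_eq_0_iff)
  qed
  then show "line a b = line c d" using assms by (intro line_eqI) (simp_all add: in_line_iff)
qed

lemma complementary_lines_iff:
  assumes "a \<noteq> 0 \<or> b \<noteq> 0" "c \<noteq> 0 \<or> d \<noteq> 0"
  shows "(line a b, line c d) \<in> complementary_lines \<longleftrightarrow> a * d - b * c \<noteq> 0"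
proof
  assume *: "(line a b, line c d) \<in> complementary_lines"
  show "a * d - b * c \<noteq> 0"
  proof
    assume "a * d - b * c = 0"
    then have "line a b = line c d" using assms by (simp add: line_eq_iff)
    moreover have "vector [a, b] \<in> line a b" using assms by (simp add: in_line_iff)
    ultimately have "vector [a, b] = (0 :: complex^2)" using * by (auto simp: complementary_lines_def)
    then show False using assms by (simp add: vector2_zero)
  qed
next
  assume D: "a * d - b * c \<noteq> 0"
  have "v = 0" if "v \<in> line a b" "v \<in> line c d" for v
  proof -
    obtain x y where v: "v = vector [x, y]" by (rule vector2_cases)
    then have "a * y = b * x" "c * y = d * x" using that assms by (simp_all add: in_line_iff)
    then have "(a * d - b * c) * x = 0" "(a * d - b * c) * y = 0" by algebra+
    then show ?thesis using D by (simp add: v vector2_zero)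
  qed
  moreover have "0 \<in> line a b \<inter> line c d" using assms by (simp add: vector2_zero in_line_iff)
  moreover have "v \<in> {u + v |u v. u \<in> line a b \<and> v \<in> line c d}" for v
  proof -
    obtain x y where v: "v = vector [x, y]" by (rule vector2_cases)
    \<comment> \<open>The coefficients of v in the basis (a, b), (c, d), by Cramer's rule.\<close>
    define k where "k = (d * x - c * y) / (a * d - b * c)"
    define m where "m = (a * y - b * x) / (a * d - b * c)"
    have "k * a + m * c = x" "k * b + m * d = y"
      using D by (simp_all add: k_def m_def add_divide_distrib[symmetric] divide_eq_eq) (simp_all add: algebra_simps)
    then have "v = k *s vector [a, b] + m *s vector [c, d]"
      by (simp add: v vec_eq_iff forall_2)
    then show ?thesis unfolding line_def by blast
  qed
  ultimately show "(line a b, line c d) \<in> complementary_lines"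
    using assms unfolding complementary_lines_def CP1_eq by blast
qed

lemma eigenspace_iff:
  "vector [x, y] \<in> eigenspace (mat2 p q r s) c \<longleftrightarrow> p * x + q * y = c * x \<and> r * x + s * y = c * y"
  by (simp add: eigenspace_def vector2_scale)

text \<open>As c^2 = -1, the number c is an eigenvalue and the two rows of the eigenvector equation
  are dependent. Where p + c is nonzero the second row alone determines the line, where c - p is
  nonzero the first.\<close>

lemma eigenspace_line:
  assumes "mat2 p q r s \<in> OrbC" "c * c = - 1"
  shows "p + c \<noteq> 0 \<Longrightarrow> eigenspace (mat2 p q r s) c = line 1 (r / (p + c))"
    "c - p \<noteq> 0 \<Longrightarrow> eigenspace (mat2 p q r s) c = line (q / (c - p)) 1"
proof -
  have s: "s = - p" and pq: "p * p + q * r = - 1" using assms(1) by (auto simp: OrbC_iff)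
  have pc: "(p - c) * (p + c) = - (q * r)" using pq assms(2) by (simp add: algebra_simps)
    (metis add.commute add_diff_cancel_right' diff_minus_eq_add)
  {
    assume ne: "p + c \<noteq> 0"
    show "eigenspace (mat2 p q r s) c = line 1 (r / (p + c))"
    proof (rule line_eqI)
      fix x y
      have "(p * x + q * y - c * x) * (p + c) = q * (y * (p + c) - r * x)" using pc by algebra
      moreover have "y * (p + c) - r * x = 0" if "r * x + s * y = c * y"
        using that by (simp add: s algebra_simps)
      ultimately have "r * x + s * y = c * y \<Longrightarrow> p * x + q * y = c * x"
        using ne by (metis eq_iff_diff_eq_0 mult_eq_0_iff)
      then show "vector [x, y] \<in> eigenspace (mat2 p q r s) c \<longleftrightarrow> 1 * y = r / (p + c) * x"
        unfolding eigenspace_iff using ne by (auto simp: s field_simps)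
    qed simp
  next
    assume ne: "c - p \<noteq> 0"
    show "eigenspace (mat2 p q r s) c = line (q / (c - p)) 1"
    proof (rule line_eqI)
      fix x y
      have "(r * x + s * y - c * y) * (c - p) = r * (x * (c - p) - q * y)" using pc s by algebra
      moreover have "x * (c - p) - q * y = 0" if "p * x + q * y = c * x"
        using that by (simp add: algebra_simps)
      ultimately have "p * x + q * y = c * x \<Longrightarrow> r * x + s * y = c * y"
        using ne by (metis eq_iff_diff_eq_0 mult_eq_0_iff)
      then show "vector [x, y] \<in> eigenspace (mat2 p q r s) c \<longleftrightarrow> q / (c - p) * y = 1 * x"
        unfolding eigenspace_iff using ne by (auto simp: s field_simps)
    qed simp
  }
qed

text \<open>\<open>\<i>\<close> times the reflection that fixes the line through \<open>(a, b)\<close> and reverses the line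
  through \<open>(c, d)\<close>.\<close>

definition lines_to_orbit :: "complex \<Rightarrow> complex \<Rightarrow> complex \<Rightarrow> complex \<Rightarrow> cmat" where
  "lines_to_orbit a b c d = (\<i> / (a * d - b * c)) *\<^sub>M
     mat2 (a * d + b * c) (- 2 * a * c) (2 * b * d) (- (a * d + b * c))"

lemma lines_to_orbit:
  assumes "a * d - b * c \<noteq> 0"
  shows "lines_to_orbit a b c d \<in> OrbC"
    "eigenspace (lines_to_orbit a b c d) \<i> = line a b"
    "eigenspace (lines_to_orbit a b c d) (- \<i>) = line c d"
proof -
  define m where "m = \<i> / (a * d - b * c)"
  have m: "m * (a * d - b * c) = \<i>" "m \<noteq> 0" using assms by (simp_all add: m_def)
  have eq: "lines_to_orbit a b c d = mat2 (m * (a * d + b * c)) (m * (- 2 * a * c)) (m * (2 * b * d)) (m * (- (a * d + b * c)))"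
    by (simp add: lines_to_orbit_def m_def)
  have "m * (a * d + b * c) * (m * (a * d + b * c)) + m * (- 2 * a * c) * (m * (2 * b * d))
    = (m * (a * d - b * c)) * (m * (a * d - b * c))" by (simp add: algebra_simps)
  also have "\<dots> = - 1" unfolding m(1) by simp
  finally show "lines_to_orbit a b c d \<in> OrbC" unfolding eq OrbC_iff by (simp only: mult_minus_right simp_thms)
  have ab: "a \<noteq> 0 \<or> b \<noteq> 0" "c \<noteq> 0 \<or> d \<noteq> 0" using assms by auto
  show "eigenspace (lines_to_orbit a b c d) \<i> = line a b"
  proof (rule line_eqI[OF ab(1)])
    fix x y
    \<comment> \<open>Both rows are multiples of the one equation of the line, with factors
      proportional to c and d, which are not both 0.\<close>
    have "m * (a * d + b * c) * x + m * (- 2 * a * c) * y - \<i> * x = 2 * m * c * (b * x - a * y)"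
      "m * (2 * b * d) * x + m * (- (a * d + b * c)) * y - \<i> * y = 2 * m * d * (b * x - a * y)"
      unfolding m(1)[symmetric] by (simp_all add: algebra_simps)
    then show "vector [x, y] \<in> eigenspace (lines_to_orbit a b c d) \<i> \<longleftrightarrow> a * y = b * x"
      unfolding eq eigenspace_iff using ab m(2) by (metis eq_iff_diff_eq_0 mult_eq_0_iff zero_neq_numeral)
  qed
  show "eigenspace (lines_to_orbit a b c d) (- \<i>) = line c d"
  proof (rule line_eqI[OF ab(2)])
    fix x y
    have "m * (a * d + b * c) * x + m * (- 2 * a * c) * y - (- \<i>) * x = 2 * m * a * (d * x - c * y)"
      "m * (2 * b * d) * x + m * (- (a * d + b * c)) * y - (- \<i>) * y = 2 * m * b * (d * x - c * y)"
      unfolding m(1)[symmetric] by (simp_all add: algebra_simps)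
    then show "vector [x, y] \<in> eigenspace (lines_to_orbit a b c d) (- \<i>) \<longleftrightarrow> c * y = d * x"
      unfolding eq eigenspace_iff using ab m(2) by (metis eq_iff_diff_eq_0 mult_eq_0_iff zero_neq_numeral)
  qed
qed

lemma OrbC_eigenspaces_inj:
  assumes "y \<in> OrbC" "y' \<in> OrbC" "eigenspace y \<i> = eigenspace y' \<i>" "eigenspace y (- \<i>) = eigenspace y' (- \<i>)"
  shows "y = y'"
proof -
  have "y *v v = y' *v v" for v
  proof -
    have "(- mat 1) *v w = - w" for w :: "complex^2"
      by (simp add: vec_eq_iff forall_2 matrix_vector_mult_def sum_2 mat_def)
    then have sq: "y *v (y *v v) = - v"
      unfolding matrix_vector_mul_assoc OrbC_square[OF assms(1)] .
    \<comment> \<open>By y^2 = -1 these are eigenvectors for \<i> and - \<i>, and 2 \<i> v = u - w,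
      so the action on the two eigenlines determines y on all v.\<close>
    define u where "u = y *v v + \<i> *s v"
    define w where "w = y *v v - \<i> *s v"
    have "y *v u = \<i> *s u" "y *v w = (- \<i>) *s w"
      unfolding u_def w_def matrix_vector_right_distrib matrix_vector_mult_diff_distrib vector_scalar_commute sq
      by (simp_all add: vec_eq_iff algebra_simps)
    then have u: "y' *v u = \<i> *s u" and w: "y' *v w = (- \<i>) *s w"
      using assms(3,4) unfolding eigenspace_def by blast+
    have v: "(2 * \<i>) *s v = u - w" by (simp add: u_def w_def vec_eq_iff)
    have "(2 * \<i>) *s (y' *v v) = y' *v (u - w)" by (simp only: v[symmetric] vector_scalar_commute)
    also have "\<dots> = \<i> *s u + \<i> *s w" by (simp add: matrix_vector_mult_diff_distrib u w vec_eq_iff)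
    also have "\<dots> = (2 * \<i>) *s (y *v v)" by (simp add: u_def w_def vec_eq_iff algebra_simps)
    finally show ?thesis by (simp add: vec_eq_iff)
  qed
  then show ?thesis by (simp add: matrix_eq)
qed

subsection \<open>Charts of the projective line\<close>

lemma line_in_CP1: "a \<noteq> 0 \<or> b \<noteq> 0 \<Longrightarrow> line a b \<in> CP1"
  unfolding CP1_eq by blast

definition chart0 :: "(complex^2) set \<Rightarrow> complex" where "chart0 l = (THE w. vector [1, w] \<in> l)"
definition chart1 :: "(complex^2) set \<Rightarrow> complex" where "chart1 l = (THE w. vector [w, 1] \<in> l)"

lemma chart_line: "chart0 (line 1 w) = w" "chart1 (line w 1) = w"
  by (auto simp: chart0_def chart1_def in_line_iff)

lemma CP1_atlas_eq: "CP1_atlas = {(range (line 1), chart0), (range (\<lambda>w. line w 1), chart1)}"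
proof -
  have "{l \<in> CP1. \<exists>w. vector [1, w] \<in> l} = range (line 1)"
  proof (intro equalityI subsetI)
    fix l assume "l \<in> {l \<in> CP1. \<exists>w. vector [1, w] \<in> l}"
    then obtain a b w where l: "l = line a b" "a \<noteq> 0 \<or> b \<noteq> 0" "vector [1, w] \<in> l" by (auto simp: CP1_eq)
    then have "l = line 1 w" by (simp add: line_eq_iff in_line_iff)
    then show "l \<in> range (line 1)" by blast
  next
    fix l assume "l \<in> range (line 1)"
    then obtain w where l: "l = line 1 w" by blast
    then have "vector [1, w] \<in> l" by (simp add: in_line_iff)
    moreover have "l \<in> CP1" unfolding l by (simp add: line_in_CP1)
    ultimately show "l \<in> {l \<in> CP1. \<exists>w. vector [1, w] \<in> l}" by blast
  qed
  moreover have "{l \<in> CP1. \<exists>w. vector [w, 1] \<in> l} = range (\<lambda>w. line w 1)"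
  proof (intro equalityI subsetI)
    fix l assume "l \<in> {l \<in> CP1. \<exists>w. vector [w, 1] \<in> l}"
    then obtain a b w where l: "l = line a b" "a \<noteq> 0 \<or> b \<noteq> 0" "vector [w, 1] \<in> l" by (auto simp: CP1_eq)
    then have "l = line w 1" by (simp add: line_eq_iff in_line_iff)
    then show "l \<in> range (\<lambda>w. line w 1)" by blast
  next
    fix l assume "l \<in> range (\<lambda>w. line w 1)"
    then obtain w where l: "l = line w 1" by blast
    then have "vector [w, 1] \<in> l" by (simp add: in_line_iff)
    moreover have "l \<in> CP1" unfolding l by (simp add: line_in_CP1)
    ultimately show "l \<in> {l \<in> CP1. \<exists>w. vector [w, 1] \<in> l}" by blast
  qed
  ultimately show ?thesis by (simp add: CP1_atlas_def chart0_def[abs_def] chart1_def[abs_def])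
qed

text \<open>Both charts are treated uniformly by a parametrisation \<open>w \<mapsto> line (\<alpha> w) (\<beta> w)\<close>.\<close>

lemma CP1_chart:
  assumes "(U, \<phi>) \<in> CP1_atlas"
  obtains \<alpha> \<beta> :: "complex \<Rightarrow> complex" where "U = range (\<lambda>w. line (\<alpha> w) (\<beta> w))"
    "\<And>w. \<phi> (line (\<alpha> w) (\<beta> w)) = w" "\<And>w. \<alpha> w \<noteq> 0 \<or> \<beta> w \<noteq> 0"
    "smooth_on UNIV \<alpha>" "smooth_on UNIV \<beta>"
proof -
  from assms consider "U = range (line 1)" "\<phi> = chart0" | "U = range (\<lambda>w. line w 1)" "\<phi> = chart1"
    by (auto simp: CP1_atlas_eq)
  then show thesis
  proof cases
    case 1
    show thesis by (rule that[of "\<lambda>w. 1" "\<lambda>w. w"]) (auto simp: 1 chart_line)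
  next
    case 2
    show thesis by (rule that[of "\<lambda>w. w" "\<lambda>w. 1"]) (auto simp: 2 chart_line)
  qed
qed

lemma points_CP1_atlas: "points CP1_atlas = CP1"
proof (intro equalityI subsetI)
  fix l assume "l \<in> points CP1_atlas"
  then consider w where "l = line 1 w" | w where "l = line w 1"
    unfolding points_def CP1_atlas_eq by auto
  then show "l \<in> CP1" by cases (auto intro: line_in_CP1)
next
  fix l assume "l \<in> CP1"
  then obtain a b where l: "l = line a b" "a \<noteq> 0 \<or> b \<noteq> 0" by (auto simp: CP1_eq)
  then have "l = line 1 (b / a) \<or> l = line (a / b) 1" by (auto simp: line_eq_iff)
  then show "l \<in> points CP1_atlas" unfolding points_def CP1_atlas_eq by auto
qed

lemma complementary_lines_subset: "complementary_lines \<subseteq> CP1 \<times> CP1"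
  by (auto simp: complementary_lines_def)

lemma in_points_iff: "p \<in> points A \<longleftrightarrow> (\<exists>U \<phi>. (U, \<phi>) \<in> A \<and> p \<in> U)"
  unfolding points_def by auto

lemma points_restrict_atlas: "points (restrict_atlas A S) = points A \<inter> S"
  by (rule set_eqI) (simp add: in_points_iff restrict_atlas_def, blast)

lemma points_prod_atlas: "points (prod_atlas A B) = points A \<times> points B"
  by (rule set_eqI) (clarsimp simp: in_points_iff prod_atlas_def, blast)

lemma points_complementary_lines_atlas: "points complementary_lines_atlas = complementary_lines"
  unfolding complementary_lines_atlas_def points_restrict_atlas points_prod_atlas points_CP1_atlas
  using complementary_lines_subset by blast

lemma complementary_chartI:
  "(U, \<phi>) \<in> CP1_atlas \<Longrightarrow> (V, \<psi>) \<in> CP1_atlas \<Longrightarrow>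
    ((U \<times> V) \<inter> complementary_lines, map_prod \<phi> \<psi>) \<in> complementary_lines_atlas"
  unfolding complementary_lines_atlas_def restrict_atlas_def prod_atlas_def mem_Collect_eq
  by (intro exI conjI) (rule refl | assumption)+

lemma complementary_chartE:
  assumes "(X, \<xi>) \<in> complementary_lines_atlas"
  obtains U \<phi> V \<psi> where "(U, \<phi>) \<in> CP1_atlas" "(V, \<psi>) \<in> CP1_atlas"
    "X = (U \<times> V) \<inter> complementary_lines" "\<xi> = map_prod \<phi> \<psi>"
proof -
  from assms obtain X' where X: "(X', \<xi>) \<in> prod_atlas CP1_atlas CP1_atlas" "X = X' \<inter> complementary_lines"
    unfolding complementary_lines_atlas_def restrict_atlas_def by auto
  from X(1) obtain U \<phi> V \<psi> where "(U, \<phi>) \<in> CP1_atlas" "(V, \<psi>) \<in> CP1_atlas" "X' = U \<times> V"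
    "\<xi> = map_prod \<phi> \<psi>"
    unfolding prod_atlas_def by auto
  then show thesis using X(2) by (intro that) auto
qed

lemma CP1_atlas_charts: "(range (line 1), chart0) \<in> CP1_atlas" "(range (\<lambda>w. line w 1), chart1) \<in> CP1_atlas"
  by (auto simp: CP1_atlas_eq)

lemma smooth_on_lines_to_orbit:
  assumes "smooth_on S a" "smooth_on S b" "smooth_on S c" "smooth_on S d"
    "\<And>p. p \<in> S \<Longrightarrow> a p * d p - b p * c p \<noteq> 0"
  shows "smooth_on S (\<lambda>p. lines_to_orbit (a p) (b p) (c p) (d p))"
  unfolding lines_to_orbit_def using assms by auto

lemma OrbC_lines:
  assumes "y \<in> OrbC"
  obtains a b c d where "a * d - b * c = 1" "y = lines_to_orbit a b c d"
proof -
  obtain g where g: "g \<in> SL2C" "y = Ad g x0" using assms by (auto simp: orbit_def)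
  \<comment> \<open>The columns of g, named (a, b) and (c, d), span the two eigenlines.\<close>
  obtain a c b d where abcd: "g = mat2 a c b d" by (rule cmat_cases)
  have D: "a * d - c * b = 1" using g(1) by (simp add: SL2C_def abcd)
  then have D': "a * d - b * c = 1" by (simp only: mult.commute)
  have "y = lines_to_orbit a b c d"
    unfolding g(2) abcd Ad_mat2_x0[OF D] lines_to_orbit_def D' by (simp add: algebra_simps)
  then show thesis by (rule that[OF D'])
qed

lemma smooth_eigenlines:
  assumes "c * c = - 1" "S \<subseteq> OrbC"
  shows "(\<And>y. y \<in> S \<Longrightarrow> y $ 1 $ 1 + c \<noteq> 0) \<Longrightarrow> smooth_on S (\<lambda>y. chart0 (eigenspace y c))"
    "(\<And>y. y \<in> S \<Longrightarrow> c - y $ 1 $ 1 \<noteq> 0) \<Longrightarrow> smooth_on S (\<lambda>y. chart1 (eigenspace y c))"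
    "\<And>y. y \<in> S \<Longrightarrow> y $ 1 $ 1 + c \<noteq> 0 \<Longrightarrow> eigenspace y c \<in> range (line 1)"
    "\<And>y. y \<in> S \<Longrightarrow> c - y $ 1 $ 1 \<noteq> 0 \<Longrightarrow> eigenspace y c \<in> range (\<lambda>w. line w 1)"
proof -
  have 1: "eigenspace y c = line 1 (y $ 2 $ 1 / (y $ 1 $ 1 + c))" if "y \<in> S" "y $ 1 $ 1 + c \<noteq> 0" for y
    using eigenspace_line(1)[OF _ assms(1), of "y $ 1 $ 1" "y $ 1 $ 2" "y $ 2 $ 1" "y $ 2 $ 2"] that assms(2)
    by (cases y rule: cmat_cases) auto
  have 2: "eigenspace y c = line (y $ 1 $ 2 / (c - y $ 1 $ 1)) 1" if "y \<in> S" "c - y $ 1 $ 1 \<noteq> 0" for y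
    using eigenspace_line(2)[OF _ assms(1), of "y $ 1 $ 1" "y $ 1 $ 2" "y $ 2 $ 1" "y $ 2 $ 2"] that assms(2)
    by (cases y rule: cmat_cases) auto
  show "eigenspace y c \<in> range (line 1)" if "y \<in> S" "y $ 1 $ 1 + c \<noteq> 0" for y
    unfolding 1[OF that] by (rule rangeI)
  show "eigenspace y c \<in> range (\<lambda>w. line w 1)" if "y \<in> S" "c - y $ 1 $ 1 \<noteq> 0" for y
    unfolding 2[OF that] by (rule rangeI)
  show "smooth_on S (\<lambda>y. chart0 (eigenspace y c))" if "\<And>y. y \<in> S \<Longrightarrow> y $ 1 $ 1 + c \<noteq> 0"
  proof (rule smooth_on_eq)
    show "smooth_on S (\<lambda>y. y $ 2 $ 1 / (y $ 1 $ 1 + c))" using that by auto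
    show "p $ 2 $ 1 / (p $ 1 $ 1 + c) = chart0 (eigenspace p c)" if p: "p \<in> S" for p
      unfolding 1[OF p \<open>\<And>y. y \<in> S \<Longrightarrow> y $ 1 $ 1 + c \<noteq> 0\<close>[OF p]] chart_line ..
  qed
  show "smooth_on S (\<lambda>y. chart1 (eigenspace y c))" if "\<And>y. y \<in> S \<Longrightarrow> c - y $ 1 $ 1 \<noteq> 0"
  proof (rule smooth_on_eq)
    show "smooth_on S (\<lambda>y. y $ 1 $ 2 / (c - y $ 1 $ 1))" using that by auto
    show "p $ 1 $ 2 / (c - p $ 1 $ 1) = chart1 (eigenspace p c)" if p: "p \<in> S" for p
      unfolding 2[OF p \<open>\<And>y. y \<in> S \<Longrightarrow> c - y $ 1 $ 1 \<noteq> 0\<close>[OF p]] chart_line ..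
  qed
qed

lemma open_entry_neq: "open {y :: cmat. y $ 1 $ 1 + c \<noteq> 0}" "open {y :: cmat. c - y $ 1 $ 1 \<noteq> 0}"
  by (intro open_Collect_neq continuous_intros)+

lemma OrbC_lines_diffeo:
  "diffeo (emb OrbC) complementary_lines_atlas (\<lambda>y. (eigenspace y \<i>, eigenspace y (- \<i>)))"
    (is "diffeo _ _ ?f")
  unfolding diffeo_def points_emb points_complementary_lines_atlas
proof (intro conjI)
  have f: "?f (lines_to_orbit a b c d) = (line a b, line c d)" if "a * d - b * c \<noteq> 0" for a b c d
    using lines_to_orbit[OF that] by simp
  have in_c: "?f y \<in> complementary_lines" if "y \<in> OrbC" for y
  proof -
    from OrbC_lines[OF that] obtain a b c d where "a * d - b * c = 1" "y = lines_to_orbit a b c d" .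
    then show ?thesis using f[of a d b c] complementary_lines_iff[of a b c d] by fastforce
  qed
  have inj: "inj_on ?f OrbC"
    by (intro inj_onI OrbC_eigenspaces_inj) auto
  have "p \<in> ?f ` OrbC" if "p \<in> complementary_lines" for p
  proof -
    from \<open>p \<in> complementary_lines\<close> complementary_lines_subset
    obtain l1 l2 where "p = (l1, l2)" "l1 \<in> CP1" "l2 \<in> CP1" by blast
    then obtain a b c d where p: "p = (line a b, line c d)" and ne: "a \<noteq> 0 \<or> b \<noteq> 0" "c \<noteq> 0 \<or> d \<noteq> 0"
      unfolding CP1_eq by blast
    have D: "a * d - b * c \<noteq> 0" using that complementary_lines_iff[OF ne] p by simp
    show ?thesis unfolding p f[OF D, symmetric] by (rule imageI[OF lines_to_orbit(1)[OF D]])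
  qed
  with in_c show bij: "bij_betw ?f OrbC complementary_lines"
    by (intro bij_betw_imageI[OF inj]) blast
  show "smooth_map (emb OrbC) complementary_lines_atlas ?f"
  proof (rule smooth_map_from_embI)
    fix y assume "y \<in> OrbC"
    have ii: "\<i> * \<i> = - 1" "- \<i> * - \<i> = - 1" by simp_all
    show "\<exists>V \<psi> W. (V, \<psi>) \<in> complementary_lines_atlas \<and> open W \<and> y \<in> W \<and>
      (\<forall>q \<in> OrbC \<inter> W. ?f q \<in> V) \<and> smooth_on (OrbC \<inter> W) (\<lambda>t. \<psi> (?f t))"
    \<comment> \<open>For the two eigenvalues the chart conditions differ only by a sign when
      opposite charts are paired, so one inequality on the corner entry covers both lines, and the
      two mixed pairs of charts suffice.\<close>
    proof (cases "y $ 1 $ 1 + \<i> = 0")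
      case False
      let ?W = "{y :: cmat. y $ 1 $ 1 + \<i> \<noteq> 0}"
      have W: "- \<i> - q $ 1 $ 1 \<noteq> 0" if "q \<in> ?W" for q
        using that by (simp add: diff_eq_eq eq_neg_iff_add_eq_0 add.commute) (metis add.commute add_eq_0_iff2 minus_equation_iff)
      have "OrbC \<inter> ?W \<subseteq> OrbC" by blast
      note e = smooth_eigenlines[OF ii(1) this] smooth_eigenlines[OF ii(2) this]
      show ?thesis
      proof (intro exI conjI ballI)
        show "(range (line 1) \<times> range (\<lambda>w. line w 1) \<inter> complementary_lines, map_prod chart0 chart1)
            \<in> complementary_lines_atlas"
          by (rule complementary_chartI[OF CP1_atlas_charts])
        show "open ?W" by (rule open_entry_neq(1))
        show "y \<in> ?W" using False by simp
        show "?f q \<in> range (line 1) \<times> range (\<lambda>w. line w 1) \<inter> complementary_lines"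
          if q: "q \<in> OrbC \<inter> ?W" for q
          using e(3)[OF q] e(8)[OF q] q W[of q] in_c[of q] by simp
        have "smooth_on (OrbC \<inter> ?W) (\<lambda>y. chart0 (eigenspace y \<i>))" by (rule e(1)) simp
        moreover have "smooth_on (OrbC \<inter> ?W) (\<lambda>y. chart1 (eigenspace y (- \<i>)))"
          by (rule e(6)) (use W in blast)
        ultimately show "smooth_on (OrbC \<inter> ?W) (\<lambda>t. map_prod chart0 chart1 (?f t))"
          unfolding map_prod_simp by (rule smooth_on_Pair)
      qed
    next
      case True
      let ?W = "{y :: cmat. \<i> - y $ 1 $ 1 \<noteq> 0}"
      have W: "q $ 1 $ 1 + - \<i> \<noteq> 0" if "q \<in> ?W" for q using that by auto
      have "OrbC \<inter> ?W \<subseteq> OrbC" by blast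
      note e = smooth_eigenlines[OF ii(1) this] smooth_eigenlines[OF ii(2) this]
      show ?thesis
      proof (intro exI conjI ballI)
        show "(range (\<lambda>w. line w 1) \<times> range (line 1) \<inter> complementary_lines, map_prod chart1 chart0)
            \<in> complementary_lines_atlas"
          by (rule complementary_chartI[OF CP1_atlas_charts(2,1)])
        show "open ?W" by (rule open_entry_neq(2))
        show "y \<in> ?W" using True by (auto simp: add_eq_0_iff2)
        show "?f q \<in> range (\<lambda>w. line w 1) \<times> range (line 1) \<inter> complementary_lines"
          if q: "q \<in> OrbC \<inter> ?W" for q
          using e(4)[OF q] e(7)[OF q] q W[of q] in_c[of q] by simp
        have "smooth_on (OrbC \<inter> ?W) (\<lambda>y. chart1 (eigenspace y \<i>))" by (rule e(2)) simp
        moreover have "smooth_on (OrbC \<inter> ?W) (\<lambda>y. chart0 (eigenspace y (- \<i>)))"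
          by (rule e(5)) (use W in blast)
        ultimately show "smooth_on (OrbC \<inter> ?W) (\<lambda>t. map_prod chart1 chart0 (?f t))"
          unfolding map_prod_simp by (rule smooth_on_Pair)
      qed
    qed
  qed
  have inv: "inv_into OrbC ?f (line a b, line c d) = lines_to_orbit a b c d" if "a * d - b * c \<noteq> 0" for a b c d
    unfolding f[OF that, symmetric] by (rule inv_into_f_f[OF inj lines_to_orbit(1)[OF that]])
  show "smooth_map complementary_lines_atlas (emb OrbC) (inv_into OrbC ?f)"
  proof (rule smooth_map_into_embI)
    show "inv_into OrbC ?f p \<in> OrbC" if "p \<in> points complementary_lines_atlas" for p
      by (rule inv_into_into)
        (use that in \<open>simp only: bij_betw_imp_surj_on[OF bij] points_complementary_lines_atlas\<close>)
  next
    fix X \<xi> assume "(X, \<xi>) \<in> complementary_lines_atlas"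
    then obtain U \<phi> V \<psi> where UV: "(U, \<phi>) \<in> CP1_atlas" "(V, \<psi>) \<in> CP1_atlas"
      and X: "X = (U \<times> V) \<inter> complementary_lines" and \<xi>: "\<xi> = map_prod \<phi> \<psi>"
      by (rule complementary_chartE)
    obtain a b where U: "U = range (\<lambda>w. line (a w) (b w))" "\<And>w. \<phi> (line (a w) (b w)) = w" 
      "\<And>w. a w \<noteq> 0 \<or> b w \<noteq> 0" and ab: "smooth_on UNIV a" "smooth_on UNIV b"
      by (rule CP1_chart[OF UV(1)]) (rule that)
    obtain c d where V: "V = range (\<lambda>w. line (c w) (d w))" "\<And>w. \<psi> (line (c w) (d w)) = w" 
      "\<And>w. c w \<noteq> 0 \<or> d w \<noteq> 0" and cd: "smooth_on UNIV c" "smooth_on UNIV d"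
      by (rule CP1_chart[OF UV(2)]) (rule that)
    have inj: "inj_on \<xi> X"
      unfolding X \<xi> U(1) V(1) by (auto intro!: inj_onI simp: U(2) V(2))
    \<comment> \<open>Parameters in the image of the chart belong to complementary lines, so the
      denominator of \<open>lines_to_orbit\<close> is nonzero there.\<close>
    have *: "a (fst t) * d (snd t) - b (fst t) * c (snd t) \<noteq> 0 \<and>
      inv_into X \<xi> t = (line (a (fst t)) (b (fst t)), line (c (snd t)) (d (snd t)))" if "t \<in> \<xi> ` X" for t
    proof -
      obtain w v where wv: "t = \<xi> (line (a w) (b w), line (c v) (d v))" "(line (a w) (b w), line (c v) (d v)) \<in> X"
        using \<open>t \<in> \<xi> ` X\<close> unfolding X U V by blast
      then have "t = (w, v)" by (simp add: \<xi> U V)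
      moreover have "inv_into X \<xi> t = (line (a w) (b w), line (c v) (d v))"
        unfolding wv(1) by (rule inv_into_f_f[OF inj wv(2)])
      moreover have "a w * d v - b w * c v \<noteq> 0"
        using wv(2) complementary_lines_iff[OF U(3) V(3)] unfolding X by blast
      ultimately show ?thesis by simp
    qed
    show "smooth_on (\<xi> ` X) (\<lambda>t. inv_into OrbC ?f (inv_into X \<xi> t))"
    proof (rule smooth_on_eq)
      show "smooth_on (\<xi> ` X) (\<lambda>t. lines_to_orbit (a (fst t)) (b (fst t)) (c (snd t)) (d (snd t)))"
        using * by (intro smooth_on_lines_to_orbit smooth_on_compose[OF ab(1)] smooth_on_compose[OF ab(2)]
          smooth_on_compose[OF cd(1)] smooth_on_compose[OF cd(2)] smooth_on_fst smooth_on_snd smooth_on_id) auto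
      show "lines_to_orbit (a (fst t)) (b (fst t)) (c (snd t)) (d (snd t)) = inv_into OrbC ?f (inv_into X \<xi> t)"
        if "t \<in> \<xi> ` X" for t
        using *[OF that] inv by simp
    qed
  qed
qed

section \<open>The compact orbit as projective line and sphere\<close>

text \<open>The vector (- cnj b, cnj a) spans the orthogonal complement of (a, b), and \<i> times
  the reflection with orthogonal eigenlines is skew-Hermitian. The compact orbit thus consists of
  the orthogonal pairs of lines.\<close>

lemma lines_to_orbit_orthogonal:
  assumes "a \<noteq> 0 \<or> b \<noteq> 0"
  shows "a * cnj a - b * - cnj b \<noteq> 0" "lines_to_orbit a b (- cnj b) (cnj a) \<in> Orb"
proof -
  have D: "a * cnj a - b * - cnj b = of_real ((cmod a)\<^sup>2 + (cmod b)\<^sup>2)"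
    unfolding of_real_add complex_norm_square by simp
  have "(cmod a)\<^sup>2 + (cmod b)\<^sup>2 \<noteq> 0"
    using assms by (simp add: sum_power2_eq_zero_iff)
  then show ne: "a * cnj a - b * - cnj b \<noteq> 0" unfolding D of_real_eq_0_iff .
  show "lines_to_orbit a b (- cnj b) (cnj a) \<in> Orb"
  proof (rule OrbI[OF lines_to_orbit(1)[OF ne]])
    show "ctransp (lines_to_orbit a b (- cnj b) (cnj a)) = - lines_to_orbit a b (- cnj b) (cnj a)"
      unfolding lines_to_orbit_def D by (simp add: algebra_simps diff_divide_distrib)
  qed
qed

lemma Orb_lines:
  assumes "y \<in> Orb"
  obtains a b where "a \<noteq> 0 \<or> b \<noteq> 0" "y = lines_to_orbit a b (- cnj b) (cnj a)"
proof -
  obtain g where "g \<in> SU2" and y: "y = Ad g x0" using assms by (auto simp: orbit_def)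
  then obtain a b where g: "g = mat2 a (- cnj b) b (cnj a)" and D: "a * cnj a + b * cnj b = 1"
    by (auto simp: SU2_iff)
  have D': "a * cnj a - (- cnj b) * b = 1" using D by (simp add: mult.commute)
  have "y = lines_to_orbit a b (- cnj b) (cnj a)"
    unfolding y g Ad_mat2_x0[OF D'] lines_to_orbit_def using D by (simp add: algebra_simps)
  moreover have "a \<noteq> 0 \<or> b \<noteq> 0" using D by auto
  ultimately show thesis using that by blast
qed

text \<open>One eigenline determines the other as its orthogonal complement, and the two together
  determine the matrix.\<close>

lemma eigenspace_Orb_inj: "inj_on (\<lambda>y. eigenspace y \<i>) Orb"
proof (rule inj_onI)
  fix y y' assume y: "y \<in> Orb" "y' \<in> Orb" "eigenspace y \<i> = eigenspace y' \<i>"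
  obtain a b where ab: "a \<noteq> 0 \<or> b \<noteq> 0" "y = lines_to_orbit a b (- cnj b) (cnj a)"
    using Orb_lines[OF y(1)] .
  obtain c d where cd: "c \<noteq> 0 \<or> d \<noteq> 0" "y' = lines_to_orbit c d (- cnj d) (cnj c)"
    using Orb_lines[OF y(2)] .
  note l = lines_to_orbit[OF lines_to_orbit_orthogonal(1)[OF ab(1)]]
    lines_to_orbit[OF lines_to_orbit_orthogonal(1)[OF cd(1)]]
  have "line a b = line c d" using y(3) unfolding ab(2) cd(2) l .
  then have "a * d = b * c" using ab cd by (simp add: line_eq_iff)
  then have "cnj (a * d) = cnj (b * c)" by simp
  then have "line (- cnj b) (cnj a) = line (- cnj d) (cnj c)"
    using ab cd by (subst line_eq_iff) (auto simp: mult.commute)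
  then have "eigenspace y (- \<i>) = eigenspace y' (- \<i>)" unfolding ab(2) cd(2) l .
  then show "y = y'" using y Orb_subset_OrbC by (intro OrbC_eigenspaces_inj) auto
qed

lemma eigenspace_Orb_image: "(\<lambda>y. eigenspace y \<i>) ` Orb = CP1"
proof (intro equalityI subsetI)
  fix l assume "l \<in> (\<lambda>y. eigenspace y \<i>) ` Orb"
  then obtain y where y: "y \<in> Orb" "l = eigenspace y \<i>" by blast
  obtain a b where ab: "a \<noteq> 0 \<or> b \<noteq> 0" "y = lines_to_orbit a b (- cnj b) (cnj a)"
    using Orb_lines[OF y(1)] .
  then show "l \<in> CP1"
    unfolding y(2) ab(2) lines_to_orbit(2)[OF lines_to_orbit_orthogonal(1)[OF ab(1)]] CP1_eq by blast
next
  fix l assume "l \<in> CP1"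
  then obtain a b where ab: "l = line a b" "a \<noteq> 0 \<or> b \<noteq> 0" by (auto simp: CP1_eq)
  show "l \<in> (\<lambda>y. eigenspace y \<i>) ` Orb"
    unfolding ab(1) lines_to_orbit(2)[OF lines_to_orbit_orthogonal(1)[OF ab(2)], symmetric]
    by (rule imageI[OF lines_to_orbit_orthogonal(2)[OF ab(2)]])
qed

text \<open>In a chart the inverse completes the line by its orthogonal complement; conjugation
  makes it smooth, though not holomorphic, in the parameter.\<close>

lemma eigenspace_Orb_inv:
  assumes "(U, \<phi>) \<in> CP1_atlas"
  shows "smooth_on (\<phi> ` U) (\<lambda>t. inv_into Orb (\<lambda>y. eigenspace y \<i>) (inv_into U \<phi> t))"
proof -
  obtain a b where U: "U = range (\<lambda>w. line (a w) (b w))" "\<And>w. \<phi> (line (a w) (b w)) = w" 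
    "\<And>w. a w \<noteq> 0 \<or> b w \<noteq> 0" and ab: "smooth_on UNIV a" "smooth_on UNIV b"
    by (rule CP1_chart[OF assms]) (rule that)
  have inj: "inj_on \<phi> U" unfolding U(1) by (auto intro!: inj_onI simp: U(2))
  have inv_\<phi>: "inv_into U \<phi> w = line (a w) (b w)" for w
  proof -
    have "line (a w) (b w) \<in> U" unfolding U(1) by (rule rangeI)
    from inv_into_f_f[OF inj this] show ?thesis by (simp only: U(2))
  qed
  have "inv_into Orb (\<lambda>y. eigenspace y \<i>) (inv_into U \<phi> w) = lines_to_orbit (a w) (b w) (- cnj (b w)) (cnj (a w))" for w
    unfolding inv_\<phi> lines_to_orbit(2)[OF lines_to_orbit_orthogonal(1)[OF U(3)], symmetric]
    by (rule inv_into_f_f[OF eigenspace_Orb_inj lines_to_orbit_orthogonal(2)[OF U(3)]])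
  moreover have "smooth_on (\<phi> ` U) (\<lambda>w. lines_to_orbit (a w) (b w) (- cnj (b w)) (cnj (a w)))"
    using smooth_on_subset[OF ab(1) subset_UNIV] smooth_on_subset[OF ab(2) subset_UNIV]
    by (intro smooth_on_lines_to_orbit smooth_on_minus smooth_on_cnj
      lines_to_orbit_orthogonal(1)[OF U(3)]) assumption+
  ultimately show ?thesis by simp
qed

text \<open>The two charts suffice because p + \<i> and \<i> - p cannot vanish together for the
  corner entry p.\<close>

lemma eigenspace_Orb_smooth:
  assumes "y \<in> Orb"
  shows "\<exists>V \<psi> W. (V, \<psi>) \<in> CP1_atlas \<and> open W \<and> y \<in> W \<and>
    (\<forall>q \<in> Orb \<inter> W. eigenspace q \<i> \<in> V) \<and> smooth_on (Orb \<inter> W) (\<lambda>t. \<psi> (eigenspace t \<i>))"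
proof -
  have ii: "\<i> * \<i> = - 1" by simp
  have "Orb \<inter> W \<subseteq> OrbC" for W using Orb_subset_OrbC by blast
  note e = smooth_eigenlines[OF ii this]
  show ?thesis
  proof (cases "y $ 1 $ 1 + \<i> = 0")
    case False
    let ?W = "{y :: cmat. y $ 1 $ 1 + \<i> \<noteq> 0}"
    have "smooth_on (Orb \<inter> ?W) (\<lambda>y. chart0 (eigenspace y \<i>))" by (rule e(1)) simp
    moreover have "\<forall>q\<in>Orb \<inter> ?W. eigenspace q \<i> \<in> range (line 1)"
      using e(3)[of _ ?W] by blast
    moreover have "y \<in> ?W" using False by simp
    ultimately show ?thesis using CP1_atlas_charts(1) open_entry_neq(1)[of \<i>] by blast
  next
    case True
    let ?W = "{y :: cmat. \<i> - y $ 1 $ 1 \<noteq> 0}"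
    have "smooth_on (Orb \<inter> ?W) (\<lambda>y. chart1 (eigenspace y \<i>))" by (rule e(2)) simp
    moreover have "\<forall>q\<in>Orb \<inter> ?W. eigenspace q \<i> \<in> range (\<lambda>w. line w 1)"
      using e(4)[of _ ?W] by blast
    moreover have "y \<in> ?W" using True by (auto simp: add_eq_0_iff2)
    ultimately show ?thesis using CP1_atlas_charts(2) open_entry_neq(2)[of \<i>] by blast
  qed
qed

lemma Orb_CP1_diffeo: "diffeo (emb Orb) CP1_atlas (\<lambda>y. eigenspace y \<i>)"
  unfolding diffeo_def points_emb points_CP1_atlas
proof (intro conjI)
  show "bij_betw (\<lambda>y. eigenspace y \<i>) Orb CP1"
    by (rule bij_betw_imageI[OF eigenspace_Orb_inj eigenspace_Orb_image])
  show "smooth_map (emb Orb) CP1_atlas (\<lambda>y. eigenspace y \<i>)"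
    by (rule smooth_map_from_embI[OF eigenspace_Orb_smooth])
  show "smooth_map CP1_atlas (emb Orb) (inv_into Orb (\<lambda>y. eigenspace y \<i>))"
    by (rule smooth_map_into_embI[OF _ eigenspace_Orb_inv])
      (simp only: points_CP1_atlas eigenspace_Orb_image[symmetric] inv_into_into)
qed

lemma smooth_on_imp_continuous_on:
  assumes "smooth_on S f"
  shows "continuous_on S f"
  unfolding continuous_on_eq_continuous_within
proof
  fix p assume p: "p \<in> S"
  obtain U F where U: "open U" "p \<in> U" "\<And>k. Ck_on k F U" "\<And>q. q \<in> S \<Longrightarrow> q \<in> U \<Longrightarrow> F q = f q"
    by (rule smooth_onE[OF assms p]) (rule that)
  have "continuous (at p within S) F"
    using U(1,2) U(3)[of 0] by (simp add: continuous_on_eq_continuous_at continuous_at_imp_continuous_within)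
  moreover have "\<forall>\<^sub>F q in at p within S. F q = f q"
    using U p by (auto simp: eventually_at_topological)
  ultimately show "continuous (at p within S) f"
    using U p by (simp add: continuous_within filterlim_cong[OF refl refl])
qed

text \<open>The intermediate step is the compact orbit, the unit sphere in the three real
  coordinates of su(2): for corner entries \<i> t and w the determinant condition is t^2 + |w|^2 =
  1.\<close>

lemma CP1_sphere: "\<exists>s. diffeo CP1_atlas (emb (sphere (0::real^3) 1)) s"
proof -
  define \<sigma> :: "cmat \<Rightarrow> real^3" where "\<sigma> y = vector [Im (y $ 1 $ 1), Re (y $ 1 $ 2), Im (y $ 1 $ 2)]" for y
  define \<tau> :: "real^3 \<Rightarrow> cmat" where
    "\<tau> v = mat2 (\<i> * of_real (v $ 1)) (of_real (v $ 2) + \<i> * of_real (v $ 3))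
      (- (of_real (v $ 2) - \<i> * of_real (v $ 3))) (- \<i> * of_real (v $ 1))" for v
  let ?S = "sphere (0::real^3) 1" and ?e = "\<lambda>y. eigenspace y \<i>"
  have S: "v \<in> ?S \<longleftrightarrow> (v $ 1)\<^sup>2 + (v $ 2)\<^sup>2 + (v $ 3)\<^sup>2 = 1" for v
    by (simp add: norm_eq_1 inner_vec_def sum_3 power2_eq_square)
  have \<sigma>_smooth: "smooth_on T \<sigma>" for T
  proof -
    have *: "smooth_on T (\<lambda>y. if i = 1 then Im (y $ 1 $ 1) else if i = 2 then Re (y $ 1 $ 2) else Im (y $ 1 $ 2))"
      for i :: 3
      by (cases "i = 1"; cases "i = 2") auto
    have "smooth_on T (\<lambda>y. \<chi> i::3. if i = 1 then Im (y $ 1 $ 1) else if i = 2 then Re (y $ 1 $ 2)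
        else Im (y $ 1 $ 2))"
      by (rule smooth_on_vec_lambda[OF *])
    then show ?thesis
      by (rule smooth_on_eq) (simp add: \<sigma>_def vec_eq_iff forall_3)
  qed
  have \<tau>_smooth: "smooth_on T \<tau>" for T unfolding \<tau>_def[abs_def] by auto
  have \<tau>: "\<tau> v \<in> Orb" if "v \<in> ?S" for v
  proof (rule OrbI)
    have "complex_of_real ((v $ 1)\<^sup>2 + (v $ 2)\<^sup>2 + (v $ 3)\<^sup>2) = 1" using that S by simp
    then show "\<tau> v \<in> OrbC" by (simp add: \<tau>_def OrbC_iff algebra_simps power2_eq_square)
  qed (simp add: \<tau>_def)
  have \<sigma>: "\<sigma> y \<in> ?S" "\<tau> (\<sigma> y) = y" if "y \<in> Orb" for y
  proof -
    obtain t w where y: "y = mat2 (\<i> * complex_of_real t) w (- cnj w) (- \<i> * of_real t)"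
      using Orb_form[OF \<open>y \<in> Orb\<close>] .
    have "y \<in> OrbC" using \<open>y \<in> Orb\<close> Orb_subset_OrbC by blast
    then have "complex_of_real (t\<^sup>2 + (cmod w)\<^sup>2) = 1"
      unfolding of_real_add complex_norm_square by (simp add: y OrbC_iff power2_eq_square algebra_simps)
    then have "t\<^sup>2 + (cmod w)\<^sup>2 = 1" unfolding of_real_eq_1_iff .
    then show "\<sigma> y \<in> ?S" unfolding S by (simp add: \<sigma>_def y cmod_power2)
    show "\<tau> (\<sigma> y) = y" by (simp add: \<tau>_def \<sigma>_def y complex_eq_iff)
  qed
  have \<sigma>\<tau>: "\<sigma> (\<tau> v) = v" for v by (simp add: \<tau>_def \<sigma>_def vec_eq_iff forall_3)
  define s where "s l = \<sigma> (inv_into Orb ?e l)" for l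
  have "bij_betw \<sigma> Orb ?S"
    using \<sigma> \<tau> \<sigma>\<tau> by (intro bij_betw_byWitness[where f' = \<tau>]) auto
  moreover have eb: "bij_betw ?e Orb CP1" by (rule bij_betw_imageI[OF eigenspace_Orb_inj eigenspace_Orb_image])
  ultimately have bij: "bij_betw s CP1 ?S"
    using bij_betw_trans[OF bij_betw_inv_into[OF eb]] by (simp add: s_def[abs_def] o_def)
  have inv: "inv_into CP1 s v = ?e (\<tau> v)" if "v \<in> ?S" for v
  proof (rule inv_into_f_eq[OF bij_betw_imp_inj_on[OF bij]])
    show "?e (\<tau> v) \<in> CP1" using \<tau>[OF that] eigenspace_Orb_image by blast
    show "s (?e (\<tau> v)) = v" unfolding s_def inv_into_f_f[OF eigenspace_Orb_inj \<tau>[OF that]] by (rule \<sigma>\<tau>)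
  qed
  have "smooth_map CP1_atlas (emb ?S) s"
  proof (rule smooth_map_into_embI)
    show "s l \<in> ?S" if "l \<in> points CP1_atlas" for l
      using that bij unfolding points_CP1_atlas by (metis bij_betw_apply)
    show "smooth_on (\<phi> ` U) (\<lambda>t. s (inv_into U \<phi> t))" if "(U, \<phi>) \<in> CP1_atlas" for U \<phi>
      unfolding s_def by (rule smooth_on_compose[OF \<sigma>_smooth eigenspace_Orb_inv[OF that]]) (rule UNIV_I)
  qed
  moreover have "smooth_map (emb ?S) CP1_atlas (\<lambda>v. ?e (\<tau> v))"
  proof (rule smooth_map_from_embI)
    fix v assume v: "v \<in> ?S"
    obtain V \<psi> W where *: "(V, \<psi>) \<in> CP1_atlas" "open W" "\<tau> v \<in> W" "\<forall>q \<in> Orb \<inter> W. ?e q \<in> V"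
      "smooth_on (Orb \<inter> W) (\<lambda>t. \<psi> (?e t))"
      using eigenspace_Orb_smooth[OF \<tau>[OF v]] by blast
    have "open (\<tau> -` W)"
      using smooth_on_imp_continuous_on[OF \<tau>_smooth[of UNIV]] *(2) by (simp add: open_vimage)
    moreover have "smooth_on (?S \<inter> \<tau> -` W) (\<lambda>v. \<psi> (?e (\<tau> v)))"
      by (rule smooth_on_compose[OF *(5) \<tau>_smooth]) (use \<tau> in auto)
    ultimately show "\<exists>V \<psi> W. (V, \<psi>) \<in> CP1_atlas \<and> open W \<and> v \<in> W \<and>
        (\<forall>q\<in>?S \<inter> W. ?e (\<tau> q) \<in> V) \<and> smooth_on (?S \<inter> W) (\<lambda>t. \<psi> (?e (\<tau> t)))"
      using * \<tau> by (intro exI[of _ V] exI[of _ \<psi>] exI[of _ "\<tau> -` W"]) auto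
  qed
  then have "smooth_map (emb ?S) CP1_atlas (inv_into CP1 s)"
    by (rule smooth_map_cong[rotated]) (simp add: inv)
  ultimately have "diffeo CP1_atlas (emb ?S) s"
    unfolding diffeo_def points_emb points_CP1_atlas using bij by blast
  then show ?thesis by blast
qed

theorem theorem3:
  shows
    "diffeo (emb OrbC) complementary_lines_atlas (\<lambda>y. (eigenspace y \<i>, eigenspace y (- \<i>))) \<and>
     diffeo (emb Orb) CP1_atlas (\<lambda>y. eigenspace y \<i>) \<and>
     (\<exists>s. diffeo CP1_atlas (emb (sphere (0::real^3) 1)) s) \<and>
     (\<exists>\<pi>. smooth_fibre_bundle OrbC Orb OrbNC \<pi> \<and>
        (\<forall>h\<in>SU2. \<forall>y\<in>OrbC. \<pi> (Ad h y) = Ad h (\<pi> y)) \<and>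
        OrbC = {Ad (k ** f ** e) x0 | k f e. k \<in> SU2 \<and> f \<in> exp_im \<and> e \<in> exp_it} \<and>
        (\<forall>k\<in>SU2. \<forall>f\<in>exp_im. \<forall>e\<in>exp_it. \<pi> (Ad (k ** f ** e) x0) = Ad k x0) \<and>
        {y \<in> OrbC. \<pi> y = x0} = (\<lambda>f. Ad f x0) ` exp_im) \<and>
     (\<lambda>f. Ad f x0) ` exp_im = OrbNC \<and>
     (\<exists>\<eta>. diffeo (emb OrbNC) (emb (ball (0::complex) 1)) \<eta> \<and>
        (\<forall>a b. (cmod a)\<^sup>2 - (cmod b)\<^sup>2 = 1 \<longrightarrow>
           \<eta> (Ad (mat2 a b (cnj b) (cnj a)) x0) = b / cnj a)) \<and>
     (\<forall>z\<in>Orb. bij_betw (\<lambda>v. lie_bracket v z) {v. (z, v) \<in> T_Orb} (tangent_space Orb z)) \<and>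
     (\<exists>\<Phi>. diffeo (emb T_Orb) (emb OrbC) \<Phi> \<and>
        (\<forall>g\<in>SU2. \<forall>a\<in>mm. \<Phi> (Ad g x0, Ad g a) =
           g ** mexp (\<i> *\<^sub>M a) ** x0 ** mexp (- (\<i> *\<^sub>M a)) ** matrix_inv g) \<and>
        (\<forall>h\<in>SU2. \<forall>(z, v)\<in>T_Orb. \<Phi> (Ad h z, Ad h v) = Ad h (\<Phi> (z, v)))) \<and>
     complexification_of OrbC Orb"
proof (intro conjI)
  have "{y \<in> OrbC. unit_part y = x0} = (\<lambda>f. Ad f x0) ` exp_im"
    unfolding exp_im_orbit by (auto simp: unit_part_OrbNC)
  then show "\<exists>\<pi>. smooth_fibre_bundle OrbC Orb OrbNC \<pi> \<and>
        (\<forall>h\<in>SU2. \<forall>y\<in>OrbC. \<pi> (Ad h y) = Ad h (\<pi> y)) \<and>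
        OrbC = {Ad (k ** f ** e) x0 | k f e. k \<in> SU2 \<and> f \<in> exp_im \<and> e \<in> exp_it} \<and>
        (\<forall>k\<in>SU2. \<forall>f\<in>exp_im. \<forall>e\<in>exp_it. \<pi> (Ad (k ** f ** e) x0) = Ad k x0) \<and>
        {y \<in> OrbC. \<pi> y = x0} = (\<lambda>f. Ad f x0) ` exp_im"
    by (intro exI[of _ unit_part] conjI unit_part_fibre_bundle OrbC_Mostow ballI)
      (simp_all add: parts_Ad Mostow_unit_part)
  show "\<exists>\<Phi>. diffeo (emb T_Orb) (emb OrbC) \<Phi> \<and>
        (\<forall>g\<in>SU2. \<forall>a\<in>mm. \<Phi> (Ad g x0, Ad g a) =
           g ** mexp (\<i> *\<^sub>M a) ** x0 ** mexp (- (\<i> *\<^sub>M a)) ** matrix_inv g) \<and>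
        (\<forall>h\<in>SU2. \<forall>(z, v)\<in>T_Orb. \<Phi> (Ad h z, Ad h v) = Ad h (\<Phi> (z, v)))"
    using diffeo_phi phi_exp phi_Ad by (intro exI[of _ phi]) auto
qed (use OrbC_lines_diffeo Orb_CP1_diffeo CP1_sphere exp_im_orbit disk_diffeo lie_bracket_bij
  OrbC_complexification in blast)+

end
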